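(* Let $(X^+,T)$ be a transitive locally compact one-sided topological Markov shift over a countably infinite set of states $S$, let $\lambda>0$, and let $\phi:X^+\to\mathbb{R}$ be a $\lambda$-transient potential function with summable variations. Let $\mu\in\mathrm{Conf}(\lambda)$ and let $\nu$ be the unique finite Borel measure on $\mathcal{M}_m(\lambda)$ with $\mu=\int_{\mathcal{M}_m(\lambda)}\mu_\omega\,d\nu(\omega)$ (regarded as a measure on $\mathcal{M}(\lambda)$ carried by $\mathcal{M}_m(\lambda)$). Then: 1. For $\mu$-a.e. $x\in X^+$, the $\rho$-limit $\lim_{n\to\infty}T^nx$ exists and belongs to $\mathcal{M}_m(\lambda)$. 2. If $\mu=\mu_\omega$ for some $\omega\in\mathcal{M}_m(\lambda)$, then for $\mu_\omega$-a.e. $x\in X^+$, $T^nx\to\omega$ with respect to $\rho$. 3. For every Borel set $E\subseteq\mathcal{M}(\lambda)$, $$\nu(E)=\mu\{x\in[o]:\exists\,\omega\in E\text{ such that }T^nx\xrightarrow{\rho}\omega\}.$$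
   Context: Let $S$ be a countably infinite set and $\mathbb{A}\in\{0,1\}^{S\times S}$. The one-sided topological Markov shift (TMS) is $X^+=\{x\in S^{\mathbb{N}\cup\{0\}}:\mathbb{A}_{(x)_i,(x)_{i+1}}=1\ \forall i\ge 0\}$ with the shift $(Tx)_i=(x)_{i+1}$ and metric $d(x,y)=2^{-\inf\{i\ge0:(x)_i\ne(y)_i\}}$. Cylinders: $[a_0,\dots,a_m]=\{x\in X^+:(x)_i=a_i,\ 0\le i\le m\}$; a finite word is admissible if its cylinder is nonempty. Transitive: for all $a,b\in S$ there is $n\ge1$ with $T^{-n}[a]\cap[b]\neq\varnothing$. Locally compact: $\sum_b\mathbb{A}_{a,b}<\infty$ for every $a\in S$ (then cylinders are compact). $C_c(X^+)$ is the space of real continuous compactly supported functions and $C_c^+(X^+)$ its non-negative members. For $\phi:X^+\to\mathbb{R}$ let $Var_m(\phi)=\sup\{|\phi(x)-\phi(y)|:(x)_i=(y)_i,\ 0\le i\le m-1\}$; $\phi$ has summable variations if $\sum_{m\ge2}Var_m(\phi)<\infty$. Ruelle operator: $(L_\phi f)(x)=\sum_{y:Ty=x}e^{\phi(y)}f(y)$. Green's function: $G(f,x|\lambda)=\sum_{n\ge0}\lambda^{-n}(L_\phi^nf)(x)$. $\phi$ is $\lambda$-transient if $G(f,x|\lambda)<\infty$ for every (equivalently, some) $f\in C_c^+(X^+)\setminus\{0\}$ and $x\in X^+$. $\mathrm{Conf}(\lambda)$ is the set of positive Radon measures $\mu$ on $X^+$ with $L_\phi^*\mu=\lambda\mu$,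 i.e. $\int L_\phi 1_K\,d\mu=\lambda\mu(K)$ for every compact $K\subseteq X^+$. A measure $\mu\in\mathrm{Conf}(\lambda)$ is extremal if whenever $\mu=\mu_1+\mu_2$ with $\mu_1,\mu_2\in\mathrm{Conf}(\lambda)$, both $\mu_i$ are scalar multiples of $\mu$. Martin boundary: fix an origin state $o\in S$ and set $K(f,x|\lambda)=G(f,x|\lambda)/G(1_{[o]},x|\lambda)$ for $f\in C_c(X^+)$, $x\in X^+$. Let $\{w_i\}_{i\ge1}$ enumerate all admissible finite words and let $C_{i}>0$ be constants with $K(1_{[w_i]},x|\lambda)\le C_{i}$ for all $x\in X^+$ (such constants exist). Define the metric $$\rho(x,y)=\sum_{i\ge1}\frac{|K(1_{[w_i]},x|\lambda)-K(1_{[w_i]},y|\lambda)|+|1_{[w_i]}(x)-1_{[w_i]}(y)|}{2^i(C_i+1)}.$$ $\widehat{X^+}(\lambda)$ is the completion of $X^+$ with respect to $\rho$, and $\mathcal{M}(\lambda)=\widehat{X^+}(\lambda)\setminus X^+$. For each $f\in C_c(X^+)$, $K(f,\cdot|\lambda)$ extends uniquely to a $\rho$-continuous function on $\widehat{X^+}(\lambda)$, denoted by the same symbol. For $\omega\in\mathcal{M}(\lambda)$, $\mu_\omega$ is the measure $\mu_\omega(f)=K(f,\omega|\lambda)$, which belongs to $\mathrm{Conf}(\lambda)$. The $\lambda$-minimal Martin boundary is $\mathcal{M}_m(\lambda)=\{\omega\in\mathcal{M}(\lambda):\mu_\omega\text{ is extremal in }\mathrm{Conf}(\lambda)\}$,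 a Borel subset of $\mathcal{M}(\lambda)$. Every $\mu\in\mathrm{Conf}(\lambda)$ has a unique representation $\mu(f)=\int_{\mathcal{M}_m(\lambda)}K(f,\omega|\lambda)\,d\nu(\omega)$ ($f\in C_c(X^+)$) with $\nu$ a finite Borel measure on $\mathcal{M}_m(\lambda)$. *)

theory Defs
  imports "HOL-Analysis.Analysis"
begin

section \<open>One-sided topological Markov shifts\<close>

text \<open>The set of states is the universe of the type \<open>'s\<close>; the 0/1 matrix is the predicate \<open>A\<close>.\<close>

definition tms :: "('s \<Rightarrow> 's \<Rightarrow> bool) \<Rightarrow> (nat \<Rightarrow> 's) set" where
  "tms A = {x. \<forall>i. A (x i) (x (Suc i))}"

definition shift :: "(nat \<Rightarrow> 's) \<Rightarrow> nat \<Rightarrow> 's" where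
  "shift x = (\<lambda>i. x (Suc i))"

text \<open>The case distinction is the convention \<open>2\<close> to the power \<open>-\<infinity>\<close> is \<open>0\<close>.\<close>

definition seq_dist :: "(nat \<Rightarrow> 's) \<Rightarrow> (nat \<Rightarrow> 's) \<Rightarrow> real" where
  "seq_dist x y = (if x = y then 0 else (1 / 2) ^ (LEAST i. x i \<noteq> y i))"

lemma Metric_space_seq_dist: "Metric_space X seq_dist"
proof
  fix x y z :: "nat \<Rightarrow> 's"
  show "0 \<le> seq_dist x y" by (simp add: seq_dist_def)
  show "seq_dist x y = seq_dist y x" 
  proof -
    have "(\<lambda>i. x i \<noteq> y i) = (\<lambda>i. y i \<noteq> x i)" by auto
    then show ?thesis unfolding seq_dist_def by simp
  qed
  show "seq_dist x y = 0 \<longleftrightarrow> x = y" by (simp add: seq_dist_def)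
  show "seq_dist x z \<le> seq_dist x y + seq_dist y z"
  proof (cases "x = z \<or> x = y \<or> y = z")
    case True
    then show ?thesis by (auto simp: seq_dist_def)
  next
    case False
    define k where "k = (LEAST i. x i \<noteq> z i)"
    obtain j where "x j \<noteq> z j" using False by (meson ext)
    then have "x k \<noteq> z k" unfolding k_def by (rule LeastI)
    then have "x k \<noteq> y k \<or> y k \<noteq> z k" by auto
    then have "(LEAST i. x i \<noteq> y i) \<le> k \<or> (LEAST i. y i \<noteq> z i) \<le> k"
      by (auto intro: Least_le)
    then have "(1 / 2 :: real) ^ k \<le> (1 / 2) ^ (LEAST i. x i \<noteq> y i)
        \<or> (1 / 2 :: real) ^ k \<le> (1 / 2) ^ (LEAST i. y i \<noteq> z i)"
      by (auto intro: power_decreasing)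
    moreover have "seq_dist x z = (1 / 2) ^ k"
      "seq_dist x y = (1 / 2) ^ (LEAST i. x i \<noteq> y i)"
      "seq_dist y z = (1 / 2) ^ (LEAST i. y i \<noteq> z i)"
      using False by (auto simp: seq_dist_def k_def)
    moreover have "(0 :: real) \<le> (1 / 2) ^ (LEAST i. x i \<noteq> y i)"
      "(0 :: real) \<le> (1 / 2) ^ (LEAST i. y i \<noteq> z i)" by simp_all
    ultimately show ?thesis by linarith
  qed
qed

definition tms_top :: "('s \<Rightarrow> 's \<Rightarrow> bool) \<Rightarrow> (nat \<Rightarrow> 's) topology" where
  "tms_top A = Metric_space.mtopology (tms A) seq_dist"

definition cylinder :: "('s \<Rightarrow> 's \<Rightarrow> bool) \<Rightarrow> 's list \<Rightarrow> (nat \<Rightarrow> 's) set" where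
  "cylinder A w = {x \<in> tms A. \<forall>i < length w. x i = w ! i}"

definition admissible_words :: "('s \<Rightarrow> 's \<Rightarrow> bool) \<Rightarrow> 's list set" where
  "admissible_words A = {w. w \<noteq> [] \<and> cylinder A w \<noteq> {}}"

definition transitive_tms :: "('s \<Rightarrow> 's \<Rightarrow> bool) \<Rightarrow> bool" where
  "transitive_tms A \<longleftrightarrow>
    (\<forall>a b. \<exists>n\<ge>1. {x \<in> tms A. (shift ^^ n) x \<in> cylinder A [a]} \<inter> cylinder A [b] \<noteq> {})"

definition locally_compact_tms :: "('s \<Rightarrow> 's \<Rightarrow> bool) \<Rightarrow> bool" where
  "locally_compact_tms A \<longleftrightarrow> (\<forall>a. finite {b. A a b})"

text \<open>Functions on the shift space are represented by functions on all sequences; no definition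
  below depends on their values outside \<open>tms A\<close>.\<close>

definition Cc :: "('s \<Rightarrow> 's \<Rightarrow> bool) \<Rightarrow> ((nat \<Rightarrow> 's) \<Rightarrow> real) set" where
  "Cc A = {f. continuous_map (tms_top A) euclideanreal f \<and>
              compactin (tms_top A) (tms_top A closure_of {x \<in> tms A. f x \<noteq> 0})}"

definition Cc_nonneg :: "('s \<Rightarrow> 's \<Rightarrow> bool) \<Rightarrow> ((nat \<Rightarrow> 's) \<Rightarrow> real) set" where
  "Cc_nonneg A = {f \<in> Cc A. \<forall>x \<in> tms A. 0 \<le> f x}"


section \<open>Potentials, Ruelle operator, Green's function\<close>

definition variation :: "('s \<Rightarrow> 's \<Rightarrow> bool) \<Rightarrow> ((nat \<Rightarrow> 's) \<Rightarrow> real) \<Rightarrow> nat \<Rightarrow> ennreal" where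
  "variation A \<phi> m =
    (SUP (x, y) \<in> {(x, y). x \<in> tms A \<and> y \<in> tms A \<and> (\<forall>i<m. x i = y i)}. ennreal \<bar>\<phi> x - \<phi> y\<bar>)"

definition summable_variations :: "('s \<Rightarrow> 's \<Rightarrow> bool) \<Rightarrow> ((nat \<Rightarrow> 's) \<Rightarrow> real) \<Rightarrow> bool" where
  "summable_variations A \<phi> \<longleftrightarrow> (\<Sum>m. variation A \<phi> (m + 2)) < \<infinity>"

text \<open>A point may have infinitely many preimages, but a function with compact support vanishes
  outside finitely many one-letter cylinders, so on such functions the sum has only finitely many
  nonzero terms.\<close>

definition ruelle ::
  "('s \<Rightarrow> 's \<Rightarrow> bool) \<Rightarrow> ((nat \<Rightarrow> 's) \<Rightarrow> real) \<Rightarrow> ((nat \<Rightarrow> 's) \<Rightarrow> real) \<Rightarrow> (nat \<Rightarrow> 's) \<Rightarrow> real" where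
  "ruelle A \<phi> f x = (\<Sum>\<^sub>\<infinity>y\<in>{y \<in> tms A. shift y = x}. exp (\<phi> y) * f y)"

definition green_term ::
  "('s \<Rightarrow> 's \<Rightarrow> bool) \<Rightarrow> ((nat \<Rightarrow> 's) \<Rightarrow> real) \<Rightarrow> real \<Rightarrow> ((nat \<Rightarrow> 's) \<Rightarrow> real) \<Rightarrow> (nat \<Rightarrow> 's) \<Rightarrow> nat \<Rightarrow> real" where
  "green_term A \<phi> lam f x n = inverse lam ^ n * (ruelle A \<phi> ^^ n) f x"

definition green ::
  "('s \<Rightarrow> 's \<Rightarrow> bool) \<Rightarrow> ((nat \<Rightarrow> 's) \<Rightarrow> real) \<Rightarrow> real \<Rightarrow> ((nat \<Rightarrow> 's) \<Rightarrow> real) \<Rightarrow> (nat \<Rightarrow> 's) \<Rightarrow> real" where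
  "green A \<phi> lam f x = (\<Sum>n. green_term A \<phi> lam f x n)"

text \<open>For \<open>f \<ge> 0\<close> all terms of the series are non-negative, so finiteness of Green's function is
  summability.\<close>

definition transient :: "('s \<Rightarrow> 's \<Rightarrow> bool) \<Rightarrow> ((nat \<Rightarrow> 's) \<Rightarrow> real) \<Rightarrow> real \<Rightarrow> bool" where
  "transient A \<phi> lam \<longleftrightarrow>
    (\<forall>f \<in> Cc_nonneg A. (\<exists>z \<in> tms A. f z \<noteq> 0) \<longrightarrow>
      (\<forall>x \<in> tms A. summable (green_term A \<phi> lam f x)))"


section \<open>Conformal measures\<close>

definition borel_on :: "'a topology \<Rightarrow> 'a measure" where
  "borel_on X = sigma (topspace X) {U. openin X U}"

text \<open>The shift space of a locally compact shift over countably many states is locally compact,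
  separable and metrizable, so a Borel measure that is finite on compact sets is automatically
  regular.\<close>

definition radon_measure :: "('s \<Rightarrow> 's \<Rightarrow> bool) \<Rightarrow> (nat \<Rightarrow> 's) measure \<Rightarrow> bool" where
  "radon_measure A \<mu> \<longleftrightarrow> sets \<mu> = sets (borel_on (tms_top A)) \<and>
    (\<forall>K. compactin (tms_top A) K \<longrightarrow> emeasure \<mu> K < \<infinity>)"

definition Conf ::
  "('s \<Rightarrow> 's \<Rightarrow> bool) \<Rightarrow> ((nat \<Rightarrow> 's) \<Rightarrow> real) \<Rightarrow> real \<Rightarrow> (nat \<Rightarrow> 's) measure set" where
  "Conf A \<phi> lam = {\<mu>. radon_measure A \<mu> \<and>
    (\<forall>K. compactin (tms_top A) K \<longrightarrow>
      (\<integral>\<^sup>+ x. ennreal (ruelle A \<phi> (indicator K) x) \<partial>\<mu>) = ennreal lam * emeasure \<mu> K)}"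

definition extremal_Conf ::
  "('s \<Rightarrow> 's \<Rightarrow> bool) \<Rightarrow> ((nat \<Rightarrow> 's) \<Rightarrow> real) \<Rightarrow> real \<Rightarrow> (nat \<Rightarrow> 's) measure \<Rightarrow> bool" where
  "extremal_Conf A \<phi> lam \<mu> \<longleftrightarrow> \<mu> \<in> Conf A \<phi> lam \<and>
    (\<forall>\<mu>1 \<in> Conf A \<phi> lam. \<forall>\<mu>2 \<in> Conf A \<phi> lam.
      (\<forall>E \<in> sets \<mu>. emeasure \<mu> E = emeasure \<mu>1 E + emeasure \<mu>2 E) \<longrightarrow>
      (\<exists>c\<ge>0. \<mu>1 = scale_measure (ennreal c) \<mu>) \<and> (\<exists>c\<ge>0. \<mu>2 = scale_measure (ennreal c) \<mu>))"


section \<open>Martin boundary\<close>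

definition martin_kernel ::
  "('s \<Rightarrow> 's \<Rightarrow> bool) \<Rightarrow> ((nat \<Rightarrow> 's) \<Rightarrow> real) \<Rightarrow> real \<Rightarrow> 's \<Rightarrow> ((nat \<Rightarrow> 's) \<Rightarrow> real) \<Rightarrow> (nat \<Rightarrow> 's) \<Rightarrow> real" where
  "martin_kernel A \<phi> lam orig f x =
    green A \<phi> lam f x / green A \<phi> lam (indicator (cylinder A [orig])) x"

text \<open>The words are enumerated by the indices \<open>i \<ge> 1\<close>; \<open>w 0\<close> and \<open>C 0\<close> are not used.\<close>

definition martin_dist ::
  "('s \<Rightarrow> 's \<Rightarrow> bool) \<Rightarrow> ((nat \<Rightarrow> 's) \<Rightarrow> real) \<Rightarrow> real \<Rightarrow> 's \<Rightarrow> (nat \<Rightarrow> 's list) \<Rightarrow> (nat \<Rightarrow> real) \<Rightarrow>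
    (nat \<Rightarrow> 's) \<Rightarrow> (nat \<Rightarrow> 's) \<Rightarrow> real" where
  "martin_dist A \<phi> lam orig w C x y =
    (\<Sum>j. let i = Suc j; u = indicator (cylinder A (w i)) in
      (\<bar>martin_kernel A \<phi> lam orig u x - martin_kernel A \<phi> lam orig u y\<bar> + \<bar>u x - u y\<bar>)
        / (2 ^ i * (C i + 1)))"

text \<open>\<open>Xh\<close>, together with the isometry \<open>e\<close>, is a completion of the set \<open>X\<close> with the
  distance \<open>d\<close>. Completions are unique up to a unique isometry over \<open>X\<close>.\<close>

definition is_completion :: "'a set \<Rightarrow> ('a \<Rightarrow> 'a \<Rightarrow> real) \<Rightarrow> 'c metric \<Rightarrow> ('a \<Rightarrow> 'c) \<Rightarrow> bool" where
  "is_completion X d Xh e \<longleftrightarrow> mcomplete_of Xh \<and> e ` X \<subseteq> mspace Xh \<and>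
    (\<forall>x \<in> X. \<forall>y \<in> X. mdist Xh (e x) (e y) = d x y) \<and>
    mtopology_of Xh closure_of (e ` X) = mspace Xh"

definition martin_boundary :: "('s \<Rightarrow> 's \<Rightarrow> bool) \<Rightarrow> 'c metric \<Rightarrow> ((nat \<Rightarrow> 's) \<Rightarrow> 'c) \<Rightarrow> 'c set" where
  "martin_boundary A Xh e = mspace Xh - e ` tms A"

text \<open>The extension of the kernel is unique on the completion; extensionality only fixes its values
  outside of the completion.\<close>

definition martin_kernel_ext ::
  "('s \<Rightarrow> 's \<Rightarrow> bool) \<Rightarrow> ((nat \<Rightarrow> 's) \<Rightarrow> real) \<Rightarrow> real \<Rightarrow> 's \<Rightarrow> 'c metric \<Rightarrow> ((nat \<Rightarrow> 's) \<Rightarrow> 'c) \<Rightarrow>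
    ((nat \<Rightarrow> 's) \<Rightarrow> real) \<Rightarrow> 'c \<Rightarrow> real" where
  "martin_kernel_ext A \<phi> lam orig Xh e f =
    (THE g. g \<in> extensional (mspace Xh) \<and> continuous_map (mtopology_of Xh) euclideanreal g \<and>
            (\<forall>x \<in> tms A. g (e x) = martin_kernel A \<phi> lam orig f x))"

text \<open>The Radon measure that the Riesz representation theorem assigns to the positive linear
  functional given by the extended kernel at \<open>\<omega>\<close>.\<close>

definition martin_measure ::
  "('s \<Rightarrow> 's \<Rightarrow> bool) \<Rightarrow> ((nat \<Rightarrow> 's) \<Rightarrow> real) \<Rightarrow> real \<Rightarrow> 's \<Rightarrow> 'c metric \<Rightarrow> ((nat \<Rightarrow> 's) \<Rightarrow> 'c) \<Rightarrow>
    'c \<Rightarrow> (nat \<Rightarrow> 's) measure" where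
  "martin_measure A \<phi> lam orig Xh e \<omega> =
    (THE m. radon_measure A m \<and>
            (\<forall>f \<in> Cc A. (\<integral>x. f x \<partial>m) = martin_kernel_ext A \<phi> lam orig Xh e f \<omega>))"

definition minimal_boundary ::
  "('s \<Rightarrow> 's \<Rightarrow> bool) \<Rightarrow> ((nat \<Rightarrow> 's) \<Rightarrow> real) \<Rightarrow> real \<Rightarrow> 's \<Rightarrow> 'c metric \<Rightarrow> ((nat \<Rightarrow> 's) \<Rightarrow> 'c) \<Rightarrow> 'c set" where
  "minimal_boundary A \<phi> lam orig Xh e =
    {\<omega> \<in> martin_boundary A Xh e. extremal_Conf A \<phi> lam (martin_measure A \<phi> lam orig Xh e \<omega>)}"

text \<open>\<open>\<nu>\<close> is a finite Borel measure on the whole boundary, carried by the minimal boundary.\<close>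

definition represents ::
  "('s \<Rightarrow> 's \<Rightarrow> bool) \<Rightarrow> ((nat \<Rightarrow> 's) \<Rightarrow> real) \<Rightarrow> real \<Rightarrow> 's \<Rightarrow> 'c metric \<Rightarrow> ((nat \<Rightarrow> 's) \<Rightarrow> 'c) \<Rightarrow>
    'c measure \<Rightarrow> (nat \<Rightarrow> 's) measure \<Rightarrow> bool" where
  "represents A \<phi> lam orig Xh e \<nu> \<mu> \<longleftrightarrow>
    finite_measure \<nu> \<and>
    sets \<nu> = sets (borel_on (subtopology (mtopology_of Xh) (martin_boundary A Xh e))) \<and>
    (AE \<omega> in \<nu>. \<omega> \<in> minimal_boundary A \<phi> lam orig Xh e) \<and>
    (\<forall>f \<in> Cc A. (\<integral>x. f x \<partial>\<mu>) = (\<integral>\<omega>. martin_kernel_ext A \<phi> lam orig Xh e f \<omega> \<partial>\<nu>))"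

definition orbit_tends_to :: "'c metric \<Rightarrow> ((nat \<Rightarrow> 's) \<Rightarrow> 'c) \<Rightarrow> (nat \<Rightarrow> 's) \<Rightarrow> 'c \<Rightarrow> bool" where
  "orbit_tends_to Xh e x \<omega> \<longleftrightarrow>
    limitin (mtopology_of Xh) (\<lambda>n. e ((shift ^^ n) x)) \<omega> sequentially"

end

theory Submission
  imports Defs
begin

text \<open>
  By conformality, the mean over \<open>\<mu>\<close> of \<open>f\<close> times the number of visits of the orbit to a set is
  the integral of \<open>G(f, \<cdot>)\<close> over that set. Applied to the points of \<open>U\<close> that never return to \<open>U\<close>,
  this last-exit decomposition shows that an inequality \<open>G(f, \<cdot>) \<le> G(g, \<cdot>)\<close> on \<open>U\<close> forces
  \<open>\<integral>f \<le> \<integral>g\<close> over the points whose orbit hits \<open>U\<close>. If \<open>\<mu>\<close> is extremal, shift-invariant sets are null or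
  co-null; taking for \<open>U\<close> the super- and sublevel sets of the kernel \<open>K(1\<^sub>[\<^sub>u\<^sub>], \<cdot>)\<close> then gives
  \<open>K(1\<^sub>[\<^sub>u\<^sub>], T\<^sup>n x) \<rightarrow> \<mu>[u] / \<mu>[o]\<close> almost everywhere. Since orbits leave every
  compact set, \<open>T\<^sup>n x \<rightarrow> \<omega>\<close> holds \<open>\<mu>\<^sub>\<omega>\<close>-almost everywhere for every minimal \<open>\<omega>\<close>.
  The general case follows by integrating this over \<open>\<mu> = \<integral>\<mu>\<^sub>\<omega> d\<nu>(\<omega>)\<close>.
\<close>

section \<open>Topology of the shift space\<close>

text \<open>Extremality decides invariant events only, so level sets enter as sets visited
  infinitely often, which is invariant, and not as sets visited at least once, which is not. If
  {K(1_[u], .) > b} with b > mu[u] / mu[o] were visited infinitely often on a set that is not null,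
  then almost every orbit would hit it, and comparing b 1_[o] with 1_[u] would give b mu[o] \<le>
  mu[u]; sublevel sets are symmetric. The obstacle is that level sets spread over infinitely many
  letters, so an orbit need not have a last visit. Visits to one letter are almost surely finite in
  number, because bounded distortion makes G(1_[b], .) bounded on [a]. Hence the comparison is made
  for the part of U in finitely many letters and then passed to the limit. Cylinder kernels
  determine rho-limits here: the indicator terms of rho vanish once the orbit and a sequence
  approximating omega have left the letters involved. The Ruelle operator occurs twice: as a real
  operator on functions supported on finitely many letters, where Green's function is finite, and
  with values in [0, \<infinity>], where it applies to every non-negative function.\<close>

lemma shift_apply: "shift x i = x (Suc i)"
  by (simp add: shift_def)

lemma shift_pow: "(shift ^^ n) x = (\<lambda>i. x (n + i))"
  by (induction n arbitrary: x) (auto simp: shift_def)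

lemma shift_case_nat [simp]: "shift (case_nat a x) = x"
  by (simp add: shift_def)

lemma case_nat_shift: "case_nat (x 0) (shift x) = x"
  by (auto simp: fun_eq_iff shift_apply split: nat.split)

lemma shift_in_tms: "x \<in> tms A \<Longrightarrow> shift x \<in> tms A"
  by (simp add: tms_def shift_apply)

lemma shift_pow_in_tms: "x \<in> tms A \<Longrightarrow> (shift ^^ n) x \<in> tms A"
  by (simp add: tms_def shift_pow)

lemma case_nat_in_tms_iff: "case_nat a x \<in> tms A \<longleftrightarrow> A a (x 0) \<and> x \<in> tms A"
  unfolding tms_def by (auto split: nat.splits)

definition agree :: "nat \<Rightarrow> (nat \<Rightarrow> 's) \<Rightarrow> (nat \<Rightarrow> 's) \<Rightarrow> bool" where
  "agree n x y \<longleftrightarrow> (\<forall>i<n. x i = y i)"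

lemma agree_sym: "agree n x y \<Longrightarrow> agree n y x"
  by (simp add: agree_def)

lemma agree_mono: "agree n x y \<Longrightarrow> m \<le> n \<Longrightarrow> agree m x y"
  by (simp add: agree_def)

lemma agree_case_nat: "agree n x y \<Longrightarrow> agree (Suc n) (case_nat a x) (case_nat a y)"
  by (auto simp: agree_def split: nat.split)

text \<open>The inequality is strict, so the first disagreement lies beyond index \<open>n\<close>;
  this is why \<open>Suc n\<close> letters agree and not \<open>n\<close>.\<close>

lemma seq_dist_less_iff: "seq_dist x y < (1/2) ^ n \<longleftrightarrow> agree (Suc n) x y"
proof (cases "x = y")
  case True
  then show ?thesis by (simp add: seq_dist_def agree_def)
next
  case False
  define k where "k = (LEAST i. x i \<noteq> y i)"
  have k: "x k \<noteq> y k" unfolding k_def by (rule LeastI_ex) (use False in \<open>simp add: fun_eq_iff\<close>)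
  have min: "x i = y i" if "i < k" for i using that not_less_Least unfolding k_def by blast
  have "seq_dist x y < (1/2) ^ n \<longleftrightarrow> n < k"
    using False by (simp add: seq_dist_def k_def)
  also have "\<dots> \<longleftrightarrow> agree (Suc n) x y"
    unfolding agree_def using k min by (metis Suc_leI less_Suc_eq_le not_less order_le_less_trans)
  finally show ?thesis .
qed

definition pref :: "(nat \<Rightarrow> 's) \<Rightarrow> nat \<Rightarrow> 's list" where
  "pref x n = map x [0..<n]"

lemma in_cylinder_pref: "y \<in> cylinder A (pref x n) \<longleftrightarrow> y \<in> tms A \<and> agree n x y"
  by (auto simp: cylinder_def agree_def pref_def)

lemma cylinder_subset: "cylinder A u \<subseteq> tms A"
  by (auto simp: cylinder_def)

lemma in_letter: "x \<in> cylinder A [a] \<longleftrightarrow> x \<in> tms A \<and> x 0 = a"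
  by (auto simp: cylinder_def)

lemma cylinder_eq_pref: "x \<in> cylinder A u \<Longrightarrow> u = pref x (length u)"
  by (auto simp: cylinder_def pref_def intro: nth_equalityI)

lemma cylinder_agree: "x \<in> cylinder A u \<Longrightarrow> y \<in> tms A \<Longrightarrow> agree n x y \<Longrightarrow> length u \<le> n \<Longrightarrow> y \<in> cylinder A u"
  by (auto simp: cylinder_def agree_def)

lemma cylinder_agree_iff:
  "x \<in> tms A \<Longrightarrow> y \<in> tms A \<Longrightarrow> agree n x y \<Longrightarrow> length u \<le> n \<Longrightarrow> x \<in> cylinder A u \<longleftrightarrow> y \<in> cylinder A u"
  by (meson agree_sym cylinder_agree)

lemma topspace_tms_top [simp]: "topspace (tms_top A) = tms A"
  unfolding tms_top_def by (simp add: Metric_space.topspace_mtopology Metric_space_seq_dist)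

text \<open>Replaces the metric by agreement of prefixes, the form in which later continuity
  arguments on the shift space are carried out.\<close>

lemma openin_tms_top_iff:
  "openin (tms_top A) U \<longleftrightarrow> U \<subseteq> tms A \<and> (\<forall>x\<in>U. \<exists>n. \<forall>y\<in>tms A. agree n x y \<longrightarrow> y \<in> U)"
proof -
  interpret Metric_space "tms A" seq_dist by (rule Metric_space_seq_dist)
  have "(\<exists>r>0. mball x r \<subseteq> U) \<longleftrightarrow> (\<exists>n. \<forall>y\<in>tms A. agree n x y \<longrightarrow> y \<in> U)" if "x \<in> tms A" for x
  proof
    assume "\<exists>r>0. mball x r \<subseteq> U"
    then obtain r where r: "r > 0" "mball x r \<subseteq> U" by blast
    obtain n where n: "(1/2::real) ^ n < r" using real_arch_pow_inv[of r "1/2"] r by auto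
    have "y \<in> U" if "y \<in> tms A" "agree (Suc n) x y" for y
    proof -
      have "seq_dist x y < r" using seq_dist_less_iff[of x y n] that n by simp
      then show ?thesis using r that \<open>x \<in> tms A\<close> by (auto simp: mball_def)
    qed
    then show "\<exists>n. \<forall>y\<in>tms A. agree n x y \<longrightarrow> y \<in> U" by blast
  next
    assume "\<exists>n. \<forall>y\<in>tms A. agree n x y \<longrightarrow> y \<in> U"
    then obtain n where n: "\<And>y. y \<in> tms A \<Longrightarrow> agree n x y \<Longrightarrow> y \<in> U" by blast
    have "mball x ((1/2) ^ n) \<subseteq> U"
      using n seq_dist_less_iff[of x _ n] by (auto simp: mball_def agree_def)
    then show "\<exists>r>0. mball x r \<subseteq> U" by (meson half_gt_zero_iff zero_less_power zero_less_one)
  qed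
  then show ?thesis unfolding tms_top_def openin_mtopology by blast
qed

lemma openin_cylinder: "openin (tms_top A) (cylinder A u)"
  unfolding openin_tms_top_iff using cylinder_subset cylinder_agree by blast

lemma closedin_cylinder: "closedin (tms_top A) (cylinder A u)"
  unfolding closedin_def openin_tms_top_iff topspace_tms_top
proof (intro conjI ballI)
  fix x assume x: "x \<in> tms A - cylinder A u"
  have "y \<notin> cylinder A u" if "y \<in> tms A" "agree (length u) x y" for y
    using cylinder_agree_iff[of x A y "length u" u] x that by simp
  then show "\<exists>n. \<forall>y\<in>tms A. agree n x y \<longrightarrow> y \<in> tms A - cylinder A u" by blast
qed (auto simp: cylinder_subset)

lemma Hausdorff_tms_top: "Hausdorff_space (tms_top A)"
proof -
  interpret Metric_space "tms A" seq_dist by (rule Metric_space_seq_dist)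
  show ?thesis unfolding tms_top_def by (rule Hausdorff_space_mtopology)
qed

lemma compactin_tms_top_subset: "compactin (tms_top A) K \<Longrightarrow> K \<subseteq> tms A"
  using compactin_subset_topspace by fastforce

lemma compactin_finite_letters:
  assumes "compactin (tms_top A) K"
  obtains F where "finite F" "K \<subseteq> (\<Union>a\<in>F. cylinder A [a])"
proof -
  have "K \<subseteq> \<Union> (range (\<lambda>a. cylinder A [a]))"
    using compactin_tms_top_subset[OF assms] by (auto simp: in_letter)
  then obtain \<F> where \<F>: "finite \<F>" "\<F> \<subseteq> range (\<lambda>a. cylinder A [a])" "K \<subseteq> \<Union>\<F>"
    using assms openin_cylinder unfolding compactin_def by (elim conjE allE[of _ "range (\<lambda>a. cylinder A [a])"]) auto
  then obtain F where "finite F" "\<F> = (\<lambda>a. cylinder A [a]) ` F"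
    by (meson finite_subset_image)
  with \<F> that show ?thesis by auto
qed

text \<open>The one-sided shift carries the topology induced by the product of discrete topologies, so
  compactness of cylinders is Tychonoff's theorem applied to the finite sets of possible
  \<open>i\<close>-th letters.\<close>

lemma compactin_letter:
  assumes lc: "locally_compact_tms A"
  shows "compactin (tms_top A) (cylinder A [a])"
proof -
  define F where "F = rec_nat {a} (\<lambda>_ S. \<Union>s\<in>S. {b. A s b})"
  have F0: "F 0 = {a}" and FS: "F (Suc i) = (\<Union>s\<in>F i. {b. A s b})" for i
    by (simp_all add: F_def)
  have finF: "finite (F i)" for i
    using lc by (induction i) (auto simp: F0 FS locally_compact_tms_def)
  define P where "P = product_topology (\<lambda>_::nat. discrete_topology (UNIV::'a set)) UNIV"
  have comp: "compactin P (PiE UNIV F)"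
    unfolding P_def compactin_PiE by (simp add: finF compactin_discrete_topology)
  have proj: "continuous_map P (discrete_topology UNIV) (\<lambda>x. x i)" for i
    unfolding P_def by (rule continuous_map_product_projection) simp
  have topP: "topspace P = UNIV" by (simp add: P_def)
  have "closedin P {x. A (x i) (x (Suc i))}" for i
  proof -
    have "continuous_map P (prod_topology (discrete_topology UNIV) (discrete_topology UNIV))
            (\<lambda>x. (x i, x (Suc i)))"
      by (intro continuous_map_pairedI proj)
    then have "continuous_map P (discrete_topology UNIV) (\<lambda>x. (x i, x (Suc i)))"
      by (simp flip: prod_topology_discrete_topology)
    from closedin_continuous_map_preimage[OF this, of "{(s,t). A s t}"]
    show ?thesis by (simp add: topP)
  qed
  then have "closedin P (\<Inter>i. {x. A (x i) (x (Suc i))})" by (intro closedin_INT) auto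
  then have cl1: "closedin P (tms A)" by (simp add: tms_def Collect_all_eq[symmetric])
  have cyl: "cylinder A [a] = tms A \<inter> PiE UNIV F"
  proof -
    have "x i \<in> F i" if "x \<in> cylinder A [a]" for x i
      using that by (induction i) (auto simp: F0 FS in_letter tms_def)
    moreover have "x 0 = a" if "x \<in> PiE UNIV F" for x
      using PiE_mem[OF that, of 0] by (simp add: F0)
    ultimately show ?thesis by (auto simp: in_letter)
  qed
  have "compactin P (cylinder A [a])"
    unfolding cyl by (rule closed_Int_compactin[OF cl1 comp])
  then have "compactin (subtopology P (tms A)) (cylinder A [a])"
    by (simp add: compactin_subtopology cylinder_subset)
  moreover have "continuous_map (subtopology P (tms A)) (tms_top A) (\<lambda>x. x)"
    unfolding continuous_map_def
  proof (intro conjI allI impI)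
    fix U assume U: "openin (tms_top A) U"
    have agr: "openin P {y. agree n x y}" for n x
    proof -
      have "openin P {y. y i = x i}" for i
        using openin_continuous_map_preimage[OF proj, of "{x i}" i] by (simp add: topP)
      \<comment> \<open>For \<open>n = 0\<close> the index set is empty and the rule for finite
        intersections does not apply; that case is settled by
        \<open>openin_topspace\<close>.\<close>
      then have "openin P (\<Inter>i\<in>{..<n}. {y. y i = x i}) \<or> n = 0"
        by (cases n) (auto intro!: openin_INT2)
      moreover have "(\<Inter>i\<in>{..<n}. {y. y i = x i}) = {y. agree n x y}" by (auto simp: agree_def)
      moreover have "openin P {y. agree 0 x y}" using openin_topspace[of P] by (simp add: topP agree_def)
      ultimately show ?thesis by auto
    qed
    define V where "V = \<Union>{W. openin P W \<and> W \<inter> tms A \<subseteq> U}"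
    have "openin P V" unfolding V_def by auto
    moreover have "V \<inter> tms A = U"
    proof
      show "V \<inter> tms A \<subseteq> U" by (auto simp: V_def)
      show "U \<subseteq> V \<inter> tms A"
      proof
        fix x assume x: "x \<in> U"
        then obtain n where n: "\<forall>y\<in>tms A. agree n x y \<longrightarrow> y \<in> U" and xt: "x \<in> tms A"
          using U unfolding openin_tms_top_iff by blast
        have "x \<in> {y. agree n x y}" by (simp add: agree_def)
        moreover have "{y. agree n x y} \<inter> tms A \<subseteq> U" using n by auto
        ultimately show "x \<in> V \<inter> tms A" unfolding V_def using agr[of n x] xt by blast
      qed
    qed
    ultimately have "openin (subtopology P (tms A)) U" unfolding openin_subtopology by metis
    moreover have "{x \<in> topspace (subtopology P (tms A)). x \<in> U} = U"
      using U openin_subset by (fastforce simp: topP)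
    ultimately show "openin (subtopology P (tms A)) {x \<in> topspace (subtopology P (tms A)). x \<in> U}"
      by simp
  qed (auto simp: topP)
  ultimately show ?thesis using image_compactin by fastforce
qed

lemma compactin_cylinder:
  assumes "locally_compact_tms A" "u \<noteq> []"
  shows "compactin (tms_top A) (cylinder A u)"
proof -
  have "cylinder A u \<subseteq> cylinder A [hd u]"
    using assms(2) by (auto simp: cylinder_def hd_conv_nth)
  then show ?thesis
    using closed_compactin compactin_letter[OF assms(1)] closedin_cylinder by blast
qed

section \<open>Cylinders as a generator of the Borel sets\<close>

lemma cylinder_Int:
  "cylinder A u \<inter> cylinder A v = {} \<or> cylinder A u \<inter> cylinder A v = cylinder A u
    \<or> cylinder A u \<inter> cylinder A v = cylinder A v"
proof -
  have *: "cylinder A v \<subseteq> cylinder A u" if "x \<in> cylinder A u" "x \<in> cylinder A v" "length u \<le> length v" for x u v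
  proof
    fix y assume y: "y \<in> cylinder A v"
    have "agree (length v) x y" using y that(2) by (auto simp: cylinder_def agree_def)
    then show "y \<in> cylinder A u" using cylinder_agree that y cylinder_subset by blast
  qed
  show ?thesis
    using * linear[of "length u" "length v"] by blast
qed

text \<open>The cylinder of the empty word is all of \<open>tms A\<close>, which need not be compact
  or have finite measure, so that word is left out. The empty set is added to make the family stable
  under intersection.\<close>

definition cyls :: "('s \<Rightarrow> 's \<Rightarrow> bool) \<Rightarrow> (nat \<Rightarrow> 's) set set" where
  "cyls A = insert {} (cylinder A ` {u. u \<noteq> []})"

lemma Int_stable_cyls: "Int_stable (cyls A)"
proof (rule Int_stableI)
  fix a b assume "a \<in> cyls A" "b \<in> cyls A"
  then consider "a \<inter> b = {}" | u v where "a = cylinder A u" "b = cylinder A v" "u \<noteq> []" "v \<noteq> []"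
    by (auto simp: cyls_def)
  then show "a \<inter> b \<in> cyls A"
  proof cases
    case 2
    then show ?thesis using cylinder_Int[of A u v] by (auto simp: cyls_def)
  qed (simp add: cyls_def)
qed

lemma space_borel_on: "space (borel_on T) = topspace T"
  unfolding borel_on_def by (intro space_measure_of) (auto dest: openin_subset)

lemma sets_borel_on: "sets (borel_on T) = sigma_sets (topspace T) {U. openin T U}"
  unfolding borel_on_def by (intro sets_measure_of) (auto dest: openin_subset)

lemma openin_in_borel_on: "openin T U \<Longrightarrow> U \<in> sets (borel_on T)"
  by (simp add: sets_borel_on)

lemma closedin_in_borel_on: "closedin T U \<Longrightarrow> U \<in> sets (borel_on T)"
proof -
  assume "closedin T U"
  then have "topspace T - (topspace T - U) \<in> sets (borel_on T)"
    unfolding sets_borel_on closedin_def by (intro sigma_sets.Compl sigma_sets.Basic) auto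
  moreover have "topspace T - (topspace T - U) = U" using \<open>closedin T U\<close> closedin_subset by fastforce
  ultimately show ?thesis by simp
qed

text \<open>An open set is the union of the cylinders it contains, and over countably many states
  there are only countably many cylinders.\<close>

lemma sets_tms_borel:
  assumes "countable (UNIV :: 's set)"
  shows "sets (borel_on (tms_top (A :: 's \<Rightarrow> 's \<Rightarrow> bool))) = sigma_sets (tms A) (cyls A)"
proof -
  have "U \<in> sigma_sets (tms A) (cyls A)" if U: "openin (tms_top A) U" for U
  proof -
    have "U = \<Union> {c \<in> cyls A. c \<subseteq> U}"
    proof
      show "U \<subseteq> \<Union> {c \<in> cyls A. c \<subseteq> U}"
      proof
        fix x assume x: "x \<in> U"
        then obtain n where n: "\<forall>y\<in>tms A. agree n x y \<longrightarrow> y \<in> U" and xt: "x \<in> tms A"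
          using U unfolding openin_tms_top_iff by blast
        have "cylinder A (pref x (Suc n)) \<subseteq> U"
          using n agree_mono[of "Suc n" x _ n] by (auto simp: in_cylinder_pref)
        moreover have "x \<in> cylinder A (pref x (Suc n))" using xt by (simp add: in_cylinder_pref agree_def)
        moreover have "cylinder A (pref x (Suc n)) \<in> cyls A" by (auto simp: cyls_def pref_def)
        ultimately show "x \<in> \<Union> {c \<in> cyls A. c \<subseteq> U}" by blast
      qed
    qed auto
    moreover have "countable {c \<in> cyls A. c \<subseteq> U}"
    proof -
      have "countable (cylinder A ` {u. u \<noteq> []})"
        using countable_lists[OF assms] by (intro countable_image) (rule countable_subset[of _ "lists UNIV"], auto)
      then have "countable (cyls A)" by (simp add: cyls_def)
      then show ?thesis by (rule countable_subset[rotated]) auto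
    qed
    then have "\<Union> {c \<in> cyls A. c \<subseteq> U} \<in> sigma_sets (tms A) (cyls A)"
      by (rule sigma_sets_UNION) auto
    ultimately show ?thesis by simp
  qed
  moreover have "c \<in> sigma_sets (tms A) {U. openin (tms_top A) U}" if "c \<in> cyls A" for c
    using that openin_cylinder by (auto simp: cyls_def sigma_sets.Empty intro: sigma_sets.Basic)
  ultimately show ?thesis
    unfolding sets_borel_on topspace_tms_top
    by (intro sigma_sets_eqI) auto
qed

section \<open>The Ruelle operator on functions supported on finitely many letters\<close>

locale transient_tms =
  fixes A :: "'s \<Rightarrow> 's \<Rightarrow> bool" and \<phi> :: "(nat \<Rightarrow> 's) \<Rightarrow> real" and lam :: real and orig :: 's
  assumes countable_states: "countable (UNIV :: 's set)"
    and transitive: "transitive_tms A"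
    and locally_compact: "locally_compact_tms A"
    and lam_pos: "lam > 0"
    and summable_var: "summable_variations A \<phi>"
    and transient_potential: "transient A \<phi> lam"
begin

abbreviation "X \<equiv> tms A"
abbreviation "cyl \<equiv> cylinder A"
abbreviation "B \<equiv> borel_on (tms_top A)"
abbreviation "L \<equiv> ruelle A \<phi>"
abbreviation "one u \<equiv> (indicator (cyl u) :: (nat \<Rightarrow> 's) \<Rightarrow> real)"
abbreviation "G \<equiv> green A \<phi> lam"
abbreviation "GR \<equiv> green_term A \<phi> lam"
abbreviation "K \<equiv> martin_kernel A \<phi> lam orig"

text \<open>Stands in for compact support: it makes the sum in \<open>ruelle\<close> finite and
  survives an application of \<open>L\<close>, so the algebra of iterates needs neither continuity
  nor summability.\<close>

definition supported :: "'s set \<Rightarrow> ((nat \<Rightarrow> 's) \<Rightarrow> real) \<Rightarrow> bool" where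
  "supported F f \<longleftrightarrow> finite F \<and> (\<forall>x\<in>X. x 0 \<notin> F \<longrightarrow> f x = 0)"

lemma preimages_eq:
  "x \<in> X \<Longrightarrow> {y \<in> X. shift y = x} = (\<lambda>a. case_nat a x) ` {a. A a (x 0)}"
proof safe
  fix y assume y: "y \<in> X"
  show "y \<in> (\<lambda>a. case_nat a (shift y)) ` {a. A a (shift y 0)}"
    using y case_nat_shift[of y] by (intro image_eqI[of _ _ "y 0"]) (auto simp: tms_def shift_apply)
qed (auto simp: case_nat_in_tms_iff)

lemma ruelle_sum:
  assumes "supported F f" "x \<in> X"
  shows "L f x = (\<Sum>a\<in>{a\<in>F. A a (x 0)}. exp (\<phi> (case_nat a x)) * f (case_nat a x))"
proof -
  have inj: "inj_on (\<lambda>a. case_nat a x) {a. A a (x 0)}"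
    by (auto simp: inj_on_def fun_eq_iff split: nat.splits)
  have "L f x = infsum ((\<lambda>y. exp (\<phi> y) * f y) \<circ> (\<lambda>a. case_nat a x)) {a. A a (x 0)}"
    unfolding ruelle_def preimages_eq[OF assms(2)] by (rule infsum_reindex[OF inj])
  also have "\<dots> = infsum ((\<lambda>y. exp (\<phi> y) * f y) \<circ> (\<lambda>a. case_nat a x)) {a\<in>F. A a (x 0)}"
    using assms by (intro infsum_cong_neutral) (auto simp: supported_def case_nat_in_tms_iff)
  also have "\<dots> = (\<Sum>a\<in>{a\<in>F. A a (x 0)}. exp (\<phi> (case_nat a x)) * f (case_nat a x))"
    using assms by (simp add: infsum_finite supported_def)
  finally show ?thesis .
qed

text \<open>A point outside \<open>X\<close> has no preimage in \<open>X\<close>. This makes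
  linearity an equality of functions on all sequences, which can be substituted into the next
  iterate.\<close>

lemma ruelle_outside: "x \<notin> X \<Longrightarrow> L f x = 0"
proof -
  assume "x \<notin> X"
  then have "{y \<in> X. shift y = x} = {}" using shift_in_tms by auto
  then show ?thesis unfolding ruelle_def by (simp only: infsum_empty)
qed

text \<open>A preimage of \<open>x\<close> that starts in \<open>F\<close> forces \<open>x 0\<close>
  to be a successor of a letter of \<open>F\<close>, and local compactness leaves finitely many of
  these.\<close>

lemma supported_ruelle: "supported F f \<Longrightarrow> supported (\<Union>a\<in>F. {b. A a b}) (L f)"
  unfolding supported_def
proof (intro conjI ballI impI)
  assume f: "finite F \<and> (\<forall>x\<in>X. x 0 \<notin> F \<longrightarrow> f x = 0)"
  then show "finite (\<Union>a\<in>F. {b. A a b})" using locally_compact by (auto simp: locally_compact_tms_def)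
  fix x assume x: "x \<in> X" "x 0 \<notin> (\<Union>a\<in>F. {b. A a b})"
  have empty: "{a\<in>F. A a (x 0)} = {}" using x by auto
  have "supported F f" using f by (simp add: supported_def)
  from ruelle_sum[OF this x(1)] show "L f x = 0" unfolding empty by simp
qed

lemma supported_mono: "supported F f \<Longrightarrow> F \<subseteq> F' \<Longrightarrow> finite F' \<Longrightarrow> supported F' f"
  by (auto simp: supported_def)

lemma supported_pow: "supported F f \<Longrightarrow> \<exists>F'. supported F' ((L ^^ n) f)"
  by (induction n) (auto dest: supported_ruelle)

lemma supported_lincomb:
  "supported F f \<Longrightarrow> supported F' g \<Longrightarrow> supported (F \<union> F') (\<lambda>x. c * f x + g x)"
  by (auto simp: supported_def)

lemma ruelle_lincomb:
  assumes "supported F f" "supported F' g"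
  shows "L (\<lambda>x. c * f x + g x) = (\<lambda>x. c * L f x + L g x)"
proof
  fix x
  show "L (\<lambda>x. c * f x + g x) x = c * L f x + L g x"
  proof (cases "x \<in> X")
    case True
    have fin: "finite (F \<union> F')" using assms by (auto simp: supported_def)
    have "supported (F \<union> F') f" "supported (F \<union> F') g"
      using assms fin by (auto intro: supported_mono)
    then show ?thesis
      using supported_lincomb[OF assms, of c] True
      by (simp add: ruelle_sum sum.distrib sum_distrib_left algebra_simps)
  qed (simp add: ruelle_outside)
qed

lemma ruelle_pow_lincomb:
  assumes "supported F f" "supported F' g"
  shows "(L ^^ n) (\<lambda>x. c * f x + g x) = (\<lambda>x. c * (L ^^ n) f x + (L ^^ n) g x)"
proof (induction n)
  case (Suc n)
  obtain F1 F2 where "supported F1 ((L ^^ n) f)" "supported F2 ((L ^^ n) g)"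
    using supported_pow assms by meson
  from ruelle_lincomb[OF this, of c] show ?case using Suc by simp
qed simp

lemma ruelle_mono:
  assumes "supported F f" "supported F' g" "\<And>x. x \<in> X \<Longrightarrow> f x \<le> g x" "x \<in> X"
  shows "L f x \<le> L g x"
proof -
  have fin: "finite (F \<union> F')" using assms by (auto simp: supported_def)
  have "supported (F \<union> F') f" "supported (F \<union> F') g"
    using assms fin by (auto intro: supported_mono)
  then show ?thesis
    using assms(3,4) by (auto simp: ruelle_sum case_nat_in_tms_iff intro!: sum_mono)
qed

lemma ruelle_pow_mono:
  assumes "supported F f" "supported F' g" "\<And>x. x \<in> X \<Longrightarrow> f x \<le> g x" "x \<in> X"
  shows "(L ^^ n) f x \<le> (L ^^ n) g x"
  using assms(4)
proof (induction n arbitrary: x)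
  case (Suc n)
  obtain F1 F2 where "supported F1 ((L ^^ n) f)" "supported F2 ((L ^^ n) g)"
    using supported_pow assms by meson
  from ruelle_mono[OF this] show ?case using Suc by simp
qed (use assms in simp)

lemma supported_zero: "supported {} (\<lambda>_. 0)"
  by (simp add: supported_def)

lemma ruelle_pow_zero: "(L ^^ n) (\<lambda>_. 0) = (\<lambda>_. 0)"
proof -
  have "(L ^^ n) (\<lambda>x. 1 * 0 + 0) = (\<lambda>x. 1 * (L ^^ n) (\<lambda>_. 0) x + (L ^^ n) (\<lambda>_. 0) x)"
    by (rule ruelle_pow_lincomb[OF supported_zero supported_zero])
  then show ?thesis by (simp add: fun_eq_iff)
qed

lemma ruelle_pow_nonneg:
  assumes "supported F f" "\<And>x. x \<in> X \<Longrightarrow> 0 \<le> f x" "x \<in> X"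
  shows "0 \<le> (L ^^ n) f x"
  using ruelle_pow_mono[OF supported_zero assms(1), of x n] assms by (simp add: ruelle_pow_zero)

lemma supported_one: "u \<noteq> [] \<Longrightarrow> supported {hd u} (one u)"
  by (auto simp: supported_def cylinder_def hd_conv_nth indicator_def)

section \<open>Finiteness of Green's function\<close>

text \<open>Contains the indicators of compact sets and all of \<open>Cc A\<close>. Boundedness
  allows domination by a multiple of the indicator of finitely many letters, whose Green's function
  is finite by transience.\<close>

definition nice :: "((nat \<Rightarrow> 's) \<Rightarrow> real) \<Rightarrow> bool" where
  "nice f \<longleftrightarrow> (\<exists>F. supported F f) \<and> (\<exists>c. \<forall>x\<in>X. \<bar>f x\<bar> \<le> c)"

lemma indicator_in_Cc_nonneg:
  assumes "openin (tms_top A) U" "compactin (tms_top A) U"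
  shows "indicator U \<in> Cc_nonneg A"
proof -
  have cl: "closedin (tms_top A) U"
    using compactin_imp_closedin[OF Hausdorff_tms_top assms(2)] .
  have sub: "U \<subseteq> X" using compactin_tms_top_subset assms(2) by blast
  have "openin (tms_top A) {x \<in> topspace (tms_top A). indicator U x \<in> V}" for V :: "real set"
  proof -
    have "{x \<in> topspace (tms_top A). indicator U x \<in> V} =
      (if 1 \<in> V then U else {}) \<union> (if 0 \<in> V then topspace (tms_top A) - U else {})"
      using sub by (auto simp: indicator_def)
    then show ?thesis using assms(1) cl using openin_topspace[of "tms_top A"]
      by (auto simp: closedin_def Un_absorb1 simp del: openin_topspace intro!: openin_Un)
  qed
  then have "continuous_map (tms_top A) euclideanreal (indicator U)"
    by (simp add: continuous_map_def)
  moreover have "{x \<in> X. indicator U x \<noteq> (0::real)} = U" using sub by (auto simp: indicator_def)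
  moreover have "tms_top A closure_of U = U" using cl by (simp add: closure_of_eq)
  ultimately show ?thesis using assms(2) by (simp add: Cc_nonneg_def Cc_def)
qed

lemma letter_nonempty: "cyl [a] \<noteq> {}"
  using transitive unfolding transitive_tms_def by blast

abbreviation "letters F \<equiv> (\<Union>a\<in>F. cyl [a])"

lemma indicator_letters:
  "finite F \<Longrightarrow> openin (tms_top A) (letters F) \<and> compactin (tms_top A) (letters F)"
  by (auto intro!: openin_Union compactin_Union compactin_letter locally_compact openin_cylinder)

text \<open>The letter \<open>orig\<close> is added so that the indicator is not the zero function,
  which \<open>transient\<close> excludes.\<close>

lemma summable_GT_letters:
  assumes "finite F" "x \<in> X"
  shows "summable (GR (indicator (\<Union>a\<in>insert orig F. cyl [a])) x)"
proof -
  define U where "U = (\<Union>a\<in>insert orig F. cyl [a])"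
  obtain z where "z \<in> cyl [orig]" using letter_nonempty by blast
  then have "z \<in> X \<and> z \<in> U" using cylinder_subset unfolding U_def by blast
  then have "\<exists>z\<in>X. indicator U z \<noteq> (0::real)" by (intro bexI[of _ z]) auto
  moreover have "indicator U \<in> Cc_nonneg A"
    unfolding U_def using indicator_letters[of "insert orig F"] assms by (intro indicator_in_Cc_nonneg) auto
  ultimately show ?thesis
    using transient_potential assms(2) unfolding transient_def U_def by blast
qed

lemma supported_letters: "finite F \<Longrightarrow> supported F (indicator (letters F))"
  by (auto simp: supported_def in_letter indicator_def)

lemma summable_GT:
  assumes "nice f" "x \<in> X"
  shows "summable (GR f x)"
proof -
  obtain F c where F: "supported F f" and c: "\<And>x. x \<in> X \<Longrightarrow> \<bar>f x\<bar> \<le> c"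
    using assms unfolding nice_def by blast
  define U where "U = (\<Union>a\<in>insert orig F. cyl [a])"
  define h where "h = (indicator U :: _ \<Rightarrow> real)"
  have fin: "finite (insert orig F)" using F by (simp add: supported_def)
  have h: "supported (insert orig F) h"
    unfolding h_def U_def using fin by (rule supported_letters)
  have c0: "c \<ge> 0" using c[OF assms(2)] by linarith
  have bd: "\<bar>f y\<bar> \<le> c * h y" if "y \<in> X" for y
  proof (cases "y 0 \<in> F")
    case True
    then show ?thesis using c that by (auto simp: h_def U_def in_letter indicator_def)
  next
    case False
    then show ?thesis using F that c0 by (simp add: supported_def h_def)
  qed
  have ch: "supported (insert orig F) (\<lambda>x. c * h x)" "supported (insert orig F) (\<lambda>x. (-c) * h x)"
    using h by (auto simp: supported_def)
  have eq: "(L ^^ n) (\<lambda>x. d * h x) = (\<lambda>x. d * (L ^^ n) h x)" for n d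
    using ruelle_pow_lincomb[OF h supported_zero, of n d] by (simp add: ruelle_pow_zero)
  have "norm (GR f x n) \<le> c * GR h x n" for n
  proof -
    have "(L ^^ n) f x \<le> (L ^^ n) (\<lambda>x. c * h x) x"
      using bd by (intro ruelle_pow_mono[OF F ch(1)] assms) (meson abs_le_D1)
    moreover have "(L ^^ n) (\<lambda>x. (-c) * h x) x \<le> (L ^^ n) f x"
      using bd by (intro ruelle_pow_mono[OF ch(2) F] assms) (metis abs_le_D2 minus_le_iff mult_minus_left)
    ultimately have "\<bar>(L ^^ n) f x\<bar> \<le> c * (L ^^ n) h x" using eq[of n c] eq[of n "-c"] by (simp add: abs_le_iff)
    then have "inverse lam ^ n * \<bar>(L ^^ n) f x\<bar> \<le> inverse lam ^ n * (c * (L ^^ n) h x)"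
      using lam_pos by (intro mult_left_mono) auto
    then show ?thesis using lam_pos by (simp add: green_term_def abs_mult algebra_simps)
  qed
  moreover have "summable (\<lambda>n. c * GR h x n)"
    unfolding h_def U_def using summable_GT_letters[OF _ assms(2), of F] F
    by (intro summable_mult) (auto simp: supported_def)
  ultimately show ?thesis by (rule summable_comparison_test'[where N=0, rotated])
qed

lemma nice_lincomb: "nice f \<Longrightarrow> nice g \<Longrightarrow> nice (\<lambda>x. c * f x + g x)"
proof -
  assume f: "nice f" and g: "nice g"
  obtain F c1 F' c2 where *: "supported F f" "supported F' g" and
    c: "\<And>x. x \<in> X \<Longrightarrow> \<bar>f x\<bar> \<le> c1" "\<And>x. x \<in> X \<Longrightarrow> \<bar>g x\<bar> \<le> c2"
    using f g unfolding nice_def by blast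
  have "\<bar>c * f x + g x\<bar> \<le> \<bar>c\<bar> * c1 + c2" if "x \<in> X" for x
  proof -
    have "\<bar>c * f x + g x\<bar> \<le> \<bar>c\<bar> * \<bar>f x\<bar> + \<bar>g x\<bar>" by (metis abs_mult abs_triangle_ineq)
    also have "\<dots> \<le> \<bar>c\<bar> * c1 + c2" using c[OF that] by (intro add_mono mult_left_mono) auto
    finally show ?thesis .
  qed
  then show ?thesis unfolding nice_def using supported_lincomb[OF *, of c] by blast
qed

lemma nice_zero: "nice (\<lambda>_. 0)"
  unfolding nice_def using supported_zero by auto

lemma nice_indicator:
  assumes "compactin (tms_top A) U"
  shows "nice (indicator U)"
proof -
  obtain F where "finite F" "U \<subseteq> letters F"
    using compactin_finite_letters[OF assms] .
  then have "supported F (indicator U)"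
    by (auto simp: supported_def indicator_def in_letter)
  then show ?thesis unfolding nice_def by (auto intro!: exI[of _ 1] simp: indicator_def)
qed

lemma nice_one: "u \<noteq> [] \<Longrightarrow> nice (one u)"
  by (intro nice_indicator compactin_cylinder locally_compact)

lemma green_lincomb:
  assumes "nice f" "nice g" "x \<in> X"
  shows "G (\<lambda>x. c * f x + g x) x = c * G f x + G g x"
proof -
  obtain F F' where *: "supported F f" "supported F' g" using assms unfolding nice_def by blast
  have "GR (\<lambda>x. c * f x + g x) x = (\<lambda>n. c * GR f x n + GR g x n)"
    unfolding green_term_def ruelle_pow_lincomb[OF *] by (simp add: fun_eq_iff algebra_simps)
  then show ?thesis
    unfolding green_def using summable_GT assms
    by (simp add: suminf_add[symmetric] suminf_mult summable_mult)
qed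

lemma green_mono:
  assumes "nice f" "nice g" "\<And>y. y \<in> X \<Longrightarrow> f y \<le> g y" "x \<in> X"
  shows "G f x \<le> G g x"
proof -
  obtain F F' where *: "supported F f" "supported F' g" using assms unfolding nice_def by blast
  show ?thesis unfolding green_def
    using ruelle_pow_mono[OF * assms(3,4)] lam_pos
    by (intro suminf_le summable_GT assms) (auto simp: green_term_def intro!: mult_left_mono)
qed

lemma green_zero: "G (\<lambda>_. 0) x = 0"
  by (simp add: green_def green_term_def ruelle_pow_zero)

text \<open>Positivity is carried along the orbit of \<open>y\<close>: the branch through the
  previous orbit point is one of the non-negative terms of the sum and is itself positive.\<close>

lemma ruelle_pow_pos:
  assumes "supported F f" "\<And>x. x \<in> X \<Longrightarrow> 0 \<le> f x" "f y > 0" "y \<in> X"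
  shows "(L ^^ n) f ((shift ^^ n) y) > 0"
proof (induction n)
  case (Suc n)
  define z where "z = (shift ^^ n) y"
  have z: "z \<in> X" unfolding z_def using assms shift_pow_in_tms by blast
  have sz: "shift z \<in> X" using z by (rule shift_in_tms)
  obtain F1 where F1: "supported F1 ((L ^^ n) f)" using supported_pow assms by meson
  have pos: "(L ^^ n) f z > 0" using Suc unfolding z_def .
  have nn: "(L ^^ n) f x \<ge> 0" if "x \<in> X" for x using ruelle_pow_nonneg assms that by meson
  have "z 0 \<in> F1" using F1 pos z unfolding supported_def by fastforce
  then have mem: "z 0 \<in> {a \<in> F1. A a (shift z 0)}" using z by (auto simp: tms_def shift_apply)
  have "0 < exp (\<phi> z) * (L ^^ n) f z" using pos by simp
  also have "\<dots> = exp (\<phi> (case_nat (z 0) (shift z))) * (L ^^ n) f (case_nat (z 0) (shift z))"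
    by (simp add: case_nat_shift)
  also have "\<dots> \<le> L ((L ^^ n) f) (shift z)"
    unfolding ruelle_sum[OF F1 sz] using mem F1 nn sz
    by (intro member_le_sum[of "z 0" _ "\<lambda>a. exp (\<phi> (case_nat a (shift z))) * (L ^^ n) f (case_nat a (shift z))"])
      (auto simp: case_nat_in_tms_iff supported_def)
  finally show ?case by (simp only: z_def funpow.simps comp_apply)
qed (use assms in simp)

text \<open>Shows that the denominator of the Martin kernel never vanishes.\<close>

lemma green_orig_pos:
  assumes x: "x \<in> X"
  shows "G (one [orig]) x > 0"
proof -
  obtain n z where z: "n \<ge> 1" "z \<in> cyl [orig]" "(shift ^^ n) z \<in> cyl [x 0]"
    using transitive unfolding transitive_tms_def by blast
  \<comment> \<open>A preimage of \<open>x\<close> under \<open>n\<close> shifts that starts at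
    \<open>orig\<close>: the path supplied by transitivity, cut off where it reaches the letter
    \<open>x 0\<close>, followed by \<open>x\<close>.\<close>
  define y where "y = (\<lambda>i. if i < n then z i else x (i - n))"
  have sy: "(shift ^^ n) y = x" by (simp add: shift_pow y_def)
  have zx: "z n = x 0" using z by (simp add: in_letter shift_pow)
  have "y \<in> X"
    unfolding tms_def
  proof (safe)
    fix i
    consider "Suc i < n" | "Suc i = n" | "i \<ge> n" by linarith
    then show "A (y i) (y (Suc i))"
    proof cases
      case 1 then show ?thesis using z by (auto simp: y_def in_letter tms_def)
    next
      case 2
      have "A (z i) (z (Suc i))" using z by (simp add: in_letter tms_def)
      then show ?thesis using 2 zx by (simp add: y_def)
    next
      case 3 then show ?thesis using x by (auto simp: y_def tms_def Suc_diff_le)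
    qed
  qed
  then have y: "y \<in> cyl [orig]" using z by (simp add: in_letter y_def)
  have s: "supported {orig} (one [orig])" using supported_one[of "[orig]"] by simp
  have "0 < GR (one [orig]) x n"
    using ruelle_pow_pos[OF s, of y n] \<open>y \<in> X\<close> y lam_pos by (simp add: green_term_def sy)
  also have "\<dots> \<le> G (one [orig]) x"
    unfolding green_def
    using sum_le_suminf[OF summable_GT[OF nice_one x], of "[orig]" "{n}"] ruelle_pow_nonneg[OF s _ x] lam_pos
    by (auto simp: green_term_def)
  finally show ?thesis .
qed

lemma K_lincomb: "nice f \<Longrightarrow> nice g \<Longrightarrow> x \<in> X \<Longrightarrow> K (\<lambda>x. c * f x + g x) x = c * K f x + K g x"
  by (simp add: martin_kernel_def green_lincomb add_divide_distrib)

lemma K_mono: "nice f \<Longrightarrow> nice g \<Longrightarrow> (\<And>y. y \<in> X \<Longrightarrow> f y \<le> g y) \<Longrightarrow> x \<in> X \<Longrightarrow> K f x \<le> K g x"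
  unfolding martin_kernel_def using green_orig_pos green_mono by (intro divide_right_mono) (auto intro: less_imp_le)

lemma K_zero: "K (\<lambda>_. 0) x = 0"
  by (simp add: martin_kernel_def green_zero)

lemma K_nonneg: "nice f \<Longrightarrow> (\<And>y. y \<in> X \<Longrightarrow> 0 \<le> f y) \<Longrightarrow> x \<in> X \<Longrightarrow> 0 \<le> K f x"
  using K_mono[OF nice_zero, of f x] by (simp add: K_zero)

lemma K_orig: "x \<in> X \<Longrightarrow> K (one [orig]) x = 1"
  unfolding martin_kernel_def using green_orig_pos[of x] by simp

section \<open>The Ruelle operator on non-negative functions\<close>

abbreviation branch :: "((nat \<Rightarrow> 's) \<Rightarrow> ennreal) \<Rightarrow> (nat \<Rightarrow> 's) \<Rightarrow> 's \<Rightarrow> ennreal" where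
  "branch f x a \<equiv> (if A a (x 0) then ennreal (exp (\<phi> (case_nat a x))) * f (case_nat a x) else 0)"

text \<open>The Ruelle operator with values in \<open>ennreal\<close>, defined for every
  non-negative function without a summability condition. Summing over letters instead of preimages
  gives an index set that does not depend on \<open>x\<close>.\<close>

definition Lp :: "((nat \<Rightarrow> 's) \<Rightarrow> ennreal) \<Rightarrow> (nat \<Rightarrow> 's) \<Rightarrow> ennreal" where
  "Lp f x = (\<integral>\<^sup>+a. branch f x a \<partial>count_space UNIV)"

definition Gp :: "((nat \<Rightarrow> 's) \<Rightarrow> ennreal) \<Rightarrow> (nat \<Rightarrow> 's) \<Rightarrow> ennreal" where
  "Gp f x = (\<Sum>n. ennreal (inverse lam ^ n) * (Lp ^^ n) f x)"

lemma Lp_cong: "(\<And>y. y \<in> X \<Longrightarrow> f y = g y) \<Longrightarrow> x \<in> X \<Longrightarrow> Lp f x = Lp g x"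
  unfolding Lp_def by (intro nn_integral_cong) (auto simp: case_nat_in_tms_iff)

lemma Lp_ennreal:
  assumes "supported F f" "\<And>x. x \<in> X \<Longrightarrow> 0 \<le> f x" "x \<in> X"
  shows "Lp (\<lambda>x. ennreal (f x)) x = ennreal (L f x)"
proof -
  have "Lp (\<lambda>x. ennreal (f x)) x =
    (\<Sum>a\<in>{a\<in>F. A a (x 0)}. ennreal (exp (\<phi> (case_nat a x))) * ennreal (f (case_nat a x)))"
    unfolding Lp_def using assms
    by (subst nn_integral_count_space'[where A="{a\<in>F. A a (x 0)}"])
      (auto simp: supported_def case_nat_in_tms_iff)
  also have "\<dots> = (\<Sum>a\<in>{a\<in>F. A a (x 0)}. ennreal (exp (\<phi> (case_nat a x)) * f (case_nat a x)))"
    using assms by (intro sum.cong) (auto simp: ennreal_mult' case_nat_in_tms_iff)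
  also have "\<dots> = ennreal (\<Sum>a\<in>{a\<in>F. A a (x 0)}. exp (\<phi> (case_nat a x)) * f (case_nat a x))"
    using assms by (intro sum_ennreal) (auto simp: case_nat_in_tms_iff)
  finally show ?thesis using ruelle_sum[OF assms(1,3)] by simp
qed

lemma Lp_pow_ennreal:
  assumes "supported F f" "\<And>x. x \<in> X \<Longrightarrow> 0 \<le> f x" "x \<in> X"
  shows "(Lp ^^ n) (\<lambda>x. ennreal (f x)) x = ennreal ((L ^^ n) f x)"
  using assms(3)
proof (induction n arbitrary: x)
  case (Suc n)
  obtain F1 where F1: "supported F1 ((L ^^ n) f)" using supported_pow assms by meson
  have "Lp ((Lp ^^ n) (\<lambda>x. ennreal (f x))) x = Lp (\<lambda>x. ennreal ((L ^^ n) f x)) x"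
    using Suc by (intro Lp_cong) auto
  also have "\<dots> = ennreal (L ((L ^^ n) f) x)"
    using ruelle_pow_nonneg[OF assms(1,2)] Suc.prems by (intro Lp_ennreal[OF F1]) auto
  finally show ?case by simp
qed simp

lemma Gp_ennreal:
  assumes "nice f" "\<And>x. x \<in> X \<Longrightarrow> 0 \<le> f x" "x \<in> X"
  shows "Gp (\<lambda>x. ennreal (f x)) x = ennreal (G f x)"
proof -
  obtain F where F: "supported F f" using assms nice_def by auto
  have nn: "GR f x n \<ge> 0" for n
    using ruelle_pow_nonneg[OF F assms(2,3)] lam_pos by (simp add: green_term_def)
  have "Gp (\<lambda>x. ennreal (f x)) x = (\<Sum>n. ennreal (GR f x n))"
    unfolding Gp_def green_term_def using ruelle_pow_nonneg[OF F assms(2,3)] lam_pos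
    by (simp add: Lp_pow_ennreal[OF F assms(2,3)] ennreal_mult)
  also have "\<dots> = ennreal (G f x)"
    unfolding green_def using nn summable_GT[OF assms(1,3)] by (rule suminf_ennreal2)
  finally show ?thesis .
qed

section \<open>Bounded distortion\<close>

text \<open>The offset 2 is that of \<open>summable_variations\<close>. It fits points that agree on
  \<open>m + 1\<close> letters: after a letter is prepended they agree on
  \<open>m + 2\<close>.\<close>

definition vr :: "nat \<Rightarrow> real" where
  "vr m = enn2real (variation A \<phi> (m + 2))"

lemma variation_finite: "variation A \<phi> (m + 2) < \<infinity>"
proof -
  have "variation A \<phi> (m + 2) \<le> (\<Sum>m. variation A \<phi> (m + 2))"
    using sum_le_suminf[of "\<lambda>m. variation A \<phi> (m + 2)" "{m}"] by simp
  then show ?thesis using summable_var unfolding summable_variations_def by (rule le_less_trans)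
qed

lemma vr_bound:
  assumes "x \<in> X" "y \<in> X" "agree (Suc (Suc m)) x y"
  shows "\<bar>\<phi> x - \<phi> y\<bar> \<le> vr m"
proof -
  have "ennreal \<bar>\<phi> x - \<phi> y\<bar> \<le> variation A \<phi> (m + 2)"
    unfolding variation_def using assms by (intro SUP_upper2[of "(x, y)"]) (auto simp: agree_def)
  also have "\<dots> = ennreal (vr m)" unfolding vr_def using variation_finite by simp
  finally show ?thesis by (simp add: vr_def)
qed

lemma vr_nonneg: "vr m \<ge> 0"
  by (simp add: vr_def)

lemma summable_vr: "summable vr"
proof (rule summable_suminf_not_top)
  have "(\<Sum>m. ennreal (vr m)) = (\<Sum>m. variation A \<phi> (m + 2))"
    unfolding vr_def using variation_finite by simp
  then show "(\<Sum>m. ennreal (vr m)) \<noteq> top" using summable_var unfolding summable_variations_def by simp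
qed (rule vr_nonneg)

definition tail :: "nat \<Rightarrow> real" where
  "tail m = (\<Sum>j. vr (m + j))"

lemma summable_vr_shift: "summable (\<lambda>j. vr (m + j))"
  using summable_ignore_initial_segment[OF summable_vr, of m] by (simp add: add.commute)

lemma tail_tendsto: "tail \<longlonglongrightarrow> 0"
proof -
  have "tail = (\<lambda>m. suminf vr - sum vr {..<m})"
  proof
    fix m
    show "tail m = suminf vr - sum vr {..<m}"
      unfolding tail_def using suminf_split_initial_segment[OF summable_vr, of m] by (simp add: add.commute[of m])
  qed
  moreover have "(\<lambda>m. suminf vr - sum vr {..<m}) \<longlonglongrightarrow> suminf vr - suminf vr"
    by (intro tendsto_diff tendsto_const summable_LIMSEQ summable_vr)
  ultimately show ?thesis by simp
qed

text \<open>The constant sits in the exponent so that the losses of successive applications of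
  \<open>Lp\<close> add up.\<close>

definition distorts :: "((nat \<Rightarrow> 's) \<Rightarrow> ennreal) \<Rightarrow> nat \<Rightarrow> real \<Rightarrow> bool" where
  "distorts f m c \<longleftrightarrow> (\<forall>x\<in>X. \<forall>y\<in>X. agree m x y \<longrightarrow> f x \<le> ennreal (exp c) * f y)"

text \<open>Points with the same first letter have the same admissible branches, and corresponding
  branches agree on one letter more. The weights therefore differ by a factor of at most
  \<open>exp (vr m)\<close>.\<close>

lemma distorts_Lp:
  assumes "distorts f (Suc (Suc m)) c"
  shows "distorts (Lp f) (Suc m) (vr m + c)"
  unfolding distorts_def
proof (intro ballI impI)
  fix x y assume x: "x \<in> X" and y: "y \<in> X" and xy: "agree (Suc m) x y"
  have x0: "x 0 = y 0" using xy by (simp add: agree_def)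
  have "Lp f x \<le> (\<integral>\<^sup>+a. ennreal (exp (vr m + c)) * branch f y a \<partial>count_space UNIV)"
    unfolding Lp_def
  proof (rule nn_integral_mono)
    fix a
    show "branch f x a
      \<le> ennreal (exp (vr m + c)) * branch f y a"
    proof (cases "A a (x 0)")
      case True
      have in': "case_nat a x \<in> X" "case_nat a y \<in> X" using True x0 x y by (auto simp: case_nat_in_tms_iff)
      have ag: "agree (Suc (Suc m)) (case_nat a x) (case_nat a y)" using xy by (rule agree_case_nat)
      have "\<phi> (case_nat a x) \<le> vr m + \<phi> (case_nat a y)" using vr_bound[OF in' ag] by linarith
      then have "ennreal (exp (\<phi> (case_nat a x))) \<le> ennreal (exp (vr m) * exp (\<phi> (case_nat a y)))"
        by (intro ennreal_leI) (simp flip: exp_add)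
      moreover have "f (case_nat a x) \<le> ennreal (exp c) * f (case_nat a y)"
        using assms in' ag unfolding distorts_def by blast
      ultimately have "ennreal (exp (\<phi> (case_nat a x))) * f (case_nat a x) \<le>
        ennreal (exp (vr m) * exp (\<phi> (case_nat a y))) * (ennreal (exp c) * f (case_nat a y))"
        by (rule mult_mono) auto
      also have "\<dots> = ennreal (exp (vr m + c)) * (ennreal (exp (\<phi> (case_nat a y))) * f (case_nat a y))"
        by (simp add: exp_add ennreal_mult mult_ac)
      finally show ?thesis using True x0 by simp
    qed simp
  qed
  also have "\<dots> = ennreal (exp (vr m + c)) * Lp f y"
    unfolding Lp_def by (rule nn_integral_cmult) simp
  finally show "Lp f x \<le> ennreal (exp (vr m + c)) * Lp f y" .
qed

text \<open>The premise says that \<open>f\<close> depends only on the first \<open>m + 1\<close>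
  letters. The losses form a partial sum of the series of variations, so they are bounded
  independently of \<open>n\<close>; this is what lets the estimate pass to Green's
  function.\<close>

lemma distorts_Lp_pow:
  assumes "\<And>k. k \<ge> m \<Longrightarrow> distorts f (Suc k) 0"
  shows "distorts ((Lp ^^ n) f) (Suc m) (\<Sum>j<n. vr (m + j))"
  using assms
proof (induction n arbitrary: m)
  case (Suc n)
  have "distorts ((Lp ^^ n) f) (Suc (Suc m)) (\<Sum>j<n. vr (Suc m + j))"
    using Suc.prems by (intro Suc.IH) auto
  from distorts_Lp[OF this] show ?case by (simp add: sum.lessThan_Suc_shift del: sum.lessThan_Suc)
qed simp

lemma Gp_distorts:
  assumes "\<And>k. k \<ge> m \<Longrightarrow> distorts f (Suc k) 0" "x \<in> X" "y \<in> X" "agree (Suc m) x y"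
  shows "Gp f x \<le> ennreal (exp (tail m)) * Gp f y"
proof -
  have *: "(Lp ^^ n) f x \<le> ennreal (exp (tail m)) * (Lp ^^ n) f y" for n
  proof -
    have "(Lp ^^ n) f x \<le> ennreal (exp (\<Sum>j<n. vr (m + j))) * (Lp ^^ n) f y"
      using distorts_Lp_pow[of m f n] assms unfolding distorts_def by blast
    also have "\<dots> \<le> ennreal (exp (tail m)) * (Lp ^^ n) f y"
      unfolding tail_def using sum_le_suminf[OF summable_vr_shift, of "{..<n}" m] vr_nonneg
      by (intro mult_right_mono ennreal_leI) auto
    finally show ?thesis .
  qed
  have "Gp f x \<le> (\<Sum>n. ennreal (exp (tail m)) * (ennreal (inverse lam ^ n) * (Lp ^^ n) f y))"
    unfolding Gp_def
  proof (rule suminf_le)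
    fix n
    have "ennreal (inverse lam ^ n) * (Lp ^^ n) f x \<le> ennreal (inverse lam ^ n) * (ennreal (exp (tail m)) * (Lp ^^ n) f y)"
      using * by (intro mult_left_mono) auto
    then show "ennreal (inverse lam ^ n) * (Lp ^^ n) f x \<le> ennreal (exp (tail m)) * (ennreal (inverse lam ^ n) * (Lp ^^ n) f y)"
      by (simp add: mult_ac)
  qed auto
  also have "\<dots> = ennreal (exp (tail m)) * Gp f y" unfolding Gp_def by (rule ennreal_suminf_cmult)
  finally show ?thesis .
qed

text \<open>Serves twice: with \<open>m = 0\<close> it bounds Green's function on a letter, and with
  \<open>m\<close> tending to infinity it gives continuity of the kernel.\<close>

lemma green_one_distorts:
  assumes "u \<noteq> []" "length u \<le> Suc m" "x \<in> X" "y \<in> X" "agree (Suc m) x y"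
  shows "G (one u) x \<le> exp (tail m) * G (one u) y"
proof -
  have "distorts (\<lambda>x. ennreal (one u x)) (Suc k) 0" if "k \<ge> m" for k
    unfolding distorts_def
  proof (intro ballI impI)
    fix x y assume *: "x \<in> X" "y \<in> X" "agree (Suc k) x y"
    have "one u x = one u y"
      using cylinder_agree_iff[OF *, of u] assms(2) that by (simp add: indicator_def)
    then show "ennreal (one u x) \<le> ennreal (exp 0) * ennreal (one u y)" by simp
  qed
  from Gp_distorts[OF this assms(3-5)]
  have "ennreal (G (one u) x) \<le> ennreal (exp (tail m)) * ennreal (G (one u) y)"
    using assms by (simp add: Gp_ennreal[OF nice_one])
  also have "\<dots> = ennreal (exp (tail m) * G (one u) y)" by (simp add: ennreal_mult')
  finally show ?thesis
    using green_mono[OF nice_zero nice_one[OF assms(1)] _ assms(4)] by (simp add: ennreal_le_iff green_zero)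
qed

end

section \<open>Conformal measures\<close>

lemma borel_on_measurableI:
  assumes "f \<in> topspace S \<rightarrow> topspace T"
    and "\<And>U. openin T U \<Longrightarrow> openin S {x \<in> topspace S. f x \<in> U}"
  shows "f \<in> measurable (borel_on S) (borel_on T)"
proof -
  have "f -` U \<inter> space (borel_on S) \<in> sets (borel_on S)" if "openin T U" for U
  proof -
    have "f -` U \<inter> space (borel_on S) = {x \<in> topspace S. f x \<in> U}"
      by (auto simp: space_borel_on)
    then show ?thesis using openin_in_borel_on[OF assms(2)[OF that]] by simp
  qed
  then show ?thesis
    unfolding borel_on_def[of T] using assms(1)
    by (intro measurable_measure_of) (auto simp: space_borel_on dest: openin_subset)
qed

context transient_tms
begin

lemma space_B [simp]: "space B = X"
  by (simp add: space_borel_on)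

lemma sets_B: "sets B = sigma_sets X (cyls A)"
  by (rule sets_tms_borel[OF countable_states])

lemma cylinder_in_B [measurable]: "cyl u \<in> sets B"
  by (intro openin_in_borel_on openin_cylinder)

lemma shift_measurable [measurable]: "shift \<in> measurable B B"
proof (rule borel_on_measurableI)
  fix U assume U: "openin (tms_top A) U"
  show "openin (tms_top A) {x \<in> topspace (tms_top A). shift x \<in> U}"
    unfolding openin_tms_top_iff
  proof (intro conjI ballI)
    fix x assume "x \<in> {x \<in> topspace (tms_top A). shift x \<in> U}"
    then obtain n where n: "\<And>y. y \<in> X \<Longrightarrow> agree n (shift x) y \<Longrightarrow> y \<in> U"
      using U unfolding openin_tms_top_iff by blast
    have "shift y \<in> U" if "y \<in> X" "agree (Suc n) x y" for y
      using n[OF shift_in_tms[OF that(1)]] that(2) by (auto simp: agree_def shift_apply)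
    then show "\<exists>n. \<forall>y\<in>X. agree n x y \<longrightarrow> y \<in> {x \<in> topspace (tms_top A). shift x \<in> U}"
      by (intro exI[of _ "Suc n"]) auto
  qed auto
qed (simp add: shift_in_tms)

lemma shift_pow_measurable [measurable]: "(shift ^^ n) \<in> measurable B B"
proof (induction n)
  case (Suc n)
  from measurable_comp[OF this shift_measurable] show ?case by simp
qed (simp add: id_def)

text \<open>Inadmissible letters leave \<open>x\<close> unchanged, so that this maps the shift space into itself.\<close>

definition cons :: "'s \<Rightarrow> (nat \<Rightarrow> 's) \<Rightarrow> nat \<Rightarrow> 's" where
  "cons a x = (if A a (x 0) then case_nat a x else x)"

lemma cons_measurable [measurable]: "cons a \<in> measurable B B"
proof (rule borel_on_measurableI)
  fix U assume U: "openin (tms_top A) U"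
  show "openin (tms_top A) {x \<in> topspace (tms_top A). cons a x \<in> U}"
    unfolding openin_tms_top_iff
  proof (intro conjI ballI)
    fix x assume x: "x \<in> {x \<in> topspace (tms_top A). cons a x \<in> U}"
    then obtain n where n: "\<And>y. y \<in> X \<Longrightarrow> agree n (cons a x) y \<Longrightarrow> y \<in> U"
      using U unfolding openin_tms_top_iff by blast
    have "cons a y \<in> U" if y: "y \<in> X" "agree (Suc n) x y" for y
    proof -
      have y0: "y 0 = x 0" using y by (simp add: agree_def)
      have "agree n (cons a x) (cons a y)"
        using y agree_case_nat[of n x y a] agree_mono[of "Suc n" _ _ n] y0 by (auto simp: cons_def)
      moreover have "cons a y \<in> X" using y by (auto simp: cons_def case_nat_in_tms_iff)
      ultimately show ?thesis using n by blast
    qed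
    then show "\<exists>n. \<forall>y\<in>X. agree n x y \<longrightarrow> y \<in> {x \<in> topspace (tms_top A). cons a x \<in> U}"
      by (intro exI[of _ "Suc n"]) auto
  qed auto
qed (auto simp: cons_def case_nat_in_tms_iff)

lemma vr_tendsto: "vr \<longlonglongrightarrow> 0"
  by (rule summable_LIMSEQ_zero[OF summable_vr])

lemma phi_measurable [measurable]: "\<phi> \<in> borel_measurable B"
proof (rule borel_measurableI)
  fix S :: "real set" assume S: "open S"
  have "openin (tms_top A) {x \<in> X. \<phi> x \<in> S}"
    unfolding openin_tms_top_iff
  proof (intro conjI ballI)
    fix x assume x: "x \<in> {x \<in> X. \<phi> x \<in> S}"
    then obtain r where r: "r > 0" "ball (\<phi> x) r \<subseteq> S" using S openE by blast
    obtain m where m: "vr m < r"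
      using order_tendstoD(2)[OF vr_tendsto r(1)] by (auto simp: eventually_sequentially)
    have "\<phi> y \<in> S" if "y \<in> X" "agree (Suc (Suc m)) x y" for y
      using vr_bound[of x y m] x that m r by (auto simp: subset_iff dist_real_def)
    then show "\<exists>n. \<forall>y\<in>X. agree n x y \<longrightarrow> y \<in> {x \<in> X. \<phi> x \<in> S}"
      by (intro exI[of _ "Suc (Suc m)"]) auto
  qed auto
  moreover have "\<phi> -` S \<inter> space B = {x \<in> X. \<phi> x \<in> S}" by auto
  ultimately show "\<phi> -` S \<inter> space B \<in> sets B" using openin_in_borel_on by metis
qed

lemma letter_pred_in_B [measurable]: "{x \<in> X. P (x 0)} \<in> sets B"
  by (intro openin_in_borel_on) (auto simp: openin_tms_top_iff agree_def intro!: exI[of _ 1])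

lemma Lp_eq_cons:
  "Lp f x = (\<integral>\<^sup>+a. indicator {x. A a (x 0)} x * (ennreal (exp (\<phi> (cons a x))) * f (cons a x)) \<partial>count_space UNIV)"
  unfolding Lp_def by (intro nn_integral_cong) (auto simp: cons_def)

lemma Lp_term_measurable:
  assumes [measurable]: "f \<in> borel_measurable B"
  shows "(\<lambda>x. indicator {x. A a (x 0)} x * (ennreal (exp (\<phi> (cons a x))) * f (cons a x))) \<in> borel_measurable B"
proof -
  have "(\<lambda>x. indicator {x \<in> X. A a (x 0)} x * (ennreal (exp (\<phi> (cons a x))) * f (cons a x))) \<in> borel_measurable B"
    by measurable
  then show ?thesis by (rule measurable_cong[THEN iffD1, rotated]) (auto simp: indicator_def)
qed

lemma Lp_measurable [measurable]:
  assumes [measurable]: "f \<in> borel_measurable B"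
  shows "Lp f \<in> borel_measurable B"
proof -
  \<comment> \<open>Measurability of an integral in a parameter requires a sigma-finite measure; for
    counting measure on the letters this is countability of the states.\<close>
  interpret sigma_finite_measure "count_space (UNIV :: 's set)"
    by (rule sigma_finite_measure_count_space_countable[OF countable_states])
  define h where "h a x = indicator {x. A a (x 0)} x * (ennreal (exp (\<phi> (cons a x))) * f (cons a x))" for a x
  have h [measurable]: "h a \<in> borel_measurable B" for a
    unfolding h_def by (rule Lp_term_measurable) fact
  have "(\<lambda>p. h (snd p) (fst p)) \<in> borel_measurable (B \<Otimes>\<^sub>M count_space UNIV)"
    by (rule measurable_compose_countable'[where f="\<lambda>i p. h i (fst p)" and g=snd, OF _ _ countable_states]) auto
  then have "(\<lambda>x. \<integral>\<^sup>+a. h a x \<partial>count_space UNIV) \<in> borel_measurable B"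
    by (intro borel_measurable_nn_integral) (simp add: case_prod_beta')
  then show ?thesis by (simp add: h_def Lp_eq_cons[abs_def])
qed

lemma Lp_pow_measurable [measurable]: "f \<in> borel_measurable B \<Longrightarrow> (Lp ^^ n) f \<in> borel_measurable B"
  by (induction n) auto

lemma Gp_measurable [measurable]: "f \<in> borel_measurable B \<Longrightarrow> Gp f \<in> borel_measurable B"
  unfolding Gp_def by measurable

lemma Lp_cmult: "Lp (\<lambda>x. c * f x) = (\<lambda>x. c * Lp f x)"
proof
  fix x
  have "Lp (\<lambda>x. c * f x) x = (\<integral>\<^sup>+a. c * branch f x a \<partial>count_space UNIV)"
    unfolding Lp_def by (intro nn_integral_cong) (auto simp: mult_ac)
  then show "Lp (\<lambda>x. c * f x) x = c * Lp f x"
    unfolding Lp_def by (simp add: nn_integral_cmult)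
qed

lemma Lp_pow_cmult: "(Lp ^^ n) (\<lambda>x. c * f x) = (\<lambda>x. c * (Lp ^^ n) f x)"
  by (induction n) (auto simp: Lp_cmult)

lemma Gp_cmult: "Gp (\<lambda>x. c * f x) x = c * Gp f x"
proof -
  have "Gp (\<lambda>x. c * f x) x = (\<Sum>n. c * (ennreal (inverse lam ^ n) * (Lp ^^ n) f x))"
    unfolding Gp_def Lp_pow_cmult by (intro suminf_cong) (simp add: mult_ac)
  then show ?thesis unfolding Gp_def by (simp add: ennreal_suminf_cmult)
qed

lemma Lp_add: "Lp (\<lambda>x. f x + g x) x = Lp f x + Lp g x"
  unfolding Lp_def
  by (subst nn_integral_add[symmetric]) (auto simp: distrib_left intro!: nn_integral_cong)

lemma Lp_suminf: "Lp (\<lambda>x. \<Sum>i. f i x) x = (\<Sum>i. Lp (f i) x)"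
  unfolding Lp_def
  by (subst nn_integral_suminf[symmetric]) (auto intro!: nn_integral_cong)

lemma Lp_SUP:
  assumes "incseq f"
  shows "Lp (\<lambda>x. SUP i. f i x) x = (SUP i. Lp (f i) x)"
proof -
  have "Lp (\<lambda>x. SUP i. f i x) x = (\<integral>\<^sup>+a. (SUP i. branch (f i) x a) \<partial>count_space UNIV)"
    unfolding Lp_def by (intro nn_integral_cong) (auto simp: SUP_mult_left_ennreal)
  also have "\<dots> = (SUP i. Lp (f i) x)"
    unfolding Lp_def using assms
    by (intro nn_integral_monotone_convergence_SUP)
      (auto simp: incseq_def le_fun_def intro!: mult_left_mono)
  finally show ?thesis .
qed

lemma Lp_mono: "(\<And>y. f y \<le> g y) \<Longrightarrow> Lp f x \<le> Lp g x"
  unfolding Lp_def by (intro nn_integral_mono) (auto intro!: mult_left_mono)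

text \<open>All preimages of \<open>x\<close> have the same image \<open>x\<close>, so a factor that
  depends on the shifted point only is constant along the sum. This identity is behind both the
  orbit sums and the restriction of a conformal measure to an invariant set.\<close>

lemma Lp_mult_shift: "Lp (\<lambda>x. f x * g (shift x)) = (\<lambda>x. Lp f x * g x)"
proof
  fix x
  have "Lp (\<lambda>x. f x * g (shift x)) x = (\<integral>\<^sup>+a. branch f x a * g x \<partial>count_space UNIV)"
    unfolding Lp_def by (intro nn_integral_cong) (simp only: shift_case_nat if_distrib[of "\<lambda>z. z * g x"] mult.assoc mult_zero_left)
  then show "Lp (\<lambda>x. f x * g (shift x)) x = Lp f x * g x"
    unfolding Lp_def by (simp add: nn_integral_multc)
qed

lemma Lp_pow_mult_shift: "(Lp ^^ n) (\<lambda>x. f x * g ((shift ^^ n) x)) = (\<lambda>x. (Lp ^^ n) f x * g x)"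
proof (induction n arbitrary: f)
  case (Suc n)
  have "(Lp ^^ Suc n) (\<lambda>x. f x * g ((shift ^^ Suc n) x)) = (Lp ^^ n) (Lp (\<lambda>x. f x * g ((shift ^^ n) (shift x))))"
    by (simp only: funpow_Suc_right comp_apply)
  also have "\<dots> = (Lp ^^ n) (\<lambda>x. Lp f x * g ((shift ^^ n) x))"
    by (simp only: Lp_mult_shift[of f "\<lambda>x. g ((shift ^^ n) x)"])
  also have "\<dots> = (\<lambda>x. (Lp ^^ Suc n) f x * g x)"
    by (simp only: Suc.IH funpow_Suc_right comp_apply)
  finally show ?case .
qed simp

text \<open>Uniqueness on an intersection-stable generator needs a countable cover by sets of finite
  measure; the one-letter cylinders are such a cover.\<close>

lemma measure_eq_on_cylinders:
  assumes "sets M = sets B" "sets N = sets B"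
    and "\<And>u. u \<noteq> [] \<Longrightarrow> emeasure M (cyl u) = emeasure N (cyl u)"
    and "\<And>a. emeasure M (cyl [a]) \<noteq> \<infinity>"
  shows "M = N"
proof (rule measure_eqI_generator_eq_countable[of "cyls A" X M N "range (\<lambda>a. cyl [a])"])
  show "Int_stable (cyls A)" by (rule Int_stable_cyls)
  show "cyls A \<subseteq> Pow X" using cylinder_subset by (auto simp: cyls_def)
  show "emeasure M Y = emeasure N Y" if "Y \<in> cyls A" for Y using that assms by (auto simp: cyls_def)
  show "sets M = sigma_sets X (cyls A)" "sets N = sigma_sets X (cyls A)" using assms sets_B by auto
  show "range (\<lambda>a. cyl [a]) \<subseteq> cyls A" by (auto simp: cyls_def)
  show "\<Union> (range (\<lambda>a. cyl [a])) = X" by (auto simp: in_letter)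
  show "countable (range (\<lambda>a. cyl [a]))" using countable_states by auto
qed (use assms in auto)

end

section \<open>Conformality for Borel sets and measurable functions\<close>

locale conformal = transient_tms A \<phi> lam orig
  for A :: "'s \<Rightarrow> 's \<Rightarrow> bool" and \<phi> lam orig +
  fixes \<mu> :: "(nat \<Rightarrow> 's) measure"
  assumes conf: "\<mu> \<in> Conf A \<phi> lam"
begin

lemma sets_mu [measurable_cong]: "sets \<mu> = sets B"
  using conf by (simp add: Conf_def radon_measure_def)

lemma space_mu [simp]: "space \<mu> = X"
  using sets_eq_imp_space_eq[OF sets_mu] by simp

lemma finite_compact: "compactin (tms_top A) U \<Longrightarrow> emeasure \<mu> U < \<infinity>"
  using conf by (simp add: Conf_def radon_measure_def)

lemma finite_cylinder: "u \<noteq> [] \<Longrightarrow> emeasure \<mu> (cyl u) < \<infinity>"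
  by (intro finite_compact compactin_cylinder locally_compact)

lemma conformal_compact:
  assumes "compactin (tms_top A) U"
  shows "(\<integral>\<^sup>+x. Lp (indicator U) x \<partial>\<mu>) = ennreal lam * emeasure \<mu> U"
proof -
  obtain F where F: "supported F (indicator U)" using nice_indicator[OF assms] by (auto simp: nice_def)
  have "(\<integral>\<^sup>+x. Lp (indicator U) x \<partial>\<mu>) = (\<integral>\<^sup>+x. ennreal (L (indicator U) x) \<partial>\<mu>)"
    using Lp_ennreal[OF F] by (intro nn_integral_cong) (simp add: ennreal_indicator)
  then show ?thesis using conf assms by (simp add: Conf_def)
qed

text \<open>\<open>Conf\<close> speaks of compact sets only. Both sides are measures as functions of
  \<open>E\<close>, the left one because \<open>Lp\<close> commutes with countable sums, and they
  agree on cylinders.\<close>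

lemma conformal_set:
  assumes "E \<in> sets B"
  shows "(\<integral>\<^sup>+x. Lp (indicator E) x \<partial>\<mu>) = ennreal lam * emeasure \<mu> E"
proof -
  define N where "N = measure_of X (sets B) (\<lambda>E. \<integral>\<^sup>+x. Lp (indicator E) x \<partial>\<mu>)"
  have sub: "sets B \<subseteq> Pow X" using sets.space_closed[of B] by simp
  have setsN: "sets N = sets B"
    unfolding N_def using sets.sigma_sets_eq[of B] sub by (simp add: sets_measure_of)
  have ca: "countably_additive (sets N) (\<lambda>E. \<integral>\<^sup>+x. Lp (indicator E) x \<partial>\<mu>)"
  proof (rule countably_additiveI)
    fix D :: "nat \<Rightarrow> (nat \<Rightarrow> 's) set"
    assume D: "range D \<subseteq> sets N" "disjoint_family D"
    have [measurable]: "D i \<in> sets B" for i using D setsN by auto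
    have "(\<Sum>i. \<integral>\<^sup>+x. Lp (indicator (D i)) x \<partial>\<mu>) = (\<integral>\<^sup>+x. (\<Sum>i. Lp (indicator (D i)) x) \<partial>\<mu>)"
      by (rule nn_integral_suminf[symmetric]) simp
    also have "\<dots> = (\<integral>\<^sup>+x. Lp (\<lambda>x. \<Sum>i. indicator (D i) x) x \<partial>\<mu>)" by (simp only: Lp_suminf)
    also have "(\<lambda>x. \<Sum>i. indicator (D i) x :: ennreal) = indicator (\<Union>i. D i)"
      using suminf_indicator[OF D(2)] by (simp add: fun_eq_iff)
    finally show "(\<Sum>i. \<integral>\<^sup>+x. Lp (indicator (D i)) x \<partial>\<mu>) = (\<integral>\<^sup>+x. Lp (indicator (\<Union>i. D i)) x \<partial>\<mu>)" .
  qed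
  have pos: "positive (sets N) (\<lambda>E. \<integral>\<^sup>+x. Lp (indicator E) x \<partial>\<mu>)"
    by (simp add: positive_def Lp_def cong: if_cong)
  have em: "emeasure N E = (\<integral>\<^sup>+x. Lp (indicator E) x \<partial>\<mu>)" if "E \<in> sets B" for E
    using emeasure_measure_of[OF N_def sub pos ca] that setsN by simp
  have "N = scale_measure (ennreal lam) \<mu>"
  proof (rule measure_eq_on_cylinders)
    show eq: "emeasure N (cyl u) = emeasure (scale_measure (ennreal lam) \<mu>) (cyl u)" if "u \<noteq> []" for u
      using conformal_compact[OF compactin_cylinder[OF locally_compact that]] by (simp add: em)
    show "emeasure N (cyl [a]) \<noteq> \<infinity>" for a
      using eq[of "[a]"] finite_cylinder[of "[a]"] by (simp add: ennreal_mult_eq_top_iff)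
  qed (auto simp: setsN sets_mu)
  then show ?thesis using em[OF assms] by simp
qed

lemma conformal_fun:
  assumes "f \<in> borel_measurable B"
  shows "(\<integral>\<^sup>+x. Lp f x \<partial>\<mu>) = ennreal lam * (\<integral>\<^sup>+x. f x \<partial>\<mu>)"
proof -
  define P where "P f \<longleftrightarrow> (\<integral>\<^sup>+x. Lp f x \<partial>\<mu>) = ennreal lam * (\<integral>\<^sup>+x. f x \<partial>\<mu>)" for f
  have "P f"
  proof (rule borel_measurable_induct[where P=P and M=B and u=f, OF assms])
    fix f g :: "(nat \<Rightarrow> 's) \<Rightarrow> ennreal"
    assume eq: "\<And>x. x \<in> space B \<Longrightarrow> f x = g x" and g: "P g"
    have "(\<integral>\<^sup>+x. Lp f x \<partial>\<mu>) = (\<integral>\<^sup>+x. Lp g x \<partial>\<mu>)"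
      using eq by (intro nn_integral_cong Lp_cong) simp_all
    moreover have "(\<integral>\<^sup>+x. f x \<partial>\<mu>) = (\<integral>\<^sup>+x. g x \<partial>\<mu>)"
      using eq by (intro nn_integral_cong) simp
    ultimately show "P f" using g by (simp only: P_def)
  next
    fix E assume "E \<in> sets B"
    then show "P (indicator E)" using conformal_set[of E] sets_mu by (simp add: P_def)
  next
    fix u :: "(nat \<Rightarrow> 's) \<Rightarrow> ennreal" and c :: ennreal
    assume [measurable]: "u \<in> borel_measurable B" and "P u"
    then show "P (\<lambda>x. c * u x)" by (simp add: P_def Lp_cmult nn_integral_cmult mult_ac)
  next
    fix u v :: "(nat \<Rightarrow> 's) \<Rightarrow> ennreal"
    assume [measurable]: "u \<in> borel_measurable B" "v \<in> borel_measurable B" and "P u" "P v"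
    then show "P (\<lambda>x. v x + u x)" by (simp add: P_def Lp_add nn_integral_add distrib_left)
  next
    fix U :: "nat \<Rightarrow> (nat \<Rightarrow> 's) \<Rightarrow> ennreal"
    assume [measurable]: "\<And>i. U i \<in> borel_measurable B" and P: "\<And>i. P (U i)" and U: "incseq U"
    have inc: "incseq (\<lambda>i. Lp (U i))"
      using U by (auto simp: incseq_def le_fun_def intro!: Lp_mono)
    have "(\<integral>\<^sup>+x. Lp (SUP i. U i) x \<partial>\<mu>) = (\<integral>\<^sup>+x. (SUP i. Lp (U i) x) \<partial>\<mu>)"
      using Lp_SUP[OF U] by (simp add: SUP_apply[abs_def])
    also have "\<dots> = (SUP i. \<integral>\<^sup>+x. Lp (U i) x \<partial>\<mu>)"
      by (rule nn_integral_monotone_convergence_SUP[OF inc]) simp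
    also have "\<dots> = (SUP i. ennreal lam * (\<integral>\<^sup>+x. U i x \<partial>\<mu>))" using P by (simp add: P_def)
    also have "\<dots> = ennreal lam * (\<integral>\<^sup>+x. (SUP i. U i x) \<partial>\<mu>)"
      by (subst nn_integral_monotone_convergence_SUP[OF U]) (auto simp: SUP_mult_left_ennreal)
    finally show "P (SUP i. U i)" by (simp add: P_def SUP_apply[abs_def])
  qed
  then show ?thesis by (simp only: P_def)
qed

lemma conformal_pow:
  assumes [measurable]: "f \<in> borel_measurable B"
  shows "(\<integral>\<^sup>+x. f x \<partial>\<mu>) = ennreal (inverse lam ^ n) * (\<integral>\<^sup>+x. (Lp ^^ n) f x \<partial>\<mu>)"
proof (induction n)
  case (Suc n)
  have "(\<integral>\<^sup>+x. (Lp ^^ Suc n) f x \<partial>\<mu>) = ennreal lam * (\<integral>\<^sup>+x. (Lp ^^ n) f x \<partial>\<mu>)"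
    using conformal_fun[OF Lp_pow_measurable[OF assms]] by (simp only: funpow.simps comp_apply)
  then have "ennreal (inverse lam ^ Suc n) * (\<integral>\<^sup>+x. (Lp ^^ Suc n) f x \<partial>\<mu>)
      = (ennreal (inverse lam ^ Suc n) * ennreal lam) * (\<integral>\<^sup>+x. (Lp ^^ n) f x \<partial>\<mu>)"
    by (simp only: mult.assoc)
  also have "ennreal (inverse lam ^ Suc n) * ennreal lam = ennreal (inverse lam ^ Suc n * lam)"
    using lam_pos by (intro ennreal_mult[symmetric]) auto
  also have "inverse lam ^ Suc n * lam = inverse lam ^ n"
    using lam_pos by simp
  finally show ?case using Suc by (simp only:)
qed simp

text \<open>\<open>conformal_pow\<close> moves the n-th term of the orbit sum by \<open>n\<close>
  applications of \<open>Lp\<close>, and \<open>Lp_pow_mult_shift\<close> then pulls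
  \<open>g\<close> out of them; the weights that remain are those of Green's function.\<close>

lemma nn_integral_orbit:
  assumes [measurable]: "f \<in> borel_measurable B" "g \<in> borel_measurable B"
  shows "(\<integral>\<^sup>+x. f x * (\<Sum>n. g ((shift ^^ n) x)) \<partial>\<mu>) = (\<integral>\<^sup>+x. Gp f x * g x \<partial>\<mu>)"
proof -
  have "(\<integral>\<^sup>+x. f x * (\<Sum>n. g ((shift ^^ n) x)) \<partial>\<mu>) = (\<integral>\<^sup>+x. (\<Sum>n. f x * g ((shift ^^ n) x)) \<partial>\<mu>)"
    by simp
  also have "\<dots> = (\<Sum>n. \<integral>\<^sup>+x. f x * g ((shift ^^ n) x) \<partial>\<mu>)"
    by (rule nn_integral_suminf) measurable
  also have "\<dots> = (\<Sum>n. \<integral>\<^sup>+x. ennreal (inverse lam ^ n) * (Lp ^^ n) f x * g x \<partial>\<mu>)"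
  proof (rule suminf_cong)
    fix n
    have "(\<integral>\<^sup>+x. f x * g ((shift ^^ n) x) \<partial>\<mu>) = ennreal (inverse lam ^ n) * (\<integral>\<^sup>+x. (Lp ^^ n) f x * g x \<partial>\<mu>)"
      by (subst conformal_pow[of _ n]) (simp_all add: Lp_pow_mult_shift)
    also have "\<dots> = (\<integral>\<^sup>+x. ennreal (inverse lam ^ n) * (Lp ^^ n) f x * g x \<partial>\<mu>)"
      by (simp add: nn_integral_cmult mult.assoc)
    finally show "(\<integral>\<^sup>+x. f x * g ((shift ^^ n) x) \<partial>\<mu>) = (\<integral>\<^sup>+x. ennreal (inverse lam ^ n) * (Lp ^^ n) f x * g x \<partial>\<mu>)" .
  qed
  also have "\<dots> = (\<integral>\<^sup>+x. (\<Sum>n. ennreal (inverse lam ^ n) * (Lp ^^ n) f x * g x) \<partial>\<mu>)"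
    by (rule nn_integral_suminf[symmetric]) measurable
  also have "\<dots> = (\<integral>\<^sup>+x. Gp f x * g x \<partial>\<mu>)"
    unfolding Gp_def by simp
  finally show ?thesis .
qed

end

section \<open>Last exits and convergence of the kernel\<close>

lemma suminf_indicator_card:
  assumes "(\<Sum>n. indicator S n :: ennreal) \<noteq> \<infinity>"
  shows "finite (S :: nat set)"
proof (rule ccontr)
  assume "infinite S"
  then have "emeasure (count_space UNIV) S = \<infinity>" by simp
  moreover have "emeasure (count_space UNIV) S = (\<Sum>n. indicator S n)"
    using nn_integral_count_space_nat[of "indicator S"] by (subst nn_integral_indicator[symmetric]) auto
  ultimately show False using assms by simp
qed

context transient_tms
begin

text \<open>All points of \<open>cyl [a]\<close> share one letter, so distortion compares Green's
  function there with its finite value at a single point \<open>z\<close>.\<close>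

lemma Gp_letter_bounded:
  obtains c where "c < \<infinity>" "\<And>x. x \<in> cyl [a] \<Longrightarrow> Gp (indicator (cyl [b])) x \<le> c"
proof -
  obtain z where z: "z \<in> cyl [a]" using letter_nonempty by blast
  have zX: "z \<in> X" using z cylinder_subset by blast
  have eq: "Gp (indicator (cyl [b])) x = ennreal (G (one [b]) x)" if "x \<in> X" for x
    using Gp_ennreal[OF nice_one[of "[b]"] _ that] by (simp add: ennreal_indicator)
  have "Gp (indicator (cyl [b])) x \<le> ennreal (exp (tail 0) * G (one [b]) z)" if "x \<in> cyl [a]" for x
  proof -
    have xX: "x \<in> X" using that cylinder_subset by blast
    have "agree (Suc 0) x z" using that z by (simp add: agree_def in_letter)
    from green_one_distorts[OF _ _ xX zX this, of "[b]"] show ?thesis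
      by (simp add: eq[OF xX] ennreal_leI)
  qed
  then show ?thesis using that[of "ennreal (exp (tail 0) * G (one [b]) z)"] by simp
qed

definition hit :: "(nat \<Rightarrow> 's) set \<Rightarrow> (nat \<Rightarrow> 's) set" where
  "hit U = {x \<in> X. \<exists>n. (shift ^^ n) x \<in> U}"

lemma hit_measurable [measurable]: "U \<in> sets B \<Longrightarrow> hit U \<in> sets B"
proof -
  assume [measurable]: "U \<in> sets B"
  have "hit U = {x \<in> space B. \<exists>n. (shift ^^ n) x \<in> U}" by (simp add: hit_def)
  also have "\<dots> \<in> sets B" by measurable
  finally show ?thesis .
qed

text \<open>The points of \<open>U\<close> whose orbit never returns to \<open>U\<close>. An orbit with finitely many visits to
  \<open>U\<close> passes through this set exactly once, at its last visit.\<close>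

definition exit_set :: "(nat \<Rightarrow> 's) set \<Rightarrow> (nat \<Rightarrow> 's) set" where
  "exit_set U = {x \<in> X. x \<in> U \<and> (\<forall>j. (shift ^^ j) (shift x) \<notin> U)}"

lemma exit_set_measurable [measurable]: "U \<in> sets B \<Longrightarrow> exit_set U \<in> sets B"
proof -
  assume [measurable]: "U \<in> sets B"
  have "exit_set U = {x \<in> space B. x \<in> U \<and> (\<forall>j. (shift ^^ j) (shift x) \<notin> U)}"
    by (simp add: exit_set_def)
  also have "\<dots> \<in> sets B" by measurable
  finally show ?thesis .
qed

lemma indicator_hit_eq:
  assumes fin: "finite {n. (shift ^^ n) x \<in> U}" and x: "x \<in> X"
  shows "(indicator (hit U) x :: ennreal) = (\<Sum>n. indicator (exit_set U) ((shift ^^ n) x))"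
proof -
  have exit: "(shift ^^ n) x \<in> exit_set U \<longleftrightarrow> (shift ^^ n) x \<in> U \<and> (\<forall>m>n. (shift ^^ m) x \<notin> U)" for n
  proof -
    have "(shift ^^ j) (shift ((shift ^^ n) x)) = (shift ^^ (n + 1 + j)) x" for j
      by (simp add: shift_pow shift_def algebra_simps)
    moreover have "(\<forall>j. (shift ^^ (n + 1 + j)) x \<notin> U) \<longleftrightarrow> (\<forall>m>n. (shift ^^ m) x \<notin> U)"
      by (metis Suc_eq_plus1 less_iff_Suc_add add_Suc)
    ultimately show ?thesis using shift_pow_in_tms[OF x] by (simp add: exit_set_def)
  qed
  show ?thesis
  proof (cases "{n. (shift ^^ n) x \<in> U} = {}")
    case True
    then have "(shift ^^ n) x \<notin> exit_set U" for n using exit by auto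
    then show ?thesis using True by (simp add: hit_def)
  next
    case False
    define N where "N = Max {n. (shift ^^ n) x \<in> U}"
    have N: "(shift ^^ N) x \<in> U" using Max_in[OF fin False] by (simp add: N_def)
    have max: "m \<le> N" if "(shift ^^ m) x \<in> U" for m
      unfolding N_def using that fin by (intro Max_ge) auto
    have "(shift ^^ n) x \<in> exit_set U \<longleftrightarrow> n = N" for n
      using exit N max by (metis linorder_neqE_nat not_le)
    then have "(\<Sum>n. indicator (exit_set U) ((shift ^^ n) x) :: ennreal) = (\<Sum>n. if n = N then 1 else 0)"
      by (intro suminf_cong) (auto simp: indicator_def)
    also have "\<dots> = 1" using sums_single[of N "\<lambda>_. 1::ennreal"] by (simp add: sums_iff)
    finally have "(\<Sum>n. indicator (exit_set U) ((shift ^^ n) x) :: ennreal) = 1" .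
    moreover have "x \<in> hit U" using N x by (auto simp: hit_def)
    ultimately show ?thesis by simp
  qed
qed

end

context conformal
begin

text \<open>Among points that start in \<open>[b]\<close>, the mean number of visits to
  \<open>[a]\<close> is the integral of \<open>G(1_[b], .)\<close> over \<open>[a]\<close>. The
  integrand is bounded there and \<open>[a]\<close> has finite measure, so the number of visits is
  finite almost everywhere.\<close>

lemma escape:
  "AE x in \<mu>. \<forall>a. finite {n. (shift ^^ n) x \<in> cyl [a]}"
proof -
  have *: "AE x in \<mu>. x \<in> cyl [b] \<longrightarrow> finite {n. (shift ^^ n) x \<in> cyl [a]}" for a b
  proof -
    obtain c where c: "c < \<infinity>" "\<And>x. x \<in> cyl [a] \<Longrightarrow> Gp (indicator (cyl [b])) x \<le> c"
      using Gp_letter_bounded[of a b] by blast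
    define h where "h x = indicator (cyl [b]) x * (\<Sum>n. indicator (cyl [a]) ((shift ^^ n) x) :: ennreal)" for x
    have [measurable]: "h \<in> borel_measurable B" unfolding h_def by measurable
    have "(\<integral>\<^sup>+x. h x \<partial>\<mu>) = (\<integral>\<^sup>+x. Gp (indicator (cyl [b])) x * indicator (cyl [a]) x \<partial>\<mu>)"
      unfolding h_def by (rule nn_integral_orbit) auto
    also have "\<dots> \<le> (\<integral>\<^sup>+x. c * indicator (cyl [a]) x \<partial>\<mu>)"
      using c(2) by (intro nn_integral_mono) (auto simp: indicator_def)
    also have "\<dots> = c * emeasure \<mu> (cyl [a])"
      by (subst nn_integral_cmult_indicator) (auto simp: sets_mu)
    also have "\<dots> < \<infinity>" using c(1) finite_cylinder[of "[a]"] by (simp add: ennreal_mult_less_top)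
    finally have "AE x in \<mu>. h x \<noteq> \<infinity>"
      by (intro nn_integral_noteq_infinite) auto
    then show ?thesis
    proof (rule AE_mp, intro AE_I2 impI)
      fix x assume "h x \<noteq> \<infinity>" "x \<in> cyl [b]"
      then have "(\<Sum>n. indicator {n. (shift ^^ n) x \<in> cyl [a]} n :: ennreal) \<noteq> \<infinity>"
        by (simp add: h_def indicator_def)
      then show "finite {n. (shift ^^ n) x \<in> cyl [a]}" by (rule suminf_indicator_card)
    qed
  qed
  \<comment> \<open>Only countably many pairs of letters occur, so their exceptional sets can be
    united; the condition on the starting letter disappears because every point starts with some
    letter.\<close>
  have "AE x in \<mu>. \<forall>p\<in>(UNIV :: ('s \<times> 's) set). x \<in> cyl [fst p] \<longrightarrow> finite {n. (shift ^^ n) x \<in> cyl [snd p]}"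
    using * countable_states by (subst AE_ball_countable) (auto simp flip: UNIV_Times_UNIV)
  then show ?thesis
    by (rule AE_mp) (auto intro!: AE_I2 simp: in_letter)
qed

text \<open>By \<open>escape\<close>, almost every orbit visits finitely many letters finitely
  often, so each orbit that hits \<open>U\<close> has a last visit. Both integrals become integrals
  of Green's functions over \<open>exit_set U\<close>, a subset of \<open>U\<close>.\<close>

lemma hit_compare_letters:
  assumes [measurable]: "f \<in> borel_measurable B" "g \<in> borel_measurable B" "U \<in> sets B"
    and F: "finite F" "U \<subseteq> letters F"
    and le: "\<And>x. x \<in> U \<Longrightarrow> Gp f x \<le> Gp g x"
  shows "(\<integral>\<^sup>+x. f x * indicator (hit U) x \<partial>\<mu>) \<le> (\<integral>\<^sup>+x. g x * indicator (hit U) x \<partial>\<mu>)"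
proof -
  have fin: "AE x in \<mu>. finite {n. (shift ^^ n) x \<in> U}"
    using escape
  proof (rule AE_mp, intro AE_I2 impI)
    fix x assume "\<forall>a. finite {n. (shift ^^ n) x \<in> cyl [a]}"
    then have "finite (\<Union>a\<in>F. {n. (shift ^^ n) x \<in> cyl [a]})" using F(1) by auto
    then show "finite {n. (shift ^^ n) x \<in> U}" by (rule rev_finite_subset) (use F(2) in auto)
  qed
  have *: "(\<integral>\<^sup>+x. h x * indicator (hit U) x \<partial>\<mu>) = (\<integral>\<^sup>+x. Gp h x * indicator (exit_set U) x \<partial>\<mu>)"
    if [measurable]: "h \<in> borel_measurable B" for h
  proof -
    have "(\<integral>\<^sup>+x. h x * indicator (hit U) x \<partial>\<mu>) = (\<integral>\<^sup>+x. h x * (\<Sum>n. indicator (exit_set U) ((shift ^^ n) x)) \<partial>\<mu>)"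
    proof (rule nn_integral_cong_AE, rule AE_mp[OF fin], intro AE_I2 impI)
      fix x assume "x \<in> space \<mu>" "finite {n. (shift ^^ n) x \<in> U}"
      then show "h x * indicator (hit U) x = h x * (\<Sum>n. indicator (exit_set U) ((shift ^^ n) x))"
        by (simp only: indicator_hit_eq space_mu)
    qed
    then show ?thesis using nn_integral_orbit[of h "indicator (exit_set U)"] by simp
  qed
  show ?thesis
    unfolding *[OF assms(1)] *[OF assms(2)] using le
    by (intro nn_integral_mono) (auto simp: indicator_def exit_set_def)
qed

text \<open>Without a restriction on its letters \<open>U\<close> may be visited infinitely often.
  The part \<open>W m\<close> of \<open>U\<close> in the first \<open>m\<close> letters of an
  enumeration admits last exits, and the sets \<open>hit (W m)\<close> increase to
  \<open>hit U\<close>.\<close>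

lemma hit_compare:
  assumes [measurable]: "f \<in> borel_measurable B" "g \<in> borel_measurable B" "U \<in> sets B"
    and le: "\<And>x. x \<in> U \<Longrightarrow> Gp f x \<le> Gp g x"
  shows "(\<integral>\<^sup>+x. f x * indicator (hit U) x \<partial>\<mu>) \<le> (\<integral>\<^sup>+x. g x * indicator (hit U) x \<partial>\<mu>)"
proof -
  define F where "F m = from_nat_into (UNIV :: 's set) ` {..<m::nat}" for m
  define V where "V m = {x \<in> X. x 0 \<in> F m}" for m
  define W where "W m = U \<inter> V m" for m
  have V: "V m = (\<Union>a\<in>F m. cyl [a])" for m by (auto simp: V_def in_letter)
  have Wm [measurable]: "W m \<in> sets B" for m unfolding W_def V_def by measurable
  have Fmono: "F m \<subseteq> F n" if "m \<le> n" for m n using that by (auto simp: F_def)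
  have inc: "incseq (\<lambda>m. hit (W m))"
    using Fmono by (fastforce simp: incseq_def hit_def W_def V_def)
  have UX: "U \<subseteq> X" using sets.sets_into_space[OF assms(3)] by simp
  have un: "(\<Union>m. hit (W m)) = hit U"
  proof
    show "hit U \<subseteq> (\<Union>m. hit (W m))"
    proof
      fix x assume "x \<in> hit U"
      then obtain n where x: "x \<in> X" and n: "(shift ^^ n) x \<in> U" by (auto simp: hit_def)
      obtain k where k: "from_nat_into UNIV k = (shift ^^ n) x 0"
        using from_nat_into_surj[OF countable_states] by blast
      have "(shift ^^ n) x \<in> W (Suc k)"
        using n shift_pow_in_tms[OF x] k[symmetric] by (auto simp: W_def V_def F_def)
      then show "x \<in> (\<Union>m. hit (W m))" using x by (auto simp: hit_def)
    qed
  qed (auto simp: hit_def W_def)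
  have "(\<integral>\<^sup>+x. f x * indicator (hit U) x \<partial>\<mu>) = (\<integral>\<^sup>+x. (SUP m. f x * indicator (hit (W m)) x) \<partial>\<mu>)"
  proof (rule nn_integral_cong)
    fix x
    have "(SUP m. indicator (hit (W m)) x :: ennreal) = indicator (hit U) x"
    proof (rule LIMSEQ_unique[OF LIMSEQ_SUP])
      show "incseq (\<lambda>m. indicator (hit (W m)) x :: ennreal)"
        using inc by (auto simp: incseq_def indicator_def)
      show "(\<lambda>m. indicator (hit (W m)) x :: ennreal) \<longlonglongrightarrow> indicator (hit U) x"
        unfolding un[symmetric] by (rule LIMSEQ_indicator_incseq[OF inc])
    qed
    then show "f x * indicator (hit U) x = (SUP m. f x * indicator (hit (W m)) x)"
      by (simp add: SUP_mult_left_ennreal[symmetric])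
  qed
  also have "\<dots> = (SUP m. \<integral>\<^sup>+x. f x * indicator (hit (W m)) x \<partial>\<mu>)"
  proof (rule nn_integral_monotone_convergence_SUP)
    show "incseq (\<lambda>m x. f x * indicator (hit (W m)) x)"
      using inc by (auto simp: incseq_def le_fun_def indicator_def)
  qed simp
  also have "\<dots> \<le> (\<integral>\<^sup>+x. g x * indicator (hit U) x \<partial>\<mu>)"
  proof (rule SUP_least)
    fix m
    have "(\<integral>\<^sup>+x. f x * indicator (hit (W m)) x \<partial>\<mu>) \<le> (\<integral>\<^sup>+x. g x * indicator (hit (W m)) x \<partial>\<mu>)"
      using le by (intro hit_compare_letters[of _ _ _ "F m"]) (auto simp: W_def V F_def)
    also have "\<dots> \<le> (\<integral>\<^sup>+x. g x * indicator (hit U) x \<partial>\<mu>)"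
      using un by (intro nn_integral_mono mult_left_mono) (auto simp: indicator_def)
    finally show "(\<integral>\<^sup>+x. f x * indicator (hit (W m)) x \<partial>\<mu>) \<le> (\<integral>\<^sup>+x. g x * indicator (hit U) x \<partial>\<mu>)" .
  qed
  finally show ?thesis .
qed

end

section \<open>Level sets of the kernel\<close>

context transient_tms
begin

lemma Gp_one: "u \<noteq> [] \<Longrightarrow> x \<in> X \<Longrightarrow> Gp (indicator (cyl u)) x = ennreal (G (one u) x)"
  using Gp_ennreal[OF nice_one, of u x] by (simp add: ennreal_indicator)

lemma green_one_nonneg: "u \<noteq> [] \<Longrightarrow> x \<in> X \<Longrightarrow> 0 \<le> G (one u) x"
  using green_mono[OF nice_zero nice_one, of u x] by (simp add: green_zero)

lemma K_one_nonneg: "u \<noteq> [] \<Longrightarrow> x \<in> X \<Longrightarrow> 0 \<le> K (one u) x"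
  by (intro K_nonneg nice_one) auto

lemma green_eq_K: "x \<in> X \<Longrightarrow> G f x = K f x * G (one [orig]) x"
  using green_orig_pos[of x] by (simp add: martin_kernel_def)

lemma green_one_measurable: "u \<noteq> [] \<Longrightarrow> G (one u) \<in> borel_measurable B"
proof -
  assume u: "u \<noteq> []"
  have "(\<lambda>x. enn2real (Gp (indicator (cyl u)) x)) \<in> borel_measurable B" by measurable
  then show ?thesis
    by (rule measurable_cong[THEN iffD1, rotated]) (simp add: Gp_one[OF u] green_one_nonneg[OF u])
qed

lemma K_one_measurable [measurable (raw)]: "u \<noteq> [] \<Longrightarrow> K (one u) \<in> borel_measurable B"
  unfolding martin_kernel_def[abs_def]
  by (intro borel_measurable_divide green_one_measurable) auto

end

context conformal
begin

lemma recurrent_compare: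
  assumes [measurable]: "f \<in> borel_measurable B" "g \<in> borel_measurable B" "U \<in> sets B"
    and hits: "AE x in \<mu>. \<exists>n. (shift ^^ n) x \<in> U"
    and le: "\<And>x. x \<in> U \<Longrightarrow> Gp f x \<le> Gp g x"
  shows "(\<integral>\<^sup>+x. f x \<partial>\<mu>) \<le> (\<integral>\<^sup>+x. g x \<partial>\<mu>)"
proof -
  have "AE x in \<mu>. x \<in> hit U"
    using hits by (rule AE_mp) (auto intro!: AE_I2 simp: hit_def)
  then have "(\<integral>\<^sup>+x. f x * indicator (hit U) x \<partial>\<mu>) = (\<integral>\<^sup>+x. f x \<partial>\<mu>)" for f
    by (intro nn_integral_cong_AE, elim AE_mp) (intro AE_I2, simp)
  then show ?thesis using hit_compare[OF assms(1-3) le] by simp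
qed

lemma level_set_measurable:
  assumes "u \<noteq> []"
  shows "{x \<in> X. K (one u) x > b} \<in> sets B" "{x \<in> X. K (one u) x < b} \<in> sets B"
proof -
  have [measurable]: "K (one u) \<in> borel_measurable B" by (rule K_one_measurable[OF assms])
  have "{x \<in> space B. K (one u) x > b} \<in> sets B" "{x \<in> space B. K (one u) x < b} \<in> sets B"
    by measurable
  then show "{x \<in> X. K (one u) x > b} \<in> sets B" "{x \<in> X. K (one u) x < b} \<in> sets B" by simp_all
qed

text \<open>On the level set, Green's function of \<open>b * 1_[orig]\<close> is at most that of
  \<open>1_[u]\<close>, and almost every orbit hits this set.\<close>

lemma kernel_lower:
  assumes u: "u \<noteq> []" and hits: "AE x in \<mu>. \<exists>n. (shift ^^ n) x \<in> {x \<in> X. K (one u) x > b}"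
  shows "ennreal b * emeasure \<mu> (cyl [orig]) \<le> emeasure \<mu> (cyl u)"
proof -
  have "(\<integral>\<^sup>+x. ennreal b * indicator (cyl [orig]) x \<partial>\<mu>) \<le> (\<integral>\<^sup>+x. indicator (cyl u) x \<partial>\<mu>)"
  proof (rule recurrent_compare[OF _ _ level_set_measurable(1)[OF u] hits])
    fix x assume x: "x \<in> {x \<in> X. K (one u) x > b}"
    then have xX: "x \<in> X" by simp
    have "b * G (one [orig]) x \<le> G (one u) x"
      using x green_orig_pos[OF xX] by (simp add: green_eq_K[OF xX, of "one u"])
    then show "Gp (\<lambda>x. ennreal b * indicator (cyl [orig]) x) x \<le> Gp (indicator (cyl u)) x"
      using green_orig_pos[OF xX]
      by (simp add: Gp_cmult Gp_one[OF _ xX] u ennreal_mult''[symmetric] ennreal_leI)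
  qed auto
  then show ?thesis by (simp add: nn_integral_cmult sets_mu)
qed

lemma kernel_upper:
  assumes u: "u \<noteq> []" and hits: "AE x in \<mu>. \<exists>n. (shift ^^ n) x \<in> {x \<in> X. K (one u) x < b}"
  shows "emeasure \<mu> (cyl u) \<le> ennreal b * emeasure \<mu> (cyl [orig])"
proof -
  have "(\<integral>\<^sup>+x. indicator (cyl u) x \<partial>\<mu>) \<le> (\<integral>\<^sup>+x. ennreal b * indicator (cyl [orig]) x \<partial>\<mu>)"
  proof (rule recurrent_compare[OF _ _ level_set_measurable(2)[OF u] hits])
    fix x assume x: "x \<in> {x \<in> X. K (one u) x < b}"
    then have xX: "x \<in> X" by simp
    have "G (one u) x \<le> b * G (one [orig]) x"
      using x green_orig_pos[OF xX] by (simp add: green_eq_K[OF xX, of "one u"])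
    then show "Gp (indicator (cyl u)) x \<le> Gp (\<lambda>x. ennreal b * indicator (cyl [orig]) x) x"
      using green_orig_pos[OF xX]
      by (simp add: Gp_cmult Gp_one[OF _ xX] u ennreal_mult''[symmetric] ennreal_leI)
  qed auto
  then show ?thesis by (simp add: nn_integral_cmult sets_mu)
qed

section \<open>Zero-one law for extremal measures and its consequence for the kernel\<close>

lemma emeasure_restrict:
  "E \<in> sets B \<Longrightarrow> D \<in> sets B \<Longrightarrow> emeasure (density \<mu> (indicator E)) D = emeasure \<mu> (E \<inter> D)"
  by (subst emeasure_density) (auto simp: sets_mu nn_integral_indicator[symmetric] simp del: nn_integral_indicator intro!: nn_integral_cong split: split_indicator)

text \<open>Invariance means that \<open>indicator E x\<close> and
  \<open>indicator E (shift x)\<close> coincide on \<open>X\<close>, so by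
  \<open>Lp_mult_shift\<close> the density passes through the operator.\<close>

lemma restrict_conformal:
  assumes [measurable]: "E \<in> sets B" and inv: "\<And>x. x \<in> X \<Longrightarrow> shift x \<in> E \<longleftrightarrow> x \<in> E"
  shows "density \<mu> (indicator E) \<in> Conf A \<phi> lam"
  unfolding Conf_def radon_measure_def mem_Collect_eq
proof (intro conjI allI impI)
  show "sets (density \<mu> (indicator E)) = sets B" by (simp add: sets_mu)
  fix U assume U: "compactin (tms_top A) U"
  have [measurable]: "U \<in> sets B"
    using closedin_in_borel_on compactin_imp_closedin[OF Hausdorff_tms_top U] by blast
  have em: "emeasure (density \<mu> (indicator E)) U = emeasure \<mu> (E \<inter> U)"
    by (rule emeasure_restrict) auto
  also have "\<dots> \<le> emeasure \<mu> U" by (intro emeasure_mono) (auto simp: sets_mu)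
  finally show "emeasure (density \<mu> (indicator E)) U < \<infinity>" using finite_compact[OF U] by simp
  obtain F where F: "supported F (indicator U)" using nice_indicator[OF U] by (auto simp: nice_def)
  have "(\<integral>\<^sup>+x. ennreal (L (indicator U) x) \<partial>density \<mu> (indicator E)) = (\<integral>\<^sup>+x. Lp (indicator U) x \<partial>density \<mu> (indicator E))"
    using Lp_ennreal[OF F] by (intro nn_integral_cong) (simp add: ennreal_indicator)
  also have "\<dots> = (\<integral>\<^sup>+x. indicator E x * Lp (indicator U) x \<partial>\<mu>)"
    by (rule nn_integral_density) auto
  also have "\<dots> = (\<integral>\<^sup>+x. Lp (\<lambda>x. indicator U x * indicator E (shift x)) x \<partial>\<mu>)"
    by (simp add: Lp_mult_shift mult.commute)
  also have "\<dots> = ennreal lam * (\<integral>\<^sup>+x. indicator U x * indicator E (shift x) \<partial>\<mu>)"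
    by (rule conformal_fun) measurable
  also have "(\<integral>\<^sup>+x. indicator U x * indicator E (shift x) \<partial>\<mu>) = (\<integral>\<^sup>+x. indicator (E \<inter> U) x \<partial>\<mu>)"
    using inv by (intro nn_integral_cong) (auto simp: indicator_def)
  also have "\<dots> = emeasure (density \<mu> (indicator E)) U" unfolding em by (simp add: sets_mu)
  finally show "(\<integral>\<^sup>+x. ennreal (L (indicator U) x) \<partial>density \<mu> (indicator E)) = ennreal lam * emeasure (density \<mu> (indicator E)) U" .
qed

lemma null_letters:
  assumes [measurable]: "E \<in> sets B" and "\<And>a. emeasure \<mu> (E \<inter> cyl [a]) = 0"
  shows "AE x in \<mu>. x \<notin> E"
proof -
  have "AE x in \<mu>. x \<notin> E \<inter> cyl [a]" for a
    using assms(2)[of a] by (intro AE_not_in null_setsI) (simp_all add: sets_mu)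
  then have "AE x in \<mu>. \<forall>a\<in>UNIV. x \<notin> E \<inter> cyl [a]"
    by (subst AE_ball_countable[OF countable_states]) blast
  then show ?thesis
    by (rule AE_mp) (auto intro!: AE_I2 simp: in_letter)
qed

text \<open>The restriction to \<open>E\<close> is \<open>c\<close> times \<open>\<mu>\<close>. It
  vanishes on the complement of \<open>E\<close>, so a nonzero \<open>c\<close> makes that
  complement null, while \<open>c = 0\<close> makes \<open>E\<close> null.\<close>

lemma extremal_dichotomy:
  assumes ext: "extremal_Conf A \<phi> lam \<mu>"
    and E [measurable]: "E \<in> sets B" and inv: "\<And>x. x \<in> X \<Longrightarrow> shift x \<in> E \<longleftrightarrow> x \<in> E"
  shows "(AE x in \<mu>. x \<in> E) \<or> (AE x in \<mu>. x \<notin> E)"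
proof -
  have c1: "density \<mu> (indicator E) \<in> Conf A \<phi> lam" using E inv by (rule restrict_conformal)
  have c2: "density \<mu> (indicator (X - E)) \<in> Conf A \<phi> lam"
    using inv shift_in_tms sets.compl_sets[OF E] by (intro restrict_conformal) auto
  have Ec [measurable]: "X - E \<in> sets B" using sets.compl_sets[OF E] by simp
  have "emeasure \<mu> D = emeasure (density \<mu> (indicator E)) D + emeasure (density \<mu> (indicator (X - E))) D"
    if "D \<in> sets \<mu>" for D
  proof -
    have D [measurable]: "D \<in> sets B" using that sets_mu by simp
    have "emeasure \<mu> (E \<inter> D) + emeasure \<mu> ((X - E) \<inter> D) = emeasure \<mu> ((E \<inter> D) \<union> ((X - E) \<inter> D))"
      by (intro plus_emeasure) (auto simp: sets_mu)
    also have "(E \<inter> D) \<union> ((X - E) \<inter> D) = D" using sets.sets_into_space[OF D] by auto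
    finally show ?thesis by (simp add: emeasure_restrict)
  qed
  then obtain c where c: "density \<mu> (indicator E) = scale_measure (ennreal c) \<mu>"
    using ext c1 c2 unfolding extremal_Conf_def by blast
  have eq: "emeasure \<mu> (E \<inter> D) = ennreal c * emeasure \<mu> D" if "D \<in> sets B" for D
    using arg_cong[OF c, of "\<lambda>M. emeasure M D"] emeasure_restrict[OF E that] by simp
  show ?thesis
  proof (cases "ennreal c = 0")
    case True
    then have "AE x in \<mu>. x \<notin> E" using eq by (intro null_letters) auto
    then show ?thesis ..
  next
    case False
    have "emeasure \<mu> ((X - E) \<inter> cyl [a]) = 0" for a
    proof -
      have "E \<inter> ((X - E) \<inter> cyl [a]) = {}" by auto
      then show ?thesis using eq[of "(X - E) \<inter> cyl [a]"] False by simp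
    qed
    then have "AE x in \<mu>. x \<notin> X - E" by (intro null_letters) auto
    then have "AE x in \<mu>. x \<in> E" by (rule AE_mp) (auto intro!: AE_I2)
    then show ?thesis ..
  qed
qed

text \<open>Deleting the first point of an orbit does not change whether it visits \<open>U\<close>
  infinitely often. The same fails for \<open>hit U\<close>, whose only visit may be the deleted
  point.\<close>

lemma frequently_dichotomy:
  assumes ext: "extremal_Conf A \<phi> lam \<mu>" and U [measurable]: "U \<in> sets B"
  shows "(AE x in \<mu>. \<forall>N. \<exists>n\<ge>N. (shift ^^ n) x \<in> U) \<or> (AE x in \<mu>. \<exists>N. \<forall>n\<ge>N. (shift ^^ n) x \<notin> U)"
proof -
  define E where "E = {x \<in> X. \<forall>N. \<exists>n\<ge>N. (shift ^^ n) x \<in> U}"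
  have "E = {x \<in> space B. \<forall>N. \<exists>n\<in>{N..}. (shift ^^ n) x \<in> U}" by (auto simp: E_def)
  also have "\<dots> \<in> sets B" by measurable
  finally have E: "E \<in> sets B" .
  have "shift x \<in> E \<longleftrightarrow> x \<in> E" if x: "x \<in> X" for x
  proof -
    have "(\<forall>N. \<exists>n\<ge>N. (shift ^^ n) (shift x) \<in> U) \<longleftrightarrow> (\<forall>N. \<exists>n\<ge>Suc N. (shift ^^ n) x \<in> U)"
    proof -
      have "(shift ^^ n) (shift x) = (shift ^^ Suc n) x" for n by (simp add: funpow_swap1)
      then show ?thesis by (metis Suc_le_D Suc_le_mono)
    qed
    also have "\<dots> \<longleftrightarrow> (\<forall>N. \<exists>n\<ge>N. (shift ^^ n) x \<in> U)" by (meson Suc_leD le_refl)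
    finally show ?thesis using x shift_in_tms[OF x] by (simp add: E_def)
  qed
  from extremal_dichotomy[OF ext E this] show ?thesis
  proof
    assume "AE x in \<mu>. x \<in> E"
    then have "AE x in \<mu>. \<forall>N. \<exists>n\<ge>N. (shift ^^ n) x \<in> U" by (rule AE_mp) (auto intro!: AE_I2 simp: E_def)
    then show ?thesis ..
  next
    assume "AE x in \<mu>. x \<notin> E"
    then have "AE x in \<mu>. \<exists>N. \<forall>n\<ge>N. (shift ^^ n) x \<notin> U" by (rule AE_mp) (auto intro!: AE_I2 simp: E_def)
    then show ?thesis ..
  qed
qed

text \<open>If the kernel exceeded some \<open>b\<close> above the claimed limit infinitely often,
  almost every orbit would hit the level set and \<open>kernel_lower\<close> would bound
  \<open>b\<close> by the limit. The normalization on \<open>cyl [orig]\<close> removes the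
  denominator from the limit.\<close>

lemma extremal_kernel_limit:
  assumes ext: "extremal_Conf A \<phi> lam \<mu>" and u: "u \<noteq> []"
    and pos: "emeasure \<mu> (cyl [orig]) = 1"
  shows "AE x in \<mu>. (\<lambda>n. K (one u) ((shift ^^ n) x)) \<longlonglongrightarrow> measure \<mu> (cyl u)"
proof -
  define \<kappa> where "\<kappa> = measure \<mu> (cyl u)"
  have em: "emeasure \<mu> (cyl u) = ennreal \<kappa>"
    unfolding \<kappa>_def using finite_cylinder[OF u] by (intro emeasure_eq_ennreal_measure) auto
  have k0: "\<kappa> \<ge> 0" by (simp add: \<kappa>_def)
  have up: "AE x in \<mu>. \<exists>N. \<forall>n\<ge>N. K (one u) ((shift ^^ n) x) \<le> b" if "b > \<kappa>" for b
  proof -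
    from frequently_dichotomy[OF ext level_set_measurable(1)[OF u]] show ?thesis
    proof
      assume "AE x in \<mu>. \<forall>N. \<exists>n\<ge>N. (shift ^^ n) x \<in> {x \<in> X. K (one u) x > b}"
      then have "AE x in \<mu>. \<exists>n. (shift ^^ n) x \<in> {x \<in> X. K (one u) x > b}"
        by (rule AE_mp) (auto intro!: AE_I2)
      from kernel_lower[OF u this] have "ennreal b \<le> ennreal \<kappa>" by (simp add: pos em)
      then show ?thesis using that k0 by (simp add: ennreal_le_iff)
    next
      assume "AE x in \<mu>. \<exists>N. \<forall>n\<ge>N. (shift ^^ n) x \<notin> {x \<in> X. K (one u) x > b}"
      then show ?thesis
      proof (rule AE_mp, intro AE_I2 impI)
        fix x assume "x \<in> space \<mu>" "\<exists>N. \<forall>n\<ge>N. (shift ^^ n) x \<notin> {x \<in> X. K (one u) x > b}"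
        then show "\<exists>N. \<forall>n\<ge>N. K (one u) ((shift ^^ n) x) \<le> b"
          using shift_pow_in_tms[of x A] by (auto simp: not_less)
      qed
    qed
  qed
  have low: "AE x in \<mu>. \<exists>N. \<forall>n\<ge>N. K (one u) ((shift ^^ n) x) \<ge> b" if "b < \<kappa>" for b
  \<comment> \<open>For \<open>b \<le> 0\<close> the bound is non-negativity of the kernel. For
    positive \<open>b\<close> nothing is lost when an inequality in \<open>ennreal\<close> is read
    as one between reals.\<close>
  proof (cases "b \<le> 0")
    case True
    have "b \<le> K (one u) ((shift ^^ n) x)" if "x \<in> X" for n x
      using True K_one_nonneg[OF u shift_pow_in_tms[OF that]] by (rule order_trans)
    then show ?thesis by (intro AE_I2) auto
  next
    case False
    from frequently_dichotomy[OF ext level_set_measurable(2)[OF u]] show ?thesis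
    proof
      assume "AE x in \<mu>. \<forall>N. \<exists>n\<ge>N. (shift ^^ n) x \<in> {x \<in> X. K (one u) x < b}"
      then have "AE x in \<mu>. \<exists>n. (shift ^^ n) x \<in> {x \<in> X. K (one u) x < b}"
        by (rule AE_mp) (auto intro!: AE_I2)
      from kernel_upper[OF u this] have "ennreal \<kappa> \<le> ennreal b" by (simp add: pos em)
      then show ?thesis using that False by (simp add: ennreal_le_iff)
    next
      assume "AE x in \<mu>. \<exists>N. \<forall>n\<ge>N. (shift ^^ n) x \<notin> {x \<in> X. K (one u) x < b}"
      then show ?thesis
      proof (rule AE_mp, intro AE_I2 impI)
        fix x assume "x \<in> space \<mu>" "\<exists>N. \<forall>n\<ge>N. (shift ^^ n) x \<notin> {x \<in> X. K (one u) x < b}"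
        then show "\<exists>N. \<forall>n\<ge>N. K (one u) ((shift ^^ n) x) \<ge> b"
          using shift_pow_in_tms[of x A] by (auto simp: not_less)
      qed
    qed
  qed
  \<comment> \<open>Countably many thresholds suffice, which keeps the exceptional set null.\<close>
  have "AE x in \<mu>. \<forall>k. (\<exists>N. \<forall>n\<ge>N. K (one u) ((shift ^^ n) x) \<le> \<kappa> + 1 / Suc k)
      \<and> (\<exists>N. \<forall>n\<ge>N. K (one u) ((shift ^^ n) x) \<ge> \<kappa> - 1 / Suc k)"
    unfolding AE_all_countable by (intro allI AE_conjI up low) auto
  then show ?thesis unfolding \<kappa>_def[symmetric]
  proof (rule AE_mp, intro AE_I2 impI)
    fix x assume *: "\<forall>k. (\<exists>N. \<forall>n\<ge>N. K (one u) ((shift ^^ n) x) \<le> \<kappa> + 1 / Suc k)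
      \<and> (\<exists>N. \<forall>n\<ge>N. K (one u) ((shift ^^ n) x) \<ge> \<kappa> - 1 / Suc k)"
    show "(\<lambda>n. K (one u) ((shift ^^ n) x)) \<longlonglongrightarrow> \<kappa>"
    proof (rule LIMSEQ_I)
      fix r :: real assume "r > 0"
      then obtain k where k: "inverse (real (Suc k)) < r" using reals_Archimedean by blast
      obtain N1 N2 where "\<forall>n\<ge>N1. K (one u) ((shift ^^ n) x) \<le> \<kappa> + 1 / Suc k"
        "\<forall>n\<ge>N2. K (one u) ((shift ^^ n) x) \<ge> \<kappa> - 1 / Suc k" using * by blast
      then have "\<forall>n\<ge>max N1 N2. norm (K (one u) ((shift ^^ n) x) - \<kappa>) < r"
        using k by (fastforce simp: inverse_eq_divide abs_less_iff)
      then show "\<exists>N. \<forall>n\<ge>N. norm (K (one u) ((shift ^^ n) x) - \<kappa>) < r" by blast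
    qed
  qed
qed

end

context transient_tms
begin

section \<open>Approximation of compactly supported functions by cylinder functions\<close>

lemma Cc_supported:
  assumes f: "f \<in> Cc A"
  obtains F where "supported F f"
proof -
  have comp: "compactin (tms_top A) (tms_top A closure_of {x \<in> X. f x \<noteq> 0})" using f by (simp add: Cc_def)
  obtain F where F: "finite F" "tms_top A closure_of {x \<in> X. f x \<noteq> 0} \<subseteq> letters F"
    using compactin_finite_letters[OF comp] .
  have "{x \<in> X. f x \<noteq> 0} \<subseteq> letters F"
    using closure_of_subset[of "{x \<in> X. f x \<noteq> 0}" "tms_top A"] F(2) by auto
  then have "supported F f" using F(1) by (auto simp: supported_def in_letter)
  then show ?thesis by (rule that)
qed

lemma Cc_continuous_at:
  assumes f: "f \<in> Cc A" and x: "x \<in> X" and r: "r > 0"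
  obtains n where "\<And>y. y \<in> X \<Longrightarrow> agree n x y \<Longrightarrow> \<bar>f y - f x\<bar> < r"
proof -
  have "openin (tms_top A) {y \<in> X. f y \<in> ball (f x) r}"
    using f openin_continuous_map_preimage[of "tms_top A" euclideanreal f "ball (f x) r"]
    by (simp add: Cc_def)
  moreover have "x \<in> {y \<in> X. f y \<in> ball (f x) r}" using x r by simp
  ultimately obtain n where "\<forall>y\<in>X. agree n x y \<longrightarrow> y \<in> {y \<in> X. f y \<in> ball (f x) r}"
    unfolding openin_tms_top_iff by blast
  then show ?thesis using that[of n] by (auto simp: dist_real_def abs_minus_commute)
qed

lemma Cc_measurable: "f \<in> Cc A \<Longrightarrow> f \<in> borel_measurable B"
proof (rule borel_measurableI)
  fix S :: "real set" assume "f \<in> Cc A" "open S"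
  then have "openin (tms_top A) {x \<in> X. f x \<in> S}"
    using openin_continuous_map_preimage[of "tms_top A" euclideanreal f S] by (simp add: Cc_def)
  moreover have "f -` S \<inter> space B = {x \<in> X. f x \<in> S}" by auto
  ultimately show "f -` S \<inter> space B \<in> sets B" using openin_in_borel_on by metis
qed

lemma Cc_uniform:
  assumes f: "f \<in> Cc A" and F: "finite F" and r: "r > 0"
  obtains l where "l \<ge> 1" "\<And>x y. x \<in> X \<Longrightarrow> y \<in> X \<Longrightarrow> x 0 \<in> F \<Longrightarrow> agree l x y \<Longrightarrow> \<bar>f y - f x\<bar> \<le> r"
proof -
  define V where "V = letters F"
  have comp: "compactin (tms_top A) V" using indicator_letters[OF F] by (simp add: V_def)
  have "\<exists>n. \<forall>y. y \<in> X \<longrightarrow> agree n x y \<longrightarrow> \<bar>f y - f x\<bar> < r / 2" if "x \<in> X" for x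
    using Cc_continuous_at[OF f that, of "r/2"] r by (metis half_gt_zero)
  then obtain N where N: "\<And>x y. x \<in> X \<Longrightarrow> y \<in> X \<Longrightarrow> agree (N x) x y \<Longrightarrow> \<bar>f y - f x\<bar> < r / 2"
    by metis
  have VX: "V \<subseteq> X" using compactin_tms_top_subset[OF comp] .
  have mem: "x \<in> cyl (pref x (N x))" if "x \<in> X" for x
    using that by (simp add: in_cylinder_pref agree_def)
  have "\<exists>\<F>. finite \<F> \<and> \<F> \<subseteq> (\<lambda>x. cyl (pref x (N x))) ` V \<and> V \<subseteq> \<Union>\<F>"
    using comp unfolding compactin_def
    by (elim conjE allE[of _ "(\<lambda>x. cyl (pref x (N x))) ` V"]) (use mem VX in \<open>auto simp: openin_cylinder\<close>)
  then obtain \<F> where \<F>: "finite \<F>" "\<F> \<subseteq> (\<lambda>x. cyl (pref x (N x))) ` V" "V \<subseteq> \<Union>\<F>"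
    by blast
  obtain D where D: "finite D" "D \<subseteq> V" "\<F> = (\<lambda>x. cyl (pref x (N x))) ` D"
    using finite_subset_image[OF \<F>(1,2)] by blast
  have D3: "V \<subseteq> (\<Union>x\<in>D. cyl (pref x (N x)))" using \<F>(3) D(3) by simp
  \<comment> \<open>The longest prefix in the finite subcover. Inserting 1 makes the maximum
    meaningful for an empty subcover and ensures that prefixes of length \<open>l\<close> show the
    first letter.\<close>
  define l where "l = Max (insert 1 (N ` D))"
  have l: "l \<ge> 1" "\<And>d. d \<in> D \<Longrightarrow> N d \<le> l" using D(1) by (auto simp: l_def)
  have "\<bar>f y - f x\<bar> \<le> r" if xy: "x \<in> X" "y \<in> X" "x 0 \<in> F" "agree l x y" for x y
  proof -
    have "x \<in> V" using xy by (auto simp: V_def in_letter)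
    then obtain d where d: "d \<in> D" "x \<in> cyl (pref d (N d))" using D3 by blast
    have dX: "d \<in> X" using d D(2) VX by blast
    have a1: "agree (N d) d x" using d(2) by (simp add: in_cylinder_pref)
    have a2: "agree (N d) d y" using a1 agree_mono[OF xy(4) l(2)[OF d(1)]] by (simp add: agree_def)
    show ?thesis using N[OF dX xy(1) a1] N[OF dX xy(2) a2] by linarith
  qed
  with l(1) show ?thesis by (rule that)
qed

lemma nice_sum: "finite W \<Longrightarrow> (\<And>u. u \<in> W \<Longrightarrow> u \<noteq> []) \<Longrightarrow> nice (\<lambda>x. \<Sum>u\<in>W. c u * one u x)"
proof (induction W rule: finite_induct)
  case (insert u W)
  then have "nice (\<lambda>x. c u * one u x + (\<Sum>u\<in>W. c u * one u x))"
    by (intro nice_lincomb nice_one) auto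
  moreover have "(\<lambda>x. \<Sum>u\<in>insert u W. c u * one u x) = (\<lambda>x. c u * one u x + (\<Sum>u\<in>W. c u * one u x))"
    using insert(1,2) by (intro ext sum.insert)
  ultimately show ?case by (simp only:)
qed (simp add: nice_zero)

lemma K_sum:
  "finite W \<Longrightarrow> (\<And>u. u \<in> W \<Longrightarrow> u \<noteq> []) \<Longrightarrow> x \<in> X \<Longrightarrow>
    K (\<lambda>x. \<Sum>u\<in>W. c u * one u x) x = (\<Sum>u\<in>W. c u * K (one u) x)"
proof (induction W rule: finite_induct)
  case (insert u W)
  then have "K (\<lambda>x. c u * one u x + (\<Sum>u\<in>W. c u * one u x)) x = c u * K (one u) x + K (\<lambda>x. \<Sum>u\<in>W. c u * one u x) x"
    by (intro K_lincomb nice_one nice_sum) auto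
  moreover have "(\<lambda>x. \<Sum>u\<in>insert u W. c u * one u x) = (\<lambda>x. c u * one u x + (\<Sum>u\<in>W. c u * one u x))"
    using insert(1,2) by (intro ext sum.insert)
  moreover have "K (\<lambda>x. \<Sum>u\<in>W. c u * one u x) x = (\<Sum>u\<in>W. c u * K (one u) x)"
    using insert by blast
  ultimately show ?case using sum.insert[OF insert(1,2), of "\<lambda>u. c u * K (one u) x"] by (simp only:)
qed (simp add: K_zero)

lemma finite_prefixes:
  assumes "compactin (tms_top A) V"
  obtains W where "finite W" "\<And>u. u \<in> W \<Longrightarrow> length u = l" "V \<subseteq> (\<Union>u\<in>W. cyl u)"
proof -
  have "V \<subseteq> \<Union> ((\<lambda>x. cyl (pref x l)) ` V)"
    using compactin_tms_top_subset[OF assms] by (auto simp: in_cylinder_pref agree_def)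
  then have "\<exists>\<F>. finite \<F> \<and> \<F> \<subseteq> (\<lambda>x. cyl (pref x l)) ` V \<and> V \<subseteq> \<Union>\<F>"
    using assms unfolding compactin_def
    by (elim conjE allE[of _ "(\<lambda>x. cyl (pref x l)) ` V"]) (auto simp: openin_cylinder)
  then obtain \<F> where \<F>: "finite \<F>" "\<F> \<subseteq> (\<lambda>x. cyl (pref x l)) ` V" "V \<subseteq> \<Union>\<F>"
    by blast
  obtain D where D: "finite D" "D \<subseteq> V" "\<F> = (\<lambda>x. cyl (pref x l)) ` D"
    using finite_subset_image[OF \<F>(1,2)] by blast
  have D3: "V \<subseteq> (\<Union>x\<in>D. cyl (pref x l))" using \<F>(3) D(3) by simp
  show ?thesis
    by (rule that[of "(\<lambda>x. pref x l) ` D"]) (use D(1) D3 in \<open>auto simp: pref_def\<close>)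
qed

text \<open>The error is dominated by a multiple of one fixed indicator and not just by a constant:
  a constant function is not supported on finitely many letters, whereas the kernel of this
  indicator controls the error after \<open>K\<close> is applied.\<close>

lemma Cc_approx:
  assumes f: "f \<in> Cc A" and F: "supported F f" and r: "r > 0"
  obtains W c where "finite W" "\<And>u. u \<in> W \<Longrightarrow> u \<noteq> []"
    "\<And>x. x \<in> X \<Longrightarrow> \<bar>f x - (\<Sum>u\<in>W. c u * one u x)\<bar> \<le> r * indicator (letters F) x"
proof -
  define V where "V = letters F"
  have fin: "finite F" using F by (simp add: supported_def)
  have comp: "compactin (tms_top A) V" using indicator_letters[OF fin] by (simp add: V_def)
  obtain l where l: "l \<ge> 1" "\<And>x y. x \<in> X \<Longrightarrow> y \<in> X \<Longrightarrow> x 0 \<in> F \<Longrightarrow> agree l x y \<Longrightarrow> \<bar>f y - f x\<bar> \<le> r"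
    using Cc_uniform[OF f fin r] by blast
  obtain W where W: "finite W" "\<And>u. u \<in> W \<Longrightarrow> length u = l" "V \<subseteq> (\<Union>u\<in>W. cyl u)"
    using finite_prefixes[OF comp, of l] by blast
  \<comment> \<open>The step function samples \<open>f\<close> at one point of \<open>V\<close> in
    each cylinder. The value 0 for cylinders that miss \<open>V\<close> makes the approximation
    vanish outside \<open>letters F\<close>.\<close>
  define c where "c u = (if \<exists>z\<in>V. z \<in> cyl u then f (SOME z. z \<in> V \<and> z \<in> cyl u) else 0)" for u
  show ?thesis
  proof (rule that[OF W(1), of c])
    show "u \<noteq> []" if "u \<in> W" for u using W(2)[OF that] l(1) by auto
    fix x assume x: "x \<in> X"
    \<comment> \<open>The words of \<open>W\<close> all have length \<open>l\<close>, so at most one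
      term of the sum is nonzero at \<open>x\<close>.\<close>
    have one: "one u x = (if u = pref x l then 1 else 0)" if "u \<in> W" for u
    proof -
      have "x \<in> cyl u \<longleftrightarrow> u = pref x l"
      proof
        assume "u = pref x l"
        then show "x \<in> cyl u" using x by (simp only: in_cylinder_pref) (simp add: agree_def)
      qed (use cylinder_eq_pref[of x A u] W(2)[OF that] in simp)
      then show ?thesis by (simp add: indicator_def)
    qed
    have S: "(\<Sum>u\<in>W. c u * one u x) = (if pref x l \<in> W then c (pref x l) else 0)"
      using W(1) by (simp add: one if_distrib cong: if_cong)
    show "\<bar>f x - (\<Sum>u\<in>W. c u * one u x)\<bar> \<le> r * indicator (letters F) x"
    proof (cases "x 0 \<in> F")
      case True
      then have xV: "x \<in> V" using x by (auto simp: V_def in_letter)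
      then obtain u where u: "u \<in> W" "x \<in> cyl u" using W(3) by blast
      have ux: "u = pref x l" using cylinder_eq_pref[OF u(2)] W(2)[OF u(1)] by simp
      define z where "z = (SOME z. z \<in> V \<and> z \<in> cyl u)"
      have z: "z \<in> V \<and> z \<in> cyl u" unfolding z_def by (rule someI[of _ x]) (use xV u in auto)
      have cz: "c u = f z" using xV u by (auto simp: c_def z_def)
      have "agree l x z" "z \<in> X" using z unfolding ux by (auto simp: in_cylinder_pref)
      then have "\<bar>f z - f x\<bar> \<le> r" using l(2) x True by blast
      then show ?thesis
        unfolding S using u(1) cz ux xV by (simp add: V_def[symmetric] abs_minus_commute)
    next
      case False
      have "c (pref x l) = 0"
      proof -
        have "False" if z: "z \<in> V" "z \<in> cyl (pref x l)" for z
        proof -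
          have "z 0 = x 0" using z(2) l(1) by (auto simp: in_cylinder_pref agree_def)
          then show False using z(1) False by (auto simp: V_def in_letter)
        qed
        then show ?thesis by (auto simp: c_def)
      qed
      then show ?thesis unfolding S using F False x r by (auto simp: supported_def)
    qed
  qed
qed

lemma nice_Cc:
  assumes f: "f \<in> Cc A"
  shows "nice f"
proof -
  obtain F where F: "supported F f" using Cc_supported[OF f] .
  show ?thesis
  proof (rule Cc_approx[OF f F zero_less_one])
    fix W :: "'s list set" and c
    assume W: "finite W"
      "\<And>x. x \<in> X \<Longrightarrow> \<bar>f x - (\<Sum>u\<in>W. c u * one u x)\<bar> \<le> 1 * indicator (letters F) x"
    have "\<bar>f x\<bar> \<le> 1 + (\<Sum>u\<in>W. \<bar>c u\<bar>)" if x: "x \<in> X" for x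
    proof -
      have "\<bar>\<Sum>u\<in>W. c u * one u x\<bar> \<le> (\<Sum>u\<in>W. \<bar>c u * one u x\<bar>)" by (rule sum_abs)
      also have "\<dots> \<le> (\<Sum>u\<in>W. \<bar>c u\<bar>)" by (intro sum_mono) (auto simp: indicator_def)
      finally have "\<bar>\<Sum>u\<in>W. c u * one u x\<bar> \<le> (\<Sum>u\<in>W. \<bar>c u\<bar>)" .
      moreover have "1 * indicator (letters F) x \<le> (1::real)" by (simp add: indicator_def)
      ultimately show ?thesis using W(2)[OF x] by linarith
    qed
    then show "nice f" using F unfolding nice_def by blast
  qed
qed

lemma K_approx:
  assumes "nice f" "nice g" "nice h" "\<And>x. x \<in> X \<Longrightarrow> \<bar>f x - g x\<bar> \<le> r * h x" "x \<in> X"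
  shows "\<bar>K f x - K g x\<bar> \<le> r * K h x"
proof -
  have "K f x \<le> K (\<lambda>x. r * h x + g x) x"
    using assms(4) by (intro K_mono nice_lincomb assms) (metis abs_le_D1 diff_le_eq)
  moreover have "K g x \<le> K (\<lambda>x. r * h x + f x) x"
    using assms(4) by (intro K_mono nice_lincomb assms) (metis abs_le_D1 abs_minus_commute diff_le_eq)
  ultimately show ?thesis using K_lincomb[OF assms(3)] assms by (simp add: abs_le_iff)
qed

text \<open>Green's functions at \<open>x\<close> and \<open>y n\<close> differ by a factor between
  \<open>exp (- tail n)\<close> and \<open>exp (tail n)\<close>, and \<open>tail n\<close> tends to
  0.\<close>

lemma K_one_continuous:
  assumes u: "u \<noteq> []" and x: "x \<in> X" and y: "\<And>n. y n \<in> X" "\<And>n. agree (Suc n) x (y n)"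
  shows "(\<lambda>n. K (one u) (y n)) \<longlonglongrightarrow> K (one u) x"
proof -
  have "(\<lambda>n. G (one v) (y n)) \<longlonglongrightarrow> G (one v) x" if v: "v \<noteq> []" for v
  proof (rule tendsto_sandwich)
    have le: "G (one v) (y n) \<le> exp (tail n) * G (one v) x"
      "exp (- tail n) * G (one v) x \<le> G (one v) (y n)" if "n \<ge> length v" for n
    proof -
      show "G (one v) (y n) \<le> exp (tail n) * G (one v) x"
        using that by (intro green_one_distorts v x y agree_sym[OF y(2)]) auto
      have "G (one v) x \<le> exp (tail n) * G (one v) (y n)"
        using that by (intro green_one_distorts v x y) auto
      then show "exp (- tail n) * G (one v) x \<le> G (one v) (y n)"
        by (simp add: exp_minus field_simps)
    qed
    show "\<forall>\<^sub>F n in sequentially. exp (- tail n) * G (one v) x \<le> G (one v) (y n)"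
      "\<forall>\<^sub>F n in sequentially. G (one v) (y n) \<le> exp (tail n) * G (one v) x"
      using le by (auto intro: eventually_sequentiallyI[of "length v"])
    have "(\<lambda>n. exp (- tail n) * G (one v) x) \<longlonglongrightarrow> exp (- 0) * G (one v) x"
      by (intro tendsto_intros tail_tendsto)
    then show "(\<lambda>n. exp (- tail n) * G (one v) x) \<longlonglongrightarrow> G (one v) x" by simp
    have "(\<lambda>n. exp (tail n) * G (one v) x) \<longlonglongrightarrow> exp 0 * G (one v) x"
      by (intro tendsto_intros tail_tendsto)
    then show "(\<lambda>n. exp (tail n) * G (one v) x) \<longlonglongrightarrow> G (one v) x" by simp
  qed
  then show ?thesis
    unfolding martin_kernel_def using u green_orig_pos[OF x] by (intro tendsto_divide) auto
qed

end

section \<open>The Martin compactification\<close>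

locale martin_compactification = transient_tms A \<phi> lam orig
  for A :: "'s \<Rightarrow> 's \<Rightarrow> bool" and \<phi> lam orig +
  fixes w :: "nat \<Rightarrow> 's list" and C :: "nat \<Rightarrow> real" and Xh :: "'c metric" and e :: "(nat \<Rightarrow> 's) \<Rightarrow> 'c"
  assumes words: "w ` {1..} = admissible_words A"
    and C_pos: "\<And>i. i \<ge> 1 \<Longrightarrow> C i > 0"
    and K_le_C: "\<And>i x. i \<ge> 1 \<Longrightarrow> x \<in> tms A \<Longrightarrow> K (one (w i)) x \<le> C i"
    and completion: "is_completion (tms A) (martin_dist A \<phi> lam orig w C) Xh e"
begin

abbreviation "\<rho> \<equiv> martin_dist A \<phi> lam orig w C"
abbreviation "Tp \<equiv> mtopology_of Xh"
abbreviation "Bd \<equiv> martin_boundary A Xh e"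
abbreviation "Bd\<^sub>m \<equiv> minimal_boundary A \<phi> lam orig Xh e"
abbreviation "Kx \<equiv> martin_kernel_ext A \<phi> lam orig Xh e"

definition rho_term :: "nat \<Rightarrow> (nat \<Rightarrow> 's) \<Rightarrow> (nat \<Rightarrow> 's) \<Rightarrow> real" where
  "rho_term j x y = (\<bar>K (one (w (Suc j))) x - K (one (w (Suc j))) y\<bar> + \<bar>one (w (Suc j)) x - one (w (Suc j)) y\<bar>)
        / (2 ^ Suc j * (C (Suc j) + 1))"

lemma rho_eq: "\<rho> x y = (\<Sum>j. rho_term j x y)"
  by (simp add: martin_dist_def rho_term_def Let_def)

lemma word_nonempty: "i \<ge> 1 \<Longrightarrow> w i \<noteq> []"
  using words by (auto simp: admissible_words_def)

lemma rho_term_bound: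
  assumes "x \<in> X" "y \<in> X"
  shows "0 \<le> rho_term j x y" "rho_term j x y \<le> (1/2) ^ Suc j"
proof -
  have C: "C (Suc j) > 0" by (rule C_pos) simp
  show "0 \<le> rho_term j x y" using C by (simp add: rho_term_def)
  have "\<bar>K (one (w (Suc j))) x - K (one (w (Suc j))) y\<bar> \<le> C (Suc j)"
    using K_one_nonneg[OF word_nonempty, of "Suc j"] K_le_C[of "Suc j"] assms
    by (auto simp: abs_le_iff intro: order_trans[OF diff_right_mono] ) (smt (verit))+
  moreover have "\<bar>one (w (Suc j)) x - one (w (Suc j)) y\<bar> \<le> 1" by (simp add: indicator_def)
  ultimately have "rho_term j x y \<le> (C (Suc j) + 1) / (2 ^ Suc j * (C (Suc j) + 1))"
    unfolding rho_term_def using C by (intro divide_right_mono) auto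
  also have "\<dots> = (1/2) ^ Suc j" using C by (simp add: power_divide)
  finally show "rho_term j x y \<le> (1/2) ^ Suc j" .
qed

lemma summable_half: "summable (\<lambda>j. (1/2 :: real) ^ Suc j)"
  by (intro summable_Suc_iff[THEN iffD2] summable_geometric) simp

lemma summable_rho_term: "x \<in> X \<Longrightarrow> y \<in> X \<Longrightarrow> summable (\<lambda>j. rho_term j x y)"
  using rho_term_bound by (intro summable_comparison_test'[OF summable_half, of 0]) auto

lemma rho_term_le: "x \<in> X \<Longrightarrow> y \<in> X \<Longrightarrow> rho_term j x y \<le> \<rho> x y"
  unfolding rho_eq using sum_le_suminf[OF summable_rho_term, of x y "{j}"] rho_term_bound by simp

text \<open>The terms are dominated by a fixed geometric series, so limits may be taken term by
  term. Both arguments vary because a boundary point is reached only through a sequence in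
  \<open>X\<close>.\<close>

lemma rho_tendsto_0:
  assumes "\<And>n. y n \<in> X" "\<And>n. z n \<in> X"
    and K0: "\<And>i. i \<ge> 1 \<Longrightarrow> (\<lambda>n. K (one (w i)) (y n) - K (one (w i)) (z n)) \<longlonglongrightarrow> 0"
    and I0: "\<And>i. i \<ge> 1 \<Longrightarrow> (\<lambda>n. one (w i) (y n) - one (w i) (z n)) \<longlonglongrightarrow> 0"
  shows "(\<lambda>n. \<rho> (y n) (z n)) \<longlonglongrightarrow> 0"
proof -
  have lim: "(\<lambda>n. rho_term j (y n) (z n)) \<longlonglongrightarrow> 0" for j
  proof -
    have "(\<lambda>n. rho_term j (y n) (z n)) \<longlonglongrightarrow> (\<bar>0\<bar> + \<bar>0\<bar>) / (2 ^ Suc j * (C (Suc j) + 1))"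
      unfolding rho_term_def using C_pos[of "Suc j"]
      by (intro tendsto_divide tendsto_add tendsto_rabs K0 I0 tendsto_const) auto
    then show ?thesis by simp
  qed
  have "((\<lambda>n. \<Sum>j. rho_term j (y n) (z n)) \<longlongrightarrow> (\<Sum>j. 0)) sequentially"
  proof (rule tannerys_theorem[THEN conjunct2, THEN conjunct2])
    show "\<forall>\<^sub>F (k, n) in sequentially \<times>\<^sub>F sequentially. norm (rho_term k (y n) (z n)) \<le> (1/2) ^ Suc k"
      using rho_term_bound[OF assms(1,2)] by (intro always_eventually) (auto simp del: power_Suc)
  qed (use lim summable_half in auto)
  then show ?thesis by (simp add: rho_eq)
qed

lemma e_in: "x \<in> X \<Longrightarrow> e x \<in> mspace Xh"
  using completion by (auto simp: is_completion_def)

lemma mdist_e: "x \<in> X \<Longrightarrow> y \<in> X \<Longrightarrow> mdist Xh (e x) (e y) = \<rho> x y"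
  using completion by (auto simp: is_completion_def)

lemma word_index: "u \<in> admissible_words A \<Longrightarrow> \<exists>i\<ge>1. w i = u"
  using words by (metis (no_types, lifting) atLeast_iff imageE)

text \<open>Words that are not admissible are missing from the enumeration \<open>w\<close>; this
  covers them in the estimates stated for all nonempty words.\<close>

lemma K_one_zero: "u \<noteq> [] \<Longrightarrow> u \<notin> admissible_words A \<Longrightarrow> K (one u) x = 0"
proof -
  assume "u \<noteq> []" "u \<notin> admissible_words A"
  then have "cyl u = {}" by (simp add: admissible_words_def)
  then have "one u = (\<lambda>_. 0)" by (simp add: fun_eq_iff)
  then show ?thesis by (simp add: K_zero)
qed

lemma rho_nonneg: "x \<in> X \<Longrightarrow> y \<in> X \<Longrightarrow> 0 \<le> \<rho> x y"
  using rho_term_le[of x y 0] rho_term_bound[of x y 0] by linarith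

text \<open>The Lipschitz constant is the reciprocal of the weight that the word has in the series
  for \<open>\<rho>\<close>.\<close>

lemma rho_one_le:
  assumes "u \<in> admissible_words A"
  obtains c where "c > 0" "\<And>x y. x \<in> X \<Longrightarrow> y \<in> X \<Longrightarrow>
    \<bar>K (one u) x - K (one u) y\<bar> \<le> c * \<rho> x y \<and> \<bar>one u x - one u y\<bar> \<le> c * \<rho> x y"
proof -
  obtain i where i: "i \<ge> 1" "w i = u" using word_index[OF assms] by blast
  define c where "c = 2 ^ i * (C i + 1)"
  have c: "c > 0" using C_pos[OF i(1)] by (simp add: c_def)
  have i': "Suc (i - 1) = i" using i by simp
  have "\<bar>K (one u) x - K (one u) y\<bar> + \<bar>one u x - one u y\<bar> \<le> c * \<rho> x y" if "x \<in> X" "y \<in> X" for x y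
  proof -
    have "(\<bar>K (one u) x - K (one u) y\<bar> + \<bar>one u x - one u y\<bar>) / c \<le> \<rho> x y"
      using rho_term_le[OF that, of "i - 1"] unfolding rho_term_def i' i(2) c_def .
    then show ?thesis using c by (simp add: field_simps)
  qed
  then show ?thesis using that[OF c] by (smt (verit, best))
qed

lemma K_one_lipschitz:
  assumes "u \<noteq> []"
  shows "\<exists>c\<ge>0. \<forall>x\<in>X. \<forall>y\<in>X. \<bar>K (one u) x - K (one u) y\<bar> \<le> c * \<rho> x y"
proof (cases "u \<in> admissible_words A")
  case True
  then show ?thesis using rho_one_le[OF True] by (metis less_imp_le)
next
  case False
  then show ?thesis using K_one_zero[OF assms False] by (intro exI[of _ 0]) auto
qed

lemma K_one_bounded:
  assumes "u \<noteq> []"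
  shows "\<exists>c\<ge>0. \<forall>x\<in>X. K (one u) x \<le> c"
proof (cases "u \<in> admissible_words A")
  case True
  then show ?thesis using word_index[OF True] K_le_C C_pos by (metis less_imp_le)
next
  case False
  then show ?thesis using K_one_zero[OF assms False] by (intro exI[of _ 0]) auto
qed

section \<open>Uniform continuity of the kernel for compactly supported functions\<close>

lemma letters_le_sum:
  assumes "finite F"
  shows "indicator (letters F) x \<le> (\<Sum>a\<in>F. one [a] x)"
proof (cases "\<exists>a\<in>F. x \<in> cyl [a]")
  case True
  then obtain a where a: "a \<in> F" "x \<in> cyl [a]" by blast
  have "one [a] x \<le> (\<Sum>a\<in>F. one [a] x)" using assms a(1) by (intro member_le_sum) auto
  moreover have "one [a] x = 1" using a by simp
  moreover have "indicator (letters F) x \<le> (1::real)" by (rule indicator_le_1)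
  ultimately show ?thesis by linarith
next
  case False
  then have "indicator (letters F) x = (0::real)" by simp
  moreover have "(0::real) \<le> (\<Sum>a\<in>F. one [a] x)" by (intro sum_nonneg) auto
  ultimately show ?thesis by linarith
qed

lemma K_letters_bounded:
  assumes F: "finite F"
  shows "\<exists>c>0. \<forall>x\<in>X. K (indicator (letters F)) x \<le> c"
proof -
  obtain d where d: "\<And>a. d a \<ge> 0" "\<And>a x. x \<in> X \<Longrightarrow> K (one [a]) x \<le> d a"
    using K_one_bounded[of "[_]"] by (metis list.distinct(1))
  \<comment> \<open>The summand 1 keeps the bound positive even if the sum is 0, so that it can be
    divided by later.\<close>
  have "K (indicator (letters F)) x \<le> 1 + (\<Sum>a\<in>F. d a)" if x: "x \<in> X" for x
  proof -
    define W where "W = (\<lambda>a. [a]) ` F"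
    have W: "finite W" "\<And>u. u \<in> W \<Longrightarrow> u \<noteq> []" using F by (auto simp: W_def)
    have eq: "(\<Sum>u\<in>W. 1 * g u) = (\<Sum>a\<in>F. g [a])" for g :: "'s list \<Rightarrow> real"
      unfolding W_def by (subst sum.reindex) (auto simp: inj_on_def)
    have "nice (indicator (letters F))"
      using indicator_letters[OF F] by (intro nice_indicator) blast
    moreover have "nice (\<lambda>x. \<Sum>u\<in>W. 1 * one u x)" by (rule nice_sum[OF W])
    ultimately have "K (indicator (letters F)) x \<le> K (\<lambda>x. \<Sum>u\<in>W. 1 * one u x) x"
      by (rule K_mono[OF _ _ _ x]) (simp only: eq letters_le_sum[OF F])
    also have "\<dots> = (\<Sum>a\<in>F. K (one [a]) x)"
      using K_sum[OF W x, of "\<lambda>_. 1"] by (simp only: eq)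
    also have "\<dots> \<le> (\<Sum>a\<in>F. d a)" using d(2)[OF x] by (intro sum_mono)
    finally show ?thesis by simp
  qed
  moreover have "1 + (\<Sum>a\<in>F. d a) > 0" using d(1) by (simp add: add_pos_nonneg sum_nonneg)
  ultimately show ?thesis by blast
qed

lemma K_uniformly_continuous:
  assumes f: "f \<in> Cc A" and r: "r > 0"
  shows "\<exists>\<delta>>0. \<forall>x\<in>X. \<forall>y\<in>X. \<rho> x y < \<delta> \<longrightarrow> \<bar>K f x - K f y\<bar> < r"
proof -
  obtain F where F: "supported F f" using Cc_supported[OF f] .
  have fin: "finite F" using F by (simp add: supported_def)
  define V where "V = letters F"
  obtain d where d: "d > 0" "\<And>x. x \<in> X \<Longrightarrow> K (indicator V) x \<le> d"
    using K_letters_bounded[OF fin] unfolding V_def by blast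
  \<comment> \<open>Chosen so that replacing \<open>f\<close> by its step function costs at most
    \<open>r / 4\<close> at each of the two points; the Lipschitz bound for the step function adds
    less than \<open>r / 4\<close>.\<close>
  define \<epsilon> where "\<epsilon> = r / (4 * d)"
  have \<epsilon>: "\<epsilon> > 0" "\<epsilon> * d = r / 4" using r d by (auto simp: \<epsilon>_def)
  obtain W c where W: "finite W" "\<And>u. u \<in> W \<Longrightarrow> u \<noteq> []"
    "\<And>x. x \<in> X \<Longrightarrow> \<bar>f x - (\<Sum>u\<in>W. c u * one u x)\<bar> \<le> \<epsilon> * indicator V x"
    using Cc_approx[OF f F \<epsilon>(1)] unfolding V_def by blast
  define S where "S x = (\<Sum>u\<in>W. c u * K (one u) x)" for x
  have appr: "\<bar>K f x - S x\<bar> \<le> r / 4" if x: "x \<in> X" for x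
  proof -
    have "nice (indicator V)" unfolding V_def using indicator_letters[OF fin] by (intro nice_indicator) auto
    from K_approx[OF nice_Cc[OF f] nice_sum[OF W(1,2)] this W(3) x]
    have "\<bar>K f x - S x\<bar> \<le> \<epsilon> * K (indicator V) x" unfolding S_def using K_sum[OF W(1,2) x] by simp
    also have "\<dots> \<le> \<epsilon> * d" using d(2)[OF x] \<epsilon>(1) by (intro mult_left_mono) auto
    finally show ?thesis using \<epsilon>(2) by simp
  qed
  have "\<forall>u. \<exists>k. u \<noteq> [] \<longrightarrow> k \<ge> 0 \<and> (\<forall>x\<in>X. \<forall>y\<in>X. \<bar>K (one u) x - K (one u) y\<bar> \<le> k * \<rho> x y)"
    using K_one_lipschitz by blast
  then obtain k where k: "\<And>u. u \<noteq> [] \<Longrightarrow> k u \<ge> 0"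
    "\<And>u x y. u \<noteq> [] \<Longrightarrow> x \<in> X \<Longrightarrow> y \<in> X \<Longrightarrow> \<bar>K (one u) x - K (one u) y\<bar> \<le> k u * \<rho> x y"
    by metis
  define D where "D = 1 + (\<Sum>u\<in>W. \<bar>c u\<bar> * k u)"
  have D: "D > 0" unfolding D_def using k(1) W(2) by (intro add_pos_nonneg sum_nonneg) auto
  have lip: "\<bar>S x - S y\<bar> \<le> D * \<rho> x y" if "x \<in> X" "y \<in> X" for x y
  proof -
    have "\<bar>S x - S y\<bar> = \<bar>\<Sum>u\<in>W. c u * (K (one u) x - K (one u) y)\<bar>"
      by (simp add: S_def sum_subtractf right_diff_distrib)
    also have "\<dots> \<le> (\<Sum>u\<in>W. \<bar>c u\<bar> * \<bar>K (one u) x - K (one u) y\<bar>)"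
      using sum_abs[of "\<lambda>u. c u * (K (one u) x - K (one u) y)" W] by (simp add: abs_mult)
    also have "\<dots> \<le> (\<Sum>u\<in>W. \<bar>c u\<bar> * (k u * \<rho> x y))"
      using k(2) W(2) that by (intro sum_mono mult_left_mono) auto
    also have "\<dots> = (\<Sum>u\<in>W. \<bar>c u\<bar> * k u) * \<rho> x y" by (simp add: sum_distrib_right mult.assoc)
    also have "\<dots> \<le> D * \<rho> x y" using rho_nonneg[OF that] by (simp add: D_def algebra_simps)
    finally show ?thesis .
  qed
  have "\<bar>K f x - K f y\<bar> < r" if "x \<in> X" "y \<in> X" "\<rho> x y < r / (4 * D)" for x y
  proof -
    have "D * \<rho> x y < r / 4" using that(3) D by (simp add: field_simps)
    then show ?thesis using lip[OF that(1,2)] appr[OF that(1)] appr[OF that(2)] r by linarith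
  qed
  moreover have "r / (4 * D) > 0" using r D by simp
  ultimately show ?thesis by blast
qed

text \<open>Argued by contradiction, because a sequence of counterexamples with longer and longer
  common prefixes is the form in which \<open>K_one_continuous\<close> and
  \<open>rho_tendsto_0\<close> apply.\<close>

lemma e_continuous_at:
  assumes x: "x \<in> X" and r: "r > 0"
  obtains n where "\<And>y. y \<in> X \<Longrightarrow> agree n x y \<Longrightarrow> \<rho> x y < r"
proof (rule ccontr)
  assume *: "\<not> thesis"
  then have "\<forall>n. \<exists>y. y \<in> X \<and> agree (Suc n) x y \<and> \<not> \<rho> x y < r" using that by blast
  then obtain y where y: "\<And>n. y n \<in> X" "\<And>n. agree (Suc n) x (y n)" "\<And>n. \<not> \<rho> x (y n) < r" by metis
  have "(\<lambda>n. \<rho> x (y n)) \<longlonglongrightarrow> 0"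
  proof (rule rho_tendsto_0)
    fix i :: nat assume i: "i \<ge> 1"
    have "(\<lambda>n. K (one (w i)) x - K (one (w i)) (y n)) \<longlonglongrightarrow> K (one (w i)) x - K (one (w i)) x"
      by (intro tendsto_diff tendsto_const K_one_continuous word_nonempty i x y)
    then show "(\<lambda>n. K (one (w i)) x - K (one (w i)) (y n)) \<longlonglongrightarrow> 0" by simp
    have "one (w i) x - one (w i) (y n) = 0" if "n \<ge> length (w i)" for n
      using cylinder_agree_iff[OF x y(1) y(2), of "w i" n] that by (simp add: indicator_def)
    then show "(\<lambda>n. one (w i) x - one (w i) (y n)) \<longlonglongrightarrow> 0"
      by (intro tendsto_eventually eventually_sequentiallyI[of "length (w i)"])
  qed (use x y in auto)
  then have "\<forall>\<^sub>F n in sequentially. \<rho> x (y n) < r" using r by (rule order_tendstoD)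
  then show False using y(3) by (auto simp: eventually_sequentially)
qed

interpretation H: Metric_space "mspace Xh" "mdist Xh"
  by (rule Metric_space_mspace_mdist)

lemma Tp_eq: "Tp = H.mtopology"
  by (simp add: mtopology_of_def)

lemma e_continuous: "continuous_map (tms_top A) Tp e"
  unfolding continuous_map_def
proof (intro conjI allI impI)
  fix U assume U: "openin Tp U"
  show "openin (tms_top A) {x \<in> topspace (tms_top A). e x \<in> U}"
    unfolding openin_tms_top_iff topspace_tms_top
  proof (intro conjI ballI)
    fix x assume "x \<in> {x \<in> X. e x \<in> U}"
    then have x: "x \<in> X" "e x \<in> U" by auto
    obtain r where r: "r > 0" "H.mball (e x) r \<subseteq> U"
      using U x(2) unfolding Tp_eq H.openin_mtopology by blast
    obtain n where n: "\<And>y. y \<in> X \<Longrightarrow> agree n x y \<Longrightarrow> \<rho> x y < r" using e_continuous_at[OF x(1) r(1)] by blast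
    have "e y \<in> U" if "y \<in> X" "agree n x y" for y
      using n[OF that] r(2) that x by (auto simp: mdist_e e_in subset_iff)
    then show "\<exists>n. \<forall>y\<in>X. agree n x y \<longrightarrow> y \<in> {x \<in> X. e x \<in> U}" by (intro exI[of _ n]) auto
  qed auto
qed (auto simp: e_in)

lemma approximating_sequence:
  assumes "\<omega> \<in> mspace Xh"
  obtains y where "\<And>n. y n \<in> X" "limitin Tp (\<lambda>n. e (y n)) \<omega> sequentially"
proof -
  have "\<omega> \<in> H.mtopology closure_of (e ` X)"
    using completion assms by (simp add: is_completion_def Tp_eq)
  then obtain \<sigma> where \<sigma>: "range \<sigma> \<subseteq> e ` X" "limitin H.mtopology \<sigma> \<omega> sequentially"
    unfolding H.closure_of_sequentially by blast
  have "\<forall>n. \<exists>x. x \<in> X \<and> \<sigma> n = e x" using \<sigma>(1) by blast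
  then obtain y where y: "\<And>n. y n \<in> X" "\<And>n. \<sigma> n = e (y n)" by metis
  have "\<sigma> = (\<lambda>n. e (y n))" using y(2) by auto
  then show ?thesis using \<sigma>(2) that[OF y(1)] by (simp add: Tp_eq)
qed

text \<open>Infinitely many visits to the compact set \<open>cyl [a]\<close> would give a
  subsequence converging to some \<open>l\<close> in \<open>X\<close>. By continuity of
  \<open>e\<close> the limit would be \<open>e l\<close>, which is not a boundary point.\<close>

lemma boundary_escape:
  assumes y: "\<And>n. y n \<in> X" and lim: "limitin Tp (\<lambda>n. e (y n)) \<omega> sequentially" and \<omega>: "\<omega> \<in> Bd"
  shows "\<forall>\<^sub>F n in sequentially. y n \<notin> cyl [a]"
proof (rule ccontr)
  interpret S: Metric_space X seq_dist by (rule Metric_space_seq_dist)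
  assume "\<not> (\<forall>\<^sub>F n in sequentially. y n \<notin> cyl [a])"
  then have inf: "infinite {n. y n \<in> cyl [a]}"
    by (simp add: not_eventually frequently_cofinite cofinite_eq_sequentially[symmetric])
  define r where "r = enumerate {n. y n \<in> cyl [a]}"
  have r: "strict_mono r" "\<And>n. y (r n) \<in> cyl [a]"
    using inf enumerate_in_set[OF inf] by (auto simp: r_def strict_mono_enumerate)
  have "compactin S.mtopology (cyl [a])"
    using compactin_letter[OF locally_compact] by (simp add: tms_top_def)
  then obtain l s where l: "l \<in> cyl [a]" "strict_mono s" "limitin S.mtopology ((y \<circ> r) \<circ> s) l sequentially"
    unfolding S.compactin_sequentially using r(2) by (metis (no_types, lifting) comp_apply image_subset_iff)
  then have "limitin Tp (e \<circ> ((y \<circ> r) \<circ> s)) (e l) sequentially"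
    using continuous_map_limit[OF e_continuous] by (simp add: tms_top_def)
  moreover have "limitin Tp ((\<lambda>n. e (y n)) \<circ> (r \<circ> s)) \<omega> sequentially"
    using limitin_subsequence[OF strict_mono_o[OF r(1) l(2)] lim] .
  moreover have "e \<circ> ((y \<circ> r) \<circ> s) = (\<lambda>n. e (y n)) \<circ> (r \<circ> s)" by auto
  ultimately have "e l = \<omega>"
    using limitin_Hausdorff_unique[of Tp] H.Hausdorff_space_mtopology by (metis Tp_eq sequentially_bot)
  then show False using \<omega> l(1) cylinder_subset by (auto simp: martin_boundary_def)
qed

section \<open>The extended kernel\<close>

lemma kernel_extension_exists:
  assumes f: "f \<in> Cc A"
  shows "\<exists>g. g \<in> extensional (mspace Xh) \<and> continuous_map Tp euclideanreal g \<and> (\<forall>x\<in>X. g (e x) = K f x)"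
proof -
  \<comment> \<open>Makes \<open>h\<close> independent of the choice in \<open>inv_into\<close>:
    equal images have \<open>\<rho>\<close>-distance 0, and by uniform continuity the kernel does
    not separate such points.\<close>
  have eq: "K f x = K f y" if "x \<in> X" "y \<in> X" "e x = e y" for x y
  proof (rule ccontr)
    assume "K f x \<noteq> K f y"
    then have "\<bar>K f x - K f y\<bar> > 0" by simp
    then obtain \<delta> where \<delta>: "\<delta> > 0"
      "\<forall>x'\<in>X. \<forall>y'\<in>X. \<rho> x' y' < \<delta> \<longrightarrow> \<bar>K f x' - K f y'\<bar> < \<bar>K f x - K f y\<bar>"
      using K_uniformly_continuous[OF f] by blast
    then have "\<rho> x y < \<delta> \<longrightarrow> \<bar>K f x - K f y\<bar> < \<bar>K f x - K f y\<bar>" using that by blast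
    moreover have "\<rho> x y = 0" using mdist_e[OF that(1,2)] that e_in[of y] by simp
    ultimately show False using \<delta>(1) by simp
  qed
  define h where "h z = K f (inv_into X e z)" for z
  have h: "h (e x) = K f x" if "x \<in> X" for x
    unfolding h_def using that
    by (intro eq[OF inv_into_into[OF imageI[OF that]] that f_inv_into_f[OF imageI[OF that]]])
  have uc: "uniformly_continuous_map (submetric Xh (e ` X)) euclidean_metric h"
    unfolding uniformly_continuous_map_def
  proof (intro conjI allI impI)
    fix r :: real assume "r > 0"
    then obtain \<delta> where \<delta>: "\<delta> > 0" "\<And>x y. x \<in> X \<Longrightarrow> y \<in> X \<Longrightarrow> \<rho> x y < \<delta> \<Longrightarrow> \<bar>K f x - K f y\<bar> < r"
      using K_uniformly_continuous[OF f] by meson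
    show "\<exists>\<delta>>0. \<forall>x\<in>mspace (submetric Xh (e ` X)). \<forall>y\<in>mspace (submetric Xh (e ` X)).
        mdist (submetric Xh (e ` X)) y x < \<delta> \<longrightarrow> mdist euclidean_metric (h y) (h x) < r"
      using \<delta> by (intro exI[of _ \<delta>]) (auto simp: h mdist_e dist_real_def)
  qed auto
  have "mcomplete_of (euclidean_metric :: real metric)"
    by (simp add: mcomplete_of_def complete_UNIV)
  then obtain g where g: "uniformly_continuous_map (submetric Xh (Tp closure_of (e ` X))) euclidean_metric g"
    "\<And>z. z \<in> e ` X \<Longrightarrow> g z = h z"
    using uniformly_continuous_map_extends_to_closure_of[OF _ uc] by blast
  have "uniformly_continuous_map Xh euclidean_metric g"
    using g(1) completion by (simp add: is_completion_def)
  then have cont: "continuous_map Tp euclideanreal g"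
    using uniformly_continuous_imp_continuous_map by fastforce
  have "continuous_map Tp euclideanreal (restrict g (mspace Xh))"
    using cont by (rule continuous_map_eq) auto
  moreover have "restrict g (mspace Xh) (e x) = K f x" if "x \<in> X" for x
    using that g(2) h e_in by simp
  ultimately show ?thesis by (intro exI[of _ "restrict g (mspace Xh)"]) auto
qed

lemma kernel_extension:
  assumes f: "f \<in> Cc A"
  shows "continuous_map Tp euclideanreal (Kx f)" "\<And>x. x \<in> X \<Longrightarrow> Kx f (e x) = K f x"
proof -
  let ?P = "\<lambda>g. g \<in> extensional (mspace Xh) \<and> continuous_map Tp euclideanreal g \<and> (\<forall>x\<in>X. g (e x) = K f x)"
  obtain g where g: "?P g" using kernel_extension_exists[OF f] by blast
  have "h = g" if h: "?P h" for h
  proof (rule extensionalityI[of _ "mspace Xh"])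
    fix z assume "z \<in> mspace Xh"
    then have "z \<in> Tp closure_of (e ` X)" using completion by (simp add: is_completion_def)
    then show "h z = g z"
      by (rule forall_in_closure_of_eq[where Y=euclideanreal]) (use g h in auto)
  qed (use g h in auto)
  then have "?P (Kx f)" unfolding martin_kernel_ext_def using g by (intro theI[of ?P g])
  then show "continuous_map Tp euclideanreal (Kx f)" "\<And>x. x \<in> X \<Longrightarrow> Kx f (e x) = K f x" by auto
qed

lemma kernel_extension_limit:
  assumes "f \<in> Cc A" "limitin Tp (\<lambda>n. e (y n)) \<omega> sequentially" "\<And>n. y n \<in> X"
  shows "(\<lambda>n. K f (y n)) \<longlonglongrightarrow> Kx f \<omega>"
proof -
  have "limitin euclideanreal (Kx f \<circ> (\<lambda>n. e (y n))) (Kx f \<omega>) sequentially"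
    by (rule continuous_map_limit[OF kernel_extension(1)[OF assms(1)] assms(2)])
  then show ?thesis using kernel_extension(2)[OF assms(1) assms(3)] by (simp add: o_def)
qed

abbreviation "mm \<equiv> martin_measure A \<phi> lam orig Xh e"

section \<open>The measures of boundary points\<close>

lemma indicator_in_Cc: "openin (tms_top A) U \<Longrightarrow> compactin (tms_top A) U \<Longrightarrow> indicator U \<in> Cc A"
  using indicator_in_Cc_nonneg by (simp add: Cc_nonneg_def)

lemma one_in_Cc: "u \<noteq> [] \<Longrightarrow> one u \<in> Cc A"
  by (intro indicator_in_Cc openin_cylinder compactin_cylinder locally_compact)

text \<open>The indicators of these sets lie in \<open>Cc A\<close>, so the extended kernel assigns
  each of them a value directly. They form a ring that generates the Borel sets, which makes the
  measure of a boundary point accessible to Caratheodory's extension.\<close>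

definition compact_open :: "(nat \<Rightarrow> 's) set set" where
  "compact_open = {U. openin (tms_top A) U \<and> compactin (tms_top A) U}"

lemma compact_open_subset: "compact_open \<subseteq> Pow X"
  using compactin_tms_top_subset by (auto simp: compact_open_def)

lemma ring_compact_open: "ring_of_sets X compact_open"
proof -
  have "a - b \<in> compact_open" if "a \<in> compact_open" "b \<in> compact_open" for a b
  proof -
    have "closedin (tms_top A) a" "closedin (tms_top A) b"
      using that compactin_imp_closedin[OF Hausdorff_tms_top] by (auto simp: compact_open_def)
    then show ?thesis
      using that openin_diff closedin_diff closed_compactin[of "tms_top A" a "a - b"]
      by (auto simp: compact_open_def)
  qed
  then show ?thesis
    unfolding ring_of_sets_iff using compact_open_subset
    by (auto simp: compact_open_def intro: openin_Un compactin_Un)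
qed

lemma cylinder_compact_open: "u \<noteq> [] \<Longrightarrow> cyl u \<in> compact_open"
  by (simp add: compact_open_def openin_cylinder compactin_cylinder locally_compact)

lemma sigma_compact_open: "sigma_sets X compact_open = sets B"
  unfolding sets_B
proof (rule sigma_sets_eqI)
  fix U assume "U \<in> compact_open"
  then have "U \<in> sets B" by (intro openin_in_borel_on) (simp add: compact_open_def)
  then show "U \<in> sigma_sets X (cyls A)" by (simp add: sets_B)
next
  fix U assume "U \<in> cyls A"
  then show "U \<in> sigma_sets X compact_open"
    using cylinder_compact_open by (auto simp: cyls_def sigma_sets.Empty intro: sigma_sets.Basic)
qed

text \<open>On the ring of compact open sets countable additivity is automatic, because a compact set
  that is a disjoint union of open sets is a union of finitely many of them.\<close>

lemma compact_open_premeasure: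
  assumes pos: "positive compact_open p" and add: "additive compact_open p"
  shows "countably_additive compact_open p"
proof (rule countably_additiveI)
  fix D :: "nat \<Rightarrow> (nat \<Rightarrow> 's) set"
  assume D: "range D \<subseteq> compact_open" "disjoint_family D" "(\<Union>i. D i) \<in> compact_open"
  have "\<exists>\<F>. finite \<F> \<and> \<F> \<subseteq> range D \<and> (\<Union>i. D i) \<subseteq> \<Union>\<F>"
    using D(1,3) unfolding compact_open_def compactin_def by (auto simp: image_subset_iff)
  then obtain \<F> where \<F>: "finite \<F>" "\<F> \<subseteq> range D" "(\<Union>i. D i) \<subseteq> \<Union>\<F>" by blast
  obtain I where I: "finite I" "\<F> = D ` I" using finite_subset_image[OF \<F>(1,2)] by blast
  have empty: "D i = {}" if "i \<notin> I" for i
  proof (rule ccontr)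
    assume "D i \<noteq> {}"
    then obtain x where x: "x \<in> D i" by blast
    then obtain j where "j \<in> I" "x \<in> D j" using \<F>(3) I(2) by blast
    moreover from this have "i \<noteq> j" using that by blast
    ultimately show False using x D(2) unfolding disjoint_family_on_def by blast
  qed
  have un: "(\<Union>i. D i) = (\<Union>i\<in>I. D i)" using \<F>(3) I(2) by auto
  have "(\<Sum>i. p (D i)) = (\<Sum>i\<in>I. p (D i))"
    using I(1) empty pos by (intro suminf_finite) (auto simp: positive_def)
  also have "\<dots> = p (\<Union>i\<in>I. D i)"
    using D I(1) by (intro ring_of_sets.additive_sum[OF ring_compact_open pos add])
      (auto simp: disjoint_family_on_def)
  finally show "(\<Sum>i. p (D i)) = p (\<Union>i. D i)" unfolding un .
qed

lemma kernel_limit_nonneg: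
  assumes "\<omega> \<in> mspace Xh" "f \<in> Cc A" "\<And>x. x \<in> X \<Longrightarrow> 0 \<le> f x"
  shows "0 \<le> Kx f \<omega>"
proof -
  obtain y where y: "\<And>n. y n \<in> X" "limitin Tp (\<lambda>n. e (y n)) \<omega> sequentially"
    using approximating_sequence[OF assms(1)] by blast
  show ?thesis
    using K_nonneg[OF nice_Cc[OF assms(2)] assms(3) y(1)]
    by (intro LIMSEQ_le_const[OF kernel_extension_limit[OF assms(2) y(2,1)]]) auto
qed

text \<open>Positivity and additivity of the kernel pass to \<open>\<omega>\<close> along a sequence
  in \<open>X\<close>. The extended measure is fixed by its values on compact open sets, and step
  functions carry the identity over to all of \<open>Cc A\<close>.\<close>

lemma martin_measure_exists:
  assumes \<omega>: "\<omega> \<in> mspace Xh"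
  shows "\<exists>m. radon_measure A m \<and> (\<forall>f\<in>Cc A. (\<integral>x. f x \<partial>m) = Kx f \<omega>)"
proof -
  obtain y where y: "\<And>n. y n \<in> X" "limitin Tp (\<lambda>n. e (y n)) \<omega> sequentially"
    using approximating_sequence[OF \<omega>] by blast
  note lim = kernel_extension_limit[OF _ y(2,1)]
  define p where "p U = ennreal (Kx (indicator U) \<omega>)" for U
  have R_Cc: "indicator U \<in> Cc A" if "U \<in> compact_open" for U
    using that by (intro indicator_in_Cc) (auto simp: compact_open_def)
  have nonneg: "0 \<le> Kx (indicator U) \<omega>" if "U \<in> compact_open" for U
    using kernel_limit_nonneg[OF \<omega> R_Cc[OF that]] by simp
  have empty: "{} \<in> compact_open" by (simp add: compact_open_def)
  have pos: "positive compact_open p"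
  proof -
    have "(indicator {} :: (nat \<Rightarrow> 's) \<Rightarrow> real) = (\<lambda>_. 0)" by (simp add: fun_eq_iff)
    then have "K (indicator {}) (y n) = 0" for n by (simp only: K_zero)
    then have "(\<lambda>n. K (indicator {}) (y n)) \<longlonglongrightarrow> 0" by (simp only: tendsto_const)
    then have "Kx (indicator {}) \<omega> = 0" using lim[OF R_Cc[OF empty]] LIMSEQ_unique by blast
    then show ?thesis by (simp add: positive_def p_def)
  qed
  have add: "additive compact_open p"
    unfolding additive_def
  proof (intro ballI impI)
    fix U V assume UV: "U \<in> compact_open" "V \<in> compact_open" "U \<inter> V = {}"
    have UnV: "U \<union> V \<in> compact_open" using UV ring_compact_open by (simp add: ring_of_sets_iff)
    have eq: "indicator (U \<union> V) = (\<lambda>x. 1 * indicator U x + indicator V x :: real)"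
      using UV(3) by (auto simp: fun_eq_iff indicator_def)
    have "K (indicator (U \<union> V)) (y n) = 1 * K (indicator U) (y n) + K (indicator V) (y n)" for n
      unfolding eq by (intro K_lincomb nice_Cc R_Cc UV y)
    then have "(\<lambda>n. K (indicator (U \<union> V)) (y n)) \<longlonglongrightarrow> Kx (indicator U) \<omega> + Kx (indicator V) \<omega>"
      using tendsto_add[OF lim[OF R_Cc[OF UV(1)]] lim[OF R_Cc[OF UV(2)]]] by simp
    then have "Kx (indicator (U \<union> V)) \<omega> = Kx (indicator U) \<omega> + Kx (indicator V) \<omega>"
      using lim[OF R_Cc[OF UnV]] LIMSEQ_unique by blast
    then show "p (U \<union> V) = p U + p V"
      using nonneg UV by (simp add: p_def ennreal_plus)
  qed
  obtain m0 where m0: "\<And>U. U \<in> compact_open \<Longrightarrow> m0 U = p U"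
    "measure_space X (sigma_sets X compact_open) m0"
    using ring_of_sets.caratheodory'[OF ring_compact_open pos compact_open_premeasure[OF pos add]] by blast
  define m where "m = measure_of X (sigma_sets X compact_open) m0"
  have sub: "sigma_sets X compact_open \<subseteq> Pow X" using sigma_sets_into_sp[OF compact_open_subset] by blast
  have sa: "sigma_algebra X (sigma_sets X compact_open)" using m0(2) by (simp add: measure_space_def)
  have sets_m: "sets m = sets B"
    unfolding m_def sigma_compact_open[symmetric] using sub sigma_algebra.sigma_sets_eq[OF sa] by (simp add: sets_measure_of)
  have [simp]: "space m = X" unfolding m_def using sub by (simp add: space_measure_of)
  have em: "emeasure m U = p U" if "U \<in> compact_open" for U
    using m0 that unfolding m_def measure_space_def
    by (subst emeasure_measure_of_sigma) (auto intro: sigma_sets.Basic)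
  have meas: "measure m U = Kx (indicator U) \<omega>" "emeasure m U < \<infinity>" "U \<in> sets m" if "U \<in> compact_open" for U
    using em[OF that] nonneg[OF that] that sigma_compact_open sigma_sets.Basic[OF that]
    by (auto simp: p_def measure_def sets_m)
  have radon: "radon_measure A m"
    unfolding radon_measure_def
  proof (intro conjI allI impI sets_m)
    fix U assume U: "compactin (tms_top A) U"
    obtain F where F: "finite F" "U \<subseteq> letters F" using compactin_finite_letters[OF U] .
    have V: "letters F \<in> compact_open" using indicator_letters[OF F(1)] by (simp add: compact_open_def)
    have "emeasure m U \<le> emeasure m (letters F)" using F(2) meas(3)[OF V] by (rule emeasure_mono)
    also have "\<dots> < \<infinity>" by (rule meas(2)[OF V])
    finally show "emeasure m U < \<infinity>" .
  qed
  have "(\<integral>x. f x \<partial>m) = Kx f \<omega>" if f: "f \<in> Cc A" for f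
  proof -
    obtain F where F: "supported F f" using Cc_supported[OF f] .
    have fin: "finite F" using F by (simp add: supported_def)
    define V where "V = letters F"
    have V: "V \<in> compact_open" using indicator_letters[OF fin] by (simp add: compact_open_def V_def)
    have [measurable]: "f \<in> borel_measurable m"
      using Cc_measurable[OF f] measurable_cong_sets[OF sets_m refl] by blast
    have intU: "integrable m (indicator U :: _ \<Rightarrow> real)" if "U \<in> compact_open" for U
      using meas[OF that] by (intro integrable_real_indicator) auto
    have int_ind: "(\<integral>x. indicator U x \<partial>m) = Kx (indicator U) \<omega>" if "U \<in> compact_open" for U
    proof -
      have "U \<inter> X = U" using that compact_open_subset by auto
      then show ?thesis using meas[OF that] by simp
    qed
    obtain c where c: "\<And>x. x \<in> X \<Longrightarrow> \<bar>f x\<bar> \<le> c" using nice_Cc[OF f] by (auto simp: nice_def)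
    have int_f: "integrable m f"
    proof (rule Bochner_Integration.integrable_bound)
      show "integrable m (\<lambda>x. c * indicator V x)" using intU[OF V] by simp
      show "AE x in m. norm (f x) \<le> norm (c * indicator V x)"
      proof (rule AE_I2)
        fix x assume "x \<in> space m"
        then have x: "x \<in> X" by simp
        show "norm (f x) \<le> norm (c * indicator V x)"
        proof (cases "x \<in> V")
          case True
          then show ?thesis using c[OF x] by simp
        next
          case False
          then have "x 0 \<notin> F" using x by (auto simp: V_def in_letter)
          then show ?thesis using F x by (simp add: supported_def)
        qed
      qed
    qed measurable
    \<comment> \<open>The same step function approximates both sides, the integral and the kernel,
      with an error of at most \<open>r * Kx (indicator V) \<omega>\<close> each; hence the factor
      2.\<close>
    have bound: "\<bar>(\<integral>x. f x \<partial>m) - Kx f \<omega>\<bar> \<le> r * (2 * Kx (indicator V) \<omega>)" if r: "r > 0" for r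
    proof (rule Cc_approx[OF f F r])
      fix W :: "'s list set" and d
      assume W: "finite W" "\<And>u. u \<in> W \<Longrightarrow> u \<noteq> []"
        and ap: "\<And>x. x \<in> X \<Longrightarrow> \<bar>f x - (\<Sum>u\<in>W. d u * one u x)\<bar> \<le> r * indicator (letters F) x"
      define S where "S x = (\<Sum>u\<in>W. d u * one u x)" for x
      have int_S: "integrable m S"
        unfolding S_def using W(2) by (intro Bochner_Integration.integrable_sum integrable_mult_right intU cylinder_compact_open)
      have S_eq: "(\<integral>x. S x \<partial>m) = (\<Sum>u\<in>W. d u * Kx (one u) \<omega>)"
      proof -
        have "(\<integral>x. S x \<partial>m) = (\<Sum>u\<in>W. \<integral>x. d u * one u x \<partial>m)"
          unfolding S_def using W(2) by (intro Bochner_Integration.integral_sum integrable_mult_right intU cylinder_compact_open)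
        also have "\<dots> = (\<Sum>u\<in>W. d u * Kx (one u) \<omega>)"
        proof (rule sum.cong[OF refl])
          fix u assume "u \<in> W"
          then show "(\<integral>x. d u * one u x \<partial>m) = d u * Kx (one u) \<omega>"
            using int_ind[OF cylinder_compact_open[OF W(2)]] by (simp only: integral_mult_right_zero)
        qed
        finally show ?thesis .
      qed
      have "\<bar>(\<integral>x. f x \<partial>m) - (\<integral>x. S x \<partial>m)\<bar> = \<bar>\<integral>x. f x - S x \<partial>m\<bar>"
        using int_f int_S by simp
      also have "\<dots> \<le> (\<integral>x. \<bar>f x - S x\<bar> \<partial>m)" by (rule integral_abs_bound)
      also have "\<dots> \<le> (\<integral>x. r * indicator V x \<partial>m)"
      proof (rule integral_mono)
        show "integrable m (\<lambda>x. \<bar>f x - S x\<bar>)"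
          by (intro integrable_abs Bochner_Integration.integrable_diff int_f int_S)
        show "integrable m (\<lambda>x. r * indicator V x)" by (intro integrable_mult_right intU V)
        show "\<bar>f x - S x\<bar> \<le> r * indicator V x" if "x \<in> space m" for x
          using ap[of x] that by (simp only: S_def V_def \<open>space m = X\<close>)
      qed
      also have "\<dots> = r * Kx (indicator V) \<omega>" by (simp only: integral_mult_right_zero int_ind[OF V])
      finally have 1: "\<bar>(\<integral>x. f x \<partial>m) - (\<integral>x. S x \<partial>m)\<bar> \<le> r * Kx (indicator V) \<omega>" .
      have "\<bar>K f (y n) - (\<Sum>u\<in>W. d u * K (one u) (y n))\<bar> \<le> r * K (indicator V) (y n)" for n
        using K_approx[OF nice_Cc[OF f] nice_sum[OF W] nice_Cc[OF R_Cc[OF V]] ap[folded V_def] y(1)]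
        by (simp only: K_sum[OF W y(1)])
      moreover have "(\<lambda>n. \<bar>K f (y n) - (\<Sum>u\<in>W. d u * K (one u) (y n))\<bar>) \<longlonglongrightarrow> \<bar>Kx f \<omega> - (\<Sum>u\<in>W. d u * Kx (one u) \<omega>)\<bar>"
        using W(2) by (intro tendsto_intros lim f one_in_Cc)
      moreover have "(\<lambda>n. r * K (indicator V) (y n)) \<longlonglongrightarrow> r * Kx (indicator V) \<omega>"
        by (intro tendsto_intros lim R_Cc V)
      ultimately have "\<bar>Kx f \<omega> - (\<Sum>u\<in>W. d u * Kx (one u) \<omega>)\<bar> \<le> r * Kx (indicator V) \<omega>"
        by (meson LIMSEQ_le)
      then show "\<bar>(\<integral>x. f x \<partial>m) - Kx f \<omega>\<bar> \<le> r * (2 * Kx (indicator V) \<omega>)"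
        using 1 unfolding S_eq by linarith
    qed
    have "\<bar>(\<integral>x. f x \<partial>m) - Kx f \<omega>\<bar> \<le> 0"
    proof (rule field_le_epsilon)
      fix \<epsilon> :: real assume \<epsilon>: "\<epsilon> > 0"
      define k where "k = 2 * Kx (indicator V) \<omega>"
      have k: "k \<ge> 0" using nonneg[OF V] by (simp add: k_def)
      \<comment> \<open>Since \<open>k\<close> may be 0, the bound is used with \<open>r\<close>
        equal to \<open>\<epsilon> / (k + 1)\<close>.\<close>
      have "\<epsilon> / (k + 1) * k \<le> \<epsilon>" using k \<epsilon> by (simp add: field_simps)
      then show "\<bar>(\<integral>x. f x \<partial>m) - Kx f \<omega>\<bar> \<le> 0 + \<epsilon>"
        using bound[of "\<epsilon> / (k + 1)"] k \<epsilon> unfolding k_def by simp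
    qed
    then show ?thesis by simp
  qed
  then show ?thesis using radon by blast
qed

lemma radon_cylinder:
  assumes "radon_measure A m" "u \<noteq> []"
  shows "emeasure m (cyl u) = ennreal (\<integral>x. one u x \<partial>m)"
proof -
  have sets: "sets m = sets B" using assms by (simp add: radon_measure_def)
  have sp: "space m = X" using sets_eq_imp_space_eq[OF sets] by simp
  have "emeasure m (cyl u) < \<infinity>"
    using assms compactin_cylinder[OF locally_compact assms(2)] by (simp add: radon_measure_def)
  moreover have "cyl u \<inter> X = cyl u" using cylinder_subset by auto
  ultimately show ?thesis by (simp add: sp emeasure_eq_ennreal_measure)
qed

lemma martin_measure:
  assumes \<omega>: "\<omega> \<in> mspace Xh"
  shows "radon_measure A (mm \<omega>)" "\<And>u. u \<noteq> [] \<Longrightarrow> emeasure (mm \<omega>) (cyl u) = ennreal (Kx (one u) \<omega>)"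
proof -
  let ?P = "\<lambda>m. radon_measure A m \<and> (\<forall>f\<in>Cc A. (\<integral>x. f x \<partial>m) = Kx f \<omega>)"
  obtain m where m: "?P m" using martin_measure_exists[OF \<omega>] by blast
  have "m' = m" if m': "?P m'" for m'
  proof (rule measure_eq_on_cylinders)
    show "sets m' = sets B" "sets m = sets B" using m m' by (auto simp: radon_measure_def)
    show "emeasure m' (cyl u) = emeasure m (cyl u)" if "u \<noteq> []" for u
    proof -
      have "(\<integral>x. one u x \<partial>m') = (\<integral>x. one u x \<partial>m)" using m m' one_in_Cc[OF that] by metis
      then show ?thesis using m m' radon_cylinder[OF _ that] by (simp only:)
    qed
    show "emeasure m' (cyl [a]) \<noteq> \<infinity>" for a
      using m' by (simp add: radon_cylinder)
  qed
  then have mm: "?P (mm \<omega>)" unfolding martin_measure_def using m by (intro theI[of ?P m])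
  then show "radon_measure A (mm \<omega>)" by blast
  show "emeasure (mm \<omega>) (cyl u) = ennreal (Kx (one u) \<omega>)" if "u \<noteq> []" for u
  proof -
    have "(\<integral>x. one u x \<partial>mm \<omega>) = Kx (one u) \<omega>" using mm one_in_Cc[OF that] by blast
    then show ?thesis using mm radon_cylinder[OF _ that] by (simp only:)
  qed
qed

lemma sets_martin_measure: "\<omega> \<in> mspace Xh \<Longrightarrow> sets (mm \<omega>) = sets B"
  using martin_measure(1) by (simp add: radon_measure_def)

text \<open>Every boundary measure thus gives mass 1 to \<open>cyl [orig]\<close>. This is why
  \<open>\<nu>\<close> is recovered by counting only the orbits that start in
  \<open>cyl [orig]\<close>.\<close>

lemma Kx_orig:
  assumes \<omega>: "\<omega> \<in> mspace Xh"
  shows "Kx (one [orig]) \<omega> = 1"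
proof -
  obtain y where y: "\<And>n. y n \<in> X" "limitin Tp (\<lambda>n. e (y n)) \<omega> sequentially"
    using approximating_sequence[OF \<omega>] by blast
  have "(\<lambda>n. K (one [orig]) (y n)) \<longlonglongrightarrow> Kx (one [orig]) \<omega>"
    by (rule kernel_extension_limit[OF one_in_Cc y(2,1)]) simp
  then have "(\<lambda>n. 1) \<longlonglongrightarrow> Kx (one [orig]) \<omega>" by (simp only: K_orig[OF y(1)])
  then show ?thesis by (simp add: LIMSEQ_const_iff)
qed

section \<open>Convergence of orbits to a minimal boundary point\<close>

lemma Bd_subset: "\<omega> \<in> Bd \<Longrightarrow> \<omega> \<in> mspace Xh"
  by (simp add: martin_boundary_def)

lemma orbit_limit_unique:
  "orbit_tends_to Xh e x \<omega> \<Longrightarrow> orbit_tends_to Xh e x \<omega>' \<Longrightarrow> \<omega> = \<omega>'"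
  unfolding orbit_tends_to_def Tp_eq by (rule H.limitin_metric_unique) auto

text \<open>The orbit is compared with a sequence \<open>y\<close> in \<open>X\<close> that
  converges to \<open>\<omega>\<close>. Their kernels have the same limits, and their indicator
  terms vanish eventually because both sequences leave every letter.\<close>

lemma minimal_converges:
  assumes \<omega>: "\<omega> \<in> Bd\<^sub>m"
  shows "AE x in mm \<omega>. orbit_tends_to Xh e x \<omega>"
proof -
  have \<omega>B: "\<omega> \<in> Bd" and ext: "extremal_Conf A \<phi> lam (mm \<omega>)" using \<omega> by (auto simp: minimal_boundary_def)
  have \<omega>X: "\<omega> \<in> mspace Xh" using Bd_subset[OF \<omega>B] .
  interpret M: conformal A \<phi> lam orig "mm \<omega>"
    by unfold_locales (use ext in \<open>simp add: extremal_Conf_def\<close>)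
  obtain y where y: "\<And>n. y n \<in> X" "limitin Tp (\<lambda>n. e (y n)) \<omega> sequentially"
    using approximating_sequence[OF \<omega>X] by blast
  have one1: "emeasure (mm \<omega>) (cyl [orig]) = 1"
    using martin_measure(2)[OF \<omega>X, of "[orig]"] Kx_orig[OF \<omega>X] by simp
  have meas: "measure (mm \<omega>) (cyl u) = Kx (one u) \<omega>" if "u \<noteq> []" for u
    using martin_measure(2)[OF \<omega>X that] kernel_limit_nonneg[OF \<omega>X one_in_Cc[OF that]] by (simp add: measure_def)
  have "AE x in mm \<omega>. (\<lambda>n. K (one (w (Suc j))) ((shift ^^ n) x)) \<longlonglongrightarrow> Kx (one (w (Suc j))) \<omega>" for j
    using M.extremal_kernel_limit[OF ext word_nonempty one1, of "Suc j"] meas[OF word_nonempty, of "Suc j"] by simp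
  then have "AE x in mm \<omega>. \<forall>j. (\<lambda>n. K (one (w (Suc j))) ((shift ^^ n) x)) \<longlonglongrightarrow> Kx (one (w (Suc j))) \<omega>"
    by (subst AE_all_countable) blast
  then show ?thesis using M.escape
  proof (elim AE_mp, intro AE_I2 impI)
    fix x assume "x \<in> space (mm \<omega>)"
      and esc: "\<forall>a. finite {n. (shift ^^ n) x \<in> cyl [a]}"
      and Klim: "\<forall>j. (\<lambda>n. K (one (w (Suc j))) ((shift ^^ n) x)) \<longlonglongrightarrow> Kx (one (w (Suc j))) \<omega>"
    then have x: "x \<in> X" by simp
    have Tx: "(shift ^^ n) x \<in> X" for n by (rule shift_pow_in_tms[OF x])
    have "(\<lambda>n. \<rho> ((shift ^^ n) x) (y n)) \<longlonglongrightarrow> 0"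
    proof (rule rho_tendsto_0)
      fix i :: nat assume i: "i \<ge> 1"
      have "(\<lambda>n. K (one (w i)) ((shift ^^ n) x)) \<longlonglongrightarrow> Kx (one (w i)) \<omega>"
        using Klim[rule_format, of "i - 1"] i by simp
      moreover have "(\<lambda>n. K (one (w i)) (y n)) \<longlonglongrightarrow> Kx (one (w i)) \<omega>"
        by (rule kernel_extension_limit[OF one_in_Cc[OF word_nonempty[OF i]] y(2,1)])
      ultimately show "(\<lambda>n. K (one (w i)) ((shift ^^ n) x) - K (one (w i)) (y n)) \<longlonglongrightarrow> 0"
        using tendsto_diff by fastforce
      have sub: "cyl (w i) \<subseteq> cyl [hd (w i)]"
        using word_nonempty[OF i] by (auto simp: cylinder_def hd_conv_nth)
      have "\<forall>\<^sub>F n in sequentially. (shift ^^ n) x \<notin> cyl [hd (w i)]"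
        using esc by (simp add: eventually_cofinite cofinite_eq_sequentially[symmetric])
      moreover have "\<forall>\<^sub>F n in sequentially. y n \<notin> cyl [hd (w i)]"
        by (rule boundary_escape[OF y \<omega>B])
      ultimately have "\<forall>\<^sub>F n in sequentially. one (w i) ((shift ^^ n) x) - one (w i) (y n) = 0"
        by eventually_elim (use sub in \<open>auto simp: indicator_def\<close>)
      then show "(\<lambda>n. one (w i) ((shift ^^ n) x) - one (w i) (y n)) \<longlonglongrightarrow> 0"
        by (rule tendsto_eventually)
    qed (use Tx y in auto)
    then have r0: "(\<lambda>n. mdist Xh (e ((shift ^^ n) x)) (e (y n))) \<longlonglongrightarrow> 0"
      by (simp add: mdist_e[OF Tx y(1)])
    have y0: "(\<lambda>n. mdist Xh (e (y n)) \<omega>) \<longlonglongrightarrow> 0"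
      using y(2) unfolding Tp_eq H.limitin_metric_dist_null by blast
    have "(\<lambda>n. mdist Xh (e ((shift ^^ n) x)) \<omega>) \<longlonglongrightarrow> 0"
    proof (rule tendsto_sandwich[where f="\<lambda>_. 0"])
      show "\<forall>\<^sub>F n in sequentially. mdist Xh (e ((shift ^^ n) x)) \<omega> \<le> mdist Xh (e ((shift ^^ n) x)) (e (y n)) + mdist Xh (e (y n)) \<omega>"
        using H.triangle[OF e_in[OF Tx] e_in[OF y(1)] \<omega>X] by (intro always_eventually) auto
      show "(\<lambda>n. mdist Xh (e ((shift ^^ n) x)) (e (y n)) + mdist Xh (e (y n)) \<omega>) \<longlonglongrightarrow> 0"
        using tendsto_add[OF r0 y0] by simp
    qed (auto intro: tendsto_const)
    then show "orbit_tends_to Xh e x \<omega>"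
      unfolding orbit_tends_to_def Tp_eq H.limitin_metric_dist_null using \<omega>X e_in[OF Tx] by simp
  qed
qed

section \<open>Measurability of the limit\<close>

lemma rho_orbit_measurable [measurable]:
  "(\<lambda>x. \<rho> ((shift ^^ n) x) ((shift ^^ m) x)) \<in> borel_measurable B"
proof -
  have [measurable]: "K (one (w (Suc j))) \<in> borel_measurable B" for j
    by (rule K_one_measurable[OF word_nonempty]) simp
  show ?thesis unfolding rho_eq rho_term_def by measurable
qed

definition limit_in :: "'c set \<Rightarrow> (nat \<Rightarrow> 's) set" where
  "limit_in E = {x \<in> X. \<exists>\<omega>\<in>E. orbit_tends_to Xh e x \<omega>}"

text \<open>Completeness replaces the search for a limit, which ranges over an uncountable set, by
  countably many conditions on distances inside \<open>X\<close>; in this form the set of convergent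
  orbits is visibly measurable.\<close>

lemma orbit_Cauchy_iff:
  assumes x: "x \<in> X"
  shows "(\<exists>\<omega>\<in>mspace Xh. orbit_tends_to Xh e x \<omega>) \<longleftrightarrow>
    (\<forall>k::nat. \<exists>N. \<forall>n\<in>{N..}. \<forall>m\<in>{N..}. \<rho> ((shift ^^ n) x) ((shift ^^ m) x) < 1 / Suc k)"
proof -
  define \<sigma> where "\<sigma> n = e ((shift ^^ n) x)" for n
  have Tx: "(shift ^^ n) x \<in> X" for n by (rule shift_pow_in_tms[OF x])
  have \<sigma>: "range \<sigma> \<subseteq> mspace Xh" using e_in[OF Tx] by (auto simp: \<sigma>_def)
  have "(\<exists>\<omega>\<in>mspace Xh. orbit_tends_to Xh e x \<omega>) \<longleftrightarrow> H.MCauchy \<sigma>"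
  proof
    assume "\<exists>\<omega>\<in>mspace Xh. orbit_tends_to Xh e x \<omega>"
    then show "H.MCauchy \<sigma>"
      using H.convergent_imp_MCauchy[OF \<sigma>] by (auto simp: orbit_tends_to_def Tp_eq \<sigma>_def[abs_def])
  next
    assume "H.MCauchy \<sigma>"
    moreover have "H.mcomplete" using completion by (simp add: is_completion_def mcomplete_of_def)
    ultimately obtain \<omega> where "limitin H.mtopology \<sigma> \<omega> sequentially" by (auto simp: H.mcomplete_def)
    then show "\<exists>\<omega>\<in>mspace Xh. orbit_tends_to Xh e x \<omega>"
      by (intro bexI[of _ \<omega>]) (auto simp: orbit_tends_to_def Tp_eq \<sigma>_def[abs_def] H.limitin_metric)
  qed
  also have "\<dots> \<longleftrightarrow> (\<forall>k::nat. \<exists>N. \<forall>n\<in>{N..}. \<forall>m\<in>{N..}. mdist Xh (\<sigma> n) (\<sigma> m) < 1 / Suc k)"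
  proof
    assume "H.MCauchy \<sigma>"
    then show "\<forall>k::nat. \<exists>N. \<forall>n\<in>{N..}. \<forall>m\<in>{N..}. mdist Xh (\<sigma> n) (\<sigma> m) < 1 / Suc k"
      unfolding H.MCauchy_def by (metis atLeast_iff divide_pos_pos of_nat_0_less_iff zero_less_Suc zero_less_one)
  next
    assume *: "\<forall>k::nat. \<exists>N. \<forall>n\<in>{N..}. \<forall>m\<in>{N..}. mdist Xh (\<sigma> n) (\<sigma> m) < 1 / Suc k"
    show "H.MCauchy \<sigma>"
      unfolding H.MCauchy_def
    proof (intro conjI \<sigma> allI impI)
      fix r :: real assume "r > 0"
      then obtain k where k: "inverse (real (Suc k)) < r" using reals_Archimedean by blast
      obtain N where "\<forall>n\<in>{N..}. \<forall>m\<in>{N..}. mdist Xh (\<sigma> n) (\<sigma> m) < 1 / Suc k" using * by blast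
      then show "\<exists>N. \<forall>n n'. N \<le> n \<longrightarrow> N \<le> n' \<longrightarrow> mdist Xh (\<sigma> n) (\<sigma> n') < r"
        using k by (intro exI[of _ N]) (auto simp: inverse_eq_divide intro: less_trans)
    qed
  qed
  finally show ?thesis by (simp add: \<sigma>_def mdist_e[OF Tx Tx])
qed

text \<open>This uses the indicator terms of \<open>\<rho>\<close>: an orbit converging to
  \<open>e z\<close> would eventually stay in the letter of \<open>z\<close>.\<close>

lemma limit_not_in_shift_space:
  assumes x: "x \<in> X" and lim: "orbit_tends_to Xh e x \<omega>"
    and esc: "\<And>a. \<forall>\<^sub>F n in sequentially. (shift ^^ n) x \<notin> cyl [a]"
  shows "\<omega> \<in> Bd"
proof (rule ccontr)
  assume "\<omega> \<notin> Bd"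
  moreover have "\<omega> \<in> mspace Xh" using lim by (simp add: orbit_tends_to_def Tp_eq H.limitin_metric)
  ultimately obtain z where z: "z \<in> X" "\<omega> = e z" by (auto simp: martin_boundary_def)
  have Tx: "(shift ^^ n) x \<in> X" for n by (rule shift_pow_in_tms[OF x])
  have zc: "z \<in> cyl [z 0]" using z by (simp add: in_letter)
  then have "[z 0] \<in> admissible_words A" by (auto simp: admissible_words_def)
  then obtain c where c: "c > 0" "\<And>x y. x \<in> X \<Longrightarrow> y \<in> X \<Longrightarrow> \<bar>one [z 0] x - one [z 0] y\<bar> \<le> c * \<rho> x y"
    using rho_one_le by metis
  \<comment> \<open>Closer than \<open>1 / c\<close> the two indicators of \<open>cyl [z 0]\<close>
    differ by less than 1, so they are equal.\<close>
  have "1 / c > 0" using c by simp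
  then have "\<forall>\<^sub>F n in sequentially. e ((shift ^^ n) x) \<in> mspace Xh \<and> mdist Xh (e ((shift ^^ n) x)) \<omega> < 1 / c"
    using lim unfolding orbit_tends_to_def Tp_eq H.limitin_metric by blast
  then have "\<forall>\<^sub>F n in sequentially. False"
    using esc[of "z 0"]
  proof eventually_elim
    case (elim n)
    have "1 = \<bar>one [z 0] ((shift ^^ n) x) - one [z 0] z\<bar>" using elim(2) zc by simp
    also have "\<dots> \<le> c * \<rho> ((shift ^^ n) x) z" by (rule c(2)[OF Tx z(1)])
    also have "\<dots> < c * (1 / c)" using elim(1) c(1) unfolding z(2) mdist_e[OF Tx z(1)] by (intro mult_strict_left_mono) auto
    finally show ?case using c(1) by simp
  qed
  then show False by simp
qed

lemma limit_in_open_measurable: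
  assumes U: "openin Tp U"
  shows "limit_in (U \<inter> Bd) \<in> sets B"
proof -
  \<comment> \<open>Points at distance at least \<open>1 / Suc k\<close> from the complement of
    \<open>U\<close>. A convergent orbit has its limit in \<open>U\<close> exactly if it eventually
    stays in one of these sets; \<open>U\<close> itself would not do, since the limit could lie on
    its border.\<close>
  define F where "F k = {p \<in> mspace Xh. H.mball p (1 / Suc k) \<subseteq> U}" for k :: nat
  define D where "D = {x \<in> X. \<exists>\<omega>\<in>mspace Xh. orbit_tends_to Xh e x \<omega>}"
  define Esc where "Esc = {x \<in> X. \<forall>a. \<exists>N. \<forall>n\<in>{N..}. (shift ^^ n) x \<notin> cyl [a]}"
  define Fin where "Fin = {x \<in> X. \<exists>k N. \<forall>n\<in>{N..}. e ((shift ^^ n) x) \<in> F k}"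
  have D: "D \<in> sets B"
  proof -
    have "D = {x \<in> space B. \<forall>k::nat. \<exists>N. \<forall>n\<in>{N..}. \<forall>m\<in>{N..}. \<rho> ((shift ^^ n) x) ((shift ^^ m) x) < 1 / Suc k}"
      unfolding D_def space_B using orbit_Cauchy_iff by blast
    also have "\<dots> \<in> sets B" by measurable
    finally show ?thesis .
  qed
  have Esc: "Esc \<in> sets B"
  proof -
    \<comment> \<open>Turns the quantifier over letters into one over natural numbers, for which
      measurability is preserved.\<close>
    have all: "(\<forall>a. P a) \<longleftrightarrow> (\<forall>k. P (from_nat_into UNIV k))" for P :: "'s \<Rightarrow> bool"
      using from_nat_into_surj[OF countable_states] by (metis UNIV_I)
    have "Esc = {x \<in> space B. \<forall>k. \<exists>N. \<forall>n\<in>{N..}. (shift ^^ n) x \<notin> cyl [from_nat_into UNIV k]}"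
      unfolding Esc_def space_B by (subst all) simp
    also have "\<dots> \<in> sets B" by measurable
    finally show ?thesis .
  qed
  have eF: "{x \<in> X. e x \<in> F k} \<in> sets B" for k
  proof -
    \<comment> \<open>Within the completion, the complement of \<open>F k\<close> as a union of open
      balls, hence with an open preimage under \<open>e\<close>.\<close>
    define G where "G = (\<Union>q\<in>mspace Xh - U. H.mball q (1 / Suc k))"
    have "openin Tp G" unfolding G_def Tp_eq by (intro openin_Union) auto
    then have "openin (tms_top A) {x \<in> X. e x \<in> G}"
      using openin_continuous_map_preimage[OF e_continuous] by simp
    then have "X - {x \<in> X. e x \<in> G} \<in> sets B"
      using sets.compl_sets[OF openin_in_borel_on] by (metis space_B)
    moreover have "p \<in> F k \<longleftrightarrow> p \<notin> G" if "p \<in> mspace Xh" for p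
      using that by (auto simp: F_def G_def H.mball_def H.commute subset_iff)
    then have "{x \<in> X. e x \<in> F k} = X - {x \<in> X. e x \<in> G}" using e_in by auto
    ultimately show ?thesis by simp
  qed
  have Fin: "Fin \<in> sets B"
  proof -
    have "Fin = {x \<in> space B. \<exists>k N. \<forall>n\<in>{N..}. (shift ^^ n) x \<in> {x \<in> X. e x \<in> F k}}"
      unfolding Fin_def space_B using shift_pow_in_tms[of _ A] by blast
    also have "\<dots> \<in> sets B" using eF by measurable
    finally show ?thesis .
  qed
  have "limit_in (U \<inter> Bd) = D \<inter> Esc \<inter> Fin"
  proof (intro equalityI subsetI)
    fix x assume "x \<in> limit_in (U \<inter> Bd)"
    then obtain \<omega> where x: "x \<in> X" and \<omega>: "\<omega> \<in> U" "\<omega> \<in> Bd" and lim: "orbit_tends_to Xh e x \<omega>"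
      by (auto simp: limit_in_def)
    have Tx: "(shift ^^ n) x \<in> X" for n by (rule shift_pow_in_tms[OF x])
    have "x \<in> D" using x lim Bd_subset[OF \<omega>(2)] by (auto simp: D_def)
    moreover have "x \<in> Esc"
    proof -
      have "\<forall>a. \<exists>N. \<forall>n\<in>{N..}. (shift ^^ n) x \<notin> cyl [a]"
        using boundary_escape[OF Tx lim[unfolded orbit_tends_to_def] \<omega>(2)]
        unfolding eventually_sequentially by (meson atLeast_iff)
      then show ?thesis using x unfolding Esc_def by blast
    qed
    moreover have "x \<in> Fin"
    proof -
      obtain r where r: "r > 0" "H.mball \<omega> r \<subseteq> U"
        using U \<omega>(1) unfolding Tp_eq H.openin_mtopology by blast
      \<comment> \<open>Half of \<open>r\<close> is spent on the distance from the orbit point to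
        \<open>\<omega>\<close> and half on the radius of the ball around the orbit point.\<close>
      then obtain k where k: "inverse (real (Suc k)) < r / 2" using reals_Archimedean[of "r/2"] by auto
      have "\<forall>\<^sub>F n in sequentially. e ((shift ^^ n) x) \<in> mspace Xh \<and> mdist Xh (e ((shift ^^ n) x)) \<omega> < r / 2"
        using lim half_gt_zero[OF r(1)] unfolding orbit_tends_to_def Tp_eq H.limitin_metric by blast
      then obtain N where N: "\<And>n. n \<ge> N \<Longrightarrow> mdist Xh (e ((shift ^^ n) x)) \<omega> < r / 2"
        by (auto simp: eventually_sequentially)
      have "e ((shift ^^ n) x) \<in> F k" if n: "n \<ge> N" for n
      proof -
        have "q \<in> U" if q: "q \<in> mspace Xh" "mdist Xh (e ((shift ^^ n) x)) q < 1 / Suc k" for q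
        proof -
          have "mdist Xh \<omega> q \<le> mdist Xh (e ((shift ^^ n) x)) \<omega> + mdist Xh (e ((shift ^^ n) x)) q"
            using H.triangle[OF Bd_subset[OF \<omega>(2)] e_in[OF Tx] q(1)] by (simp only: H.commute[of \<omega>])
          also have "\<dots> < r / 2 + r / 2" using N[OF n] q(2) k by (intro add_strict_mono) (auto simp: inverse_eq_divide)
          finally show ?thesis using r(2) q(1) Bd_subset[OF \<omega>(2)] by (auto simp: H.mball_def subset_iff)
        qed
        then show ?thesis using e_in[OF Tx] by (auto simp: F_def)
      qed
      then show ?thesis using x by (auto simp: Fin_def)
    qed
    ultimately show "x \<in> D \<inter> Esc \<inter> Fin" by blast
  next
    fix x assume "x \<in> D \<inter> Esc \<inter> Fin"
    then have xD: "x \<in> D" "x \<in> Fin" and x: "x \<in> X"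
      and esc: "\<And>a. \<exists>N. \<forall>n\<in>{N..}. (shift ^^ n) x \<notin> cyl [a]"
      unfolding Esc_def by blast+
    obtain \<omega> where \<omega>: "\<omega> \<in> mspace Xh" and lim: "orbit_tends_to Xh e x \<omega>"
      using xD(1) unfolding D_def by blast
    obtain k N where N: "\<And>n. n \<ge> N \<Longrightarrow> e ((shift ^^ n) x) \<in> F k"
      using xD(2) unfolding Fin_def by auto
    have "\<omega> \<in> Bd"
    proof (rule limit_not_in_shift_space[OF x lim])
      show "\<forall>\<^sub>F n in sequentially. (shift ^^ n) x \<notin> cyl [a]" for a
        using esc[of a] unfolding eventually_sequentially by (meson atLeast_iff)
    qed
    moreover have "\<omega> \<in> U"
    proof -
      \<comment> \<open>One orbit point in \<open>F k\<close> at distance less than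
        \<open>1 / Suc k\<close> from \<open>\<omega>\<close> already forces \<open>\<omega>\<close>
        into \<open>U\<close>.\<close>
      have "1 / real (Suc k) > 0" by simp
      then have "\<forall>\<^sub>F n in sequentially. e ((shift ^^ n) x) \<in> mspace Xh \<and> mdist Xh (e ((shift ^^ n) x)) \<omega> < 1 / real (Suc k)"
        using lim unfolding orbit_tends_to_def Tp_eq H.limitin_metric by blast
      then obtain n where n: "n \<ge> N" "mdist Xh (e ((shift ^^ n) x)) \<omega> < 1 / real (Suc k)"
        by (auto simp: eventually_sequentially) (metis nle_le)
      show ?thesis using N[OF n(1)] n(2) \<omega> by (auto simp: F_def H.mball_def subset_iff)
    qed
    ultimately show "x \<in> limit_in (U \<inter> Bd)" using x lim by (auto simp: limit_in_def)
  qed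
  then show ?thesis using D Esc Fin by auto
qed

text \<open>Since limits are unique, \<open>limit_in\<close> respects complements within the
  boundary as well as countable unions, so measurability spreads from open sets to all Borel
  sets.\<close>

lemma limit_in_measurable:
  assumes E: "E \<in> sets (borel_on (subtopology Tp Bd))"
  shows "limit_in E \<in> sets B"
proof -
  have mB: "mspace Xh \<inter> Bd = Bd" using Bd_subset by auto
  then have top: "topspace (subtopology Tp Bd) = Bd" by simp
  have "E \<in> sigma_sets Bd {U. openin (subtopology Tp Bd) U}"
    using E by (simp add: sets_borel_on mB)
  then show ?thesis
  proof induction
    case (Basic U)
    then obtain V where "openin Tp V" "U = V \<inter> Bd" by (auto simp: openin_subtopology)
    then show ?case using limit_in_open_measurable by simp
  next
    case Empty
    then show ?case by (simp add: limit_in_def)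
  next
    case (Compl E)
    have "limit_in Bd \<in> sets B"
      using limit_in_open_measurable[of "mspace Xh"] openin_topspace[of Tp] by (simp add: mB)
    moreover have "limit_in (Bd - E) = limit_in Bd - limit_in E"
    proof -
      have "E \<subseteq> Bd" using sigma_sets_into_sp[OF _ Compl(1)] openin_subset top by blast
      then show ?thesis using orbit_limit_unique by (auto simp: limit_in_def) 
    qed
    ultimately show ?case using Compl by auto
  next
    case (Union D)
    have "limit_in (\<Union>i. D i) = (\<Union>i. limit_in (D i))" by (auto simp: limit_in_def)
    then show ?case using Union by auto
  qed
qed

section \<open>Disintegration\<close>

lemma Kx_one_bounded:
  assumes "u \<noteq> []"
  obtains c where "\<And>\<omega>. \<omega> \<in> mspace Xh \<Longrightarrow> Kx (one u) \<omega> \<le> c"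
proof -
  obtain c where c: "\<And>x. x \<in> X \<Longrightarrow> K (one u) x \<le> c" using K_one_bounded[OF assms] by blast
  have "Kx (one u) \<omega> \<le> c" if \<omega>: "\<omega> \<in> mspace Xh" for \<omega>
  proof -
    obtain y where y: "\<And>n. y n \<in> X" "limitin Tp (\<lambda>n. e (y n)) \<omega> sequentially"
      using approximating_sequence[OF \<omega>] by blast
    show ?thesis using c[OF y(1)]
      by (intro LIMSEQ_le_const2[OF kernel_extension_limit[OF one_in_Cc[OF assms] y(2,1)]]) auto
  qed
  then show ?thesis by (rule that)
qed

lemma Kx_measurable:
  assumes f: "f \<in> Cc A" and sets: "sets \<nu> = sets (borel_on (subtopology Tp Bd))"
  shows "Kx f \<in> borel_measurable \<nu>"
proof -
  have sp: "space \<nu> = Bd" using sets_eq_imp_space_eq[OF sets] Bd_subset by (auto simp: space_borel_on)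
  show ?thesis
  proof (rule borel_measurableI)
    fix S :: "real set" assume "open S"
    have "continuous_map (subtopology Tp Bd) euclideanreal (Kx f)"
      by (intro continuous_map_from_subtopology kernel_extension(1) f)
    from openin_continuous_map_preimage[OF this, of S] \<open>open S\<close>
    have "openin (subtopology Tp Bd) {\<omega> \<in> topspace (subtopology Tp Bd). Kx f \<omega> \<in> S}" by simp
    moreover have "{\<omega> \<in> topspace (subtopology Tp Bd). Kx f \<omega> \<in> S} = Kx f -` S \<inter> space \<nu>"
      using Bd_subset by (auto simp: sp)
    ultimately show "Kx f -` S \<inter> space \<nu> \<in> sets \<nu>" using openin_in_borel_on sets by metis
  qed
qed

text \<open>\<open>represents\<close> tests against \<open>Cc A\<close>, which contains the
  indicators of cylinders, and induction over the generated sigma-algebra does the rest.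
  Intersecting with a letter keeps all measures finite, so that they can be subtracted in the
  complement step.\<close>

lemma disintegration:
  assumes conf: "\<mu> \<in> Conf A \<phi> lam" and rep: "represents A \<phi> lam orig Xh e \<nu> \<mu>"
    and D: "D \<in> sets B"
  shows "(\<lambda>\<omega>. emeasure (mm \<omega>) (D \<inter> cyl [a])) \<in> borel_measurable \<nu> \<and>
    emeasure \<mu> (D \<inter> cyl [a]) = (\<integral>\<^sup>+\<omega>. emeasure (mm \<omega>) (D \<inter> cyl [a]) \<partial>\<nu>)"
proof -
  let ?M = "\<lambda>\<omega> E. emeasure (mm \<omega>) (E \<inter> cyl [a])"
  interpret conformal A \<phi> lam orig \<mu> by unfold_locales (rule conf)
  interpret N: finite_measure \<nu> using rep by (simp add: represents_def)
  have sets_nu: "sets \<nu> = sets (borel_on (subtopology Tp Bd))" using rep by (simp add: represents_def)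
  have sp: "space \<nu> = Bd" using sets_eq_imp_space_eq[OF sets_nu] Bd_subset by (auto simp: space_borel_on)
  define P where "P D \<longleftrightarrow> (\<lambda>\<omega>. emeasure (mm \<omega>) D) \<in> borel_measurable \<nu> \<and>
    emeasure \<mu> D = (\<integral>\<^sup>+\<omega>. emeasure (mm \<omega>) D \<partial>\<nu>)" for D
  have cyl: "P (cyl u)" if u: "u \<noteq> []" for u
  proof -
    have [measurable]: "Kx (one u) \<in> borel_measurable \<nu>" by (rule Kx_measurable[OF one_in_Cc[OF u] sets_nu])
    have eq: "emeasure (mm \<omega>) (cyl u) = ennreal (Kx (one u) \<omega>)" if "\<omega> \<in> space \<nu>" for \<omega>
      using martin_measure(2)[OF Bd_subset u] that sp by simp
    have meas: "(\<lambda>\<omega>. emeasure (mm \<omega>) (cyl u)) \<in> borel_measurable \<nu>"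
      by (subst measurable_cong[OF eq]) auto
    obtain c where c: "\<And>\<omega>. \<omega> \<in> mspace Xh \<Longrightarrow> Kx (one u) \<omega> \<le> c" using Kx_one_bounded[OF u] by blast
    have nn: "0 \<le> Kx (one u) \<omega>" if "\<omega> \<in> space \<nu>" for \<omega>
      using kernel_limit_nonneg[OF Bd_subset one_in_Cc[OF u]] that sp by simp
    have int: "integrable \<nu> (Kx (one u))"
      using c nn Bd_subset sp by (intro N.integrable_const_bound[of _ c]) auto
    have "radon_measure A \<mu>" using conf by (simp add: Conf_def)
    then have "emeasure \<mu> (cyl u) = ennreal (\<integral>x. one u x \<partial>\<mu>)" using u by (rule radon_cylinder)
    also have "(\<integral>x. one u x \<partial>\<mu>) = (\<integral>\<omega>. Kx (one u) \<omega> \<partial>\<nu>)"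
      using rep one_in_Cc[OF u] unfolding represents_def by blast
    also have "ennreal \<dots> = (\<integral>\<^sup>+\<omega>. ennreal (Kx (one u) \<omega>) \<partial>\<nu>)"
      using nn by (intro nn_integral_eq_integral[symmetric] int) auto
    also have "\<dots> = (\<integral>\<^sup>+\<omega>. emeasure (mm \<omega>) (cyl u) \<partial>\<nu>)"
      by (intro nn_integral_cong) (simp add: eq)
    finally show ?thesis using meas by (simp add: P_def)
  qed
  have empty: "P {}" by (simp add: P_def)
  have fin: "?M \<omega> D \<le> emeasure (mm \<omega>) (cyl [a])"
    "emeasure (mm \<omega>) (cyl [a]) < \<infinity>" if "\<omega> \<in> space \<nu>" for \<omega> D
  proof -
    have \<omega>: "\<omega> \<in> mspace Xh" using that sp Bd_subset by simp
    show "emeasure (mm \<omega>) (cyl [a]) < \<infinity>" using martin_measure(2)[OF \<omega>, of "[a]"] by simp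
    show "?M \<omega> D \<le> emeasure (mm \<omega>) (cyl [a])"
      by (intro emeasure_mono) (auto simp: sets_martin_measure[OF \<omega>])
  qed
  have "P (D \<inter> cyl [a])"
  proof -
    have sub: "cyls A \<subseteq> Pow X" using cylinder_subset by (auto simp: cyls_def)
    have "D \<in> sigma_sets X (cyls A)" using D by (simp add: sets_B)
    with Int_stable_cyls sub show ?thesis
    proof (induction rule: sigma_sets_induct_disjoint)
      case (basic E)
      show ?case
      proof (cases "E = {}")
        case False
        then obtain u where u: "u \<noteq> []" "E = cyl u" using basic by (auto simp: cyls_def)
        \<comment> \<open>Cylinders are nested or disjoint, so the intersection is empty or one of
          the two cylinders.\<close>
        show ?thesis using cylinder_Int[of A u "[a]"] cyl[OF u(1)] cyl[of "[a]"] empty unfolding u(2) by auto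
      qed (simp add: empty)
    next
      case empty
      show ?case using \<open>P {}\<close> by simp
    next
      case (compl E)
      have E [measurable]: "E \<in> sets B" using compl(1) by (simp add: sets_B)
      have Em: "E \<inter> cyl [a] \<in> sets B" by measurable
      have split: "emeasure m ((X - E) \<inter> cyl [a]) = emeasure m (cyl [a]) - emeasure m (E \<inter> cyl [a])"
        if "sets m = sets B" "emeasure m (cyl [a]) < \<infinity>" for m
      proof -
        have "(X - E) \<inter> cyl [a] = cyl [a] - E \<inter> cyl [a]"
          using cylinder_subset by auto
        moreover have "emeasure m (E \<inter> cyl [a]) \<noteq> \<infinity>"
          using emeasure_mono[of "E \<inter> cyl [a]" "cyl [a]" m] that by (auto simp: top_unique)
        ultimately show ?thesis using that Em by (simp add: emeasure_Diff)
      qed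
      have Pa: "P (cyl [a])" by (rule cyl) simp
      have [measurable]: "(\<lambda>\<omega>. emeasure (mm \<omega>) (cyl [a])) \<in> borel_measurable \<nu>"
        "(\<lambda>\<omega>. ?M \<omega> E) \<in> borel_measurable \<nu>"
        using Pa compl(2) by (auto simp: P_def)
      have eq: "?M \<omega> (X - E) =
          emeasure (mm \<omega>) (cyl [a]) - ?M \<omega> E" if "\<omega> \<in> space \<nu>" for \<omega>
        using that sp Bd_subset by (intro split sets_martin_measure fin) auto
      have "(\<integral>\<^sup>+\<omega>. ?M \<omega> (X - E) \<partial>\<nu>) =
        (\<integral>\<^sup>+\<omega>. emeasure (mm \<omega>) (cyl [a]) - ?M \<omega> E \<partial>\<nu>)"
        by (intro nn_integral_cong eq)
      also have "\<dots> = (\<integral>\<^sup>+\<omega>. emeasure (mm \<omega>) (cyl [a]) \<partial>\<nu>) - (\<integral>\<^sup>+\<omega>. ?M \<omega> E \<partial>\<nu>)"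
      proof (rule nn_integral_diff)
        have "(\<integral>\<^sup>+\<omega>. ?M \<omega> E \<partial>\<nu>) = emeasure \<mu> (E \<inter> cyl [a])"
          using compl(2) by (simp add: P_def)
        also have "\<dots> \<le> emeasure \<mu> (cyl [a])" by (intro emeasure_mono) (auto simp: sets_mu)
        also have "\<dots> < \<infinity>" by (rule finite_cylinder) simp
        finally show "(\<integral>\<^sup>+\<omega>. ?M \<omega> E \<partial>\<nu>) \<noteq> \<infinity>" by simp
      qed (use fin in auto)
      also have "\<dots> = emeasure \<mu> ((X - E) \<inter> cyl [a])"
        using Pa compl(2) split[OF sets_mu finite_cylinder] by (simp add: P_def)
      finally show ?case
        unfolding P_def by (subst measurable_cong[OF eq]) auto
    next
      case (union E)
      have E [measurable]: "E i \<in> sets B" for i using union(2) by (auto simp: sets_B)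
      have eq: "emeasure m ((\<Union>i. E i) \<inter> cyl [a]) = (\<Sum>i. emeasure m (E i \<inter> cyl [a]))"
        if "sets m = sets B" for m
      proof -
        have "(\<Union>i. E i) \<inter> cyl [a] = (\<Union>i. E i \<inter> cyl [a])" by auto
        then show ?thesis using that union(1)
          by (simp only:) (intro suminf_emeasure[symmetric], auto simp: disjoint_family_on_def)
      qed
      have mE [measurable]: "(\<lambda>\<omega>. ?M \<omega> (E i)) \<in> borel_measurable \<nu>" for i
        using union(3) by (simp add: P_def)
      have eqm: "?M \<omega> (\<Union>i. E i) = (\<Sum>i. ?M \<omega> (E i))"
        if "\<omega> \<in> space \<nu>" for \<omega>
        using that sp Bd_subset by (intro eq sets_martin_measure) auto
      have "(\<integral>\<^sup>+\<omega>. ?M \<omega> (\<Union>i. E i) \<partial>\<nu>) =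
         (\<integral>\<^sup>+\<omega>. (\<Sum>i. ?M \<omega> (E i)) \<partial>\<nu>)"
        by (intro nn_integral_cong eqm)
      also have "\<dots> = (\<Sum>i. \<integral>\<^sup>+\<omega>. ?M \<omega> (E i) \<partial>\<nu>)"
        by (rule nn_integral_suminf) (rule mE)
      also have "\<dots> = (\<Sum>i. emeasure \<mu> (E i \<inter> cyl [a]))" using union(3) by (simp add: P_def)
      also have "\<dots> = emeasure \<mu> ((\<Union>i. E i) \<inter> cyl [a])" by (rule eq[OF sets_mu, symmetric])
      finally show ?case
        unfolding P_def by (subst measurable_cong[OF eqm]) auto
    qed
  qed
  then show ?thesis by (simp add: P_def)
qed

lemma convergence_to_boundary:
  assumes conf: "\<mu> \<in> Conf A \<phi> lam" and rep: "represents A \<phi> lam orig Xh e \<nu> \<mu>"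
  shows "AE x in \<mu>. \<exists>\<omega>\<in>Bd\<^sub>m. orbit_tends_to Xh e x \<omega>"
proof -
  interpret conformal A \<phi> lam orig \<mu> by unfold_locales (rule conf)
  have sets_nu: "sets \<nu> = sets (borel_on (subtopology Tp Bd))" using rep by (simp add: represents_def)
  have sp: "space \<nu> = Bd" using sets_eq_imp_space_eq[OF sets_nu] Bd_subset by (auto simp: space_borel_on)
  have "AE \<omega> in \<nu>. \<omega> \<in> Bd\<^sub>m" using rep by (simp add: represents_def)
  then obtain N where N: "{\<omega> \<in> space \<nu>. \<omega> \<notin> Bd\<^sub>m} \<subseteq> N"
    "emeasure \<nu> N = 0" "N \<in> sets \<nu>" by (rule AE_E)
  \<comment> \<open>A Borel subset of \<open>Bd\<^sub>m\<close> with full measure. It takes the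
    place of \<open>Bd\<^sub>m\<close> so that \<open>limit_in_measurable\<close> applies.\<close>
  define E where "E = Bd - N"
  have E: "E \<in> sets \<nu>" using sets.compl_sets[OF N(3)] by (simp add: E_def sp)
  have E_min: "\<omega> \<in> Bd\<^sub>m" if "\<omega> \<in> E" for \<omega> using that N(1) sp by (auto simp: E_def)
  have AE_E: "AE \<omega> in \<nu>. \<omega> \<in> E"
    using N(2,3) sp by (intro AE_I[of _ _ N]) (auto simp: E_def)
  have Z [measurable]: "limit_in E \<in> sets B" using limit_in_measurable E sets_nu by simp
  have Zc: "X - limit_in E \<in> sets B" using sets.compl_sets[OF Z] by simp
  have "emeasure \<mu> ((X - limit_in E) \<inter> cyl [a]) = 0" for a
  proof -
    have "emeasure \<mu> ((X - limit_in E) \<inter> cyl [a]) = (\<integral>\<^sup>+\<omega>. emeasure (mm \<omega>) ((X - limit_in E) \<inter> cyl [a]) \<partial>\<nu>)"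
      using disintegration[OF conf rep Zc] by blast
    also have "\<dots> = (\<integral>\<^sup>+\<omega>. 0 \<partial>\<nu>)"
    proof (rule nn_integral_cong_AE, rule AE_mp[OF AE_E], intro AE_I2 impI)
      fix \<omega> assume \<omega>: "\<omega> \<in> E"
      have \<omega>X: "\<omega> \<in> mspace Xh" using \<omega> Bd_subset by (simp add: E_def)
      have s: "sets (mm \<omega>) = sets B" by (rule sets_martin_measure[OF \<omega>X])
      have spm: "space (mm \<omega>) = X" using sets_eq_imp_space_eq[OF s] by simp
      have "AE x in mm \<omega>. x \<notin> (X - limit_in E) \<inter> cyl [a]"
        using minimal_converges[OF E_min[OF \<omega>]]
        by (rule AE_mp) (use \<omega> in \<open>auto intro!: AE_I2 simp: limit_in_def spm\<close>)
      then show "emeasure (mm \<omega>) ((X - limit_in E) \<inter> cyl [a]) = 0"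
        using Zc by (subst (asm) AE_iff_measurable[of "(X - limit_in E) \<inter> cyl [a]"]) (auto simp: s spm)
    qed
    finally show ?thesis by simp
  qed
  then have "AE x in \<mu>. x \<notin> X - limit_in E" by (rule null_letters[OF Zc])
  then show ?thesis
    by (rule AE_mp) (use E_min in \<open>auto intro!: AE_I2 simp: limit_in_def\<close>)
qed

text \<open>For a minimal \<open>\<omega>\<close> almost every orbit converges to
  \<open>\<omega>\<close> alone, so its measure gives \<open>limit_in E \<inter> cyl [orig]\<close>
  the mass 1 or 0 according to whether \<open>\<omega>\<close> is in \<open>E\<close>. Integrating
  this indicator over \<open>\<nu>\<close> yields the claim.\<close>

lemma boundary_measure_eq:
  assumes conf: "\<mu> \<in> Conf A \<phi> lam" and rep: "represents A \<phi> lam orig Xh e \<nu> \<mu>"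
    and E: "E \<in> sets (borel_on (subtopology Tp Bd))"
  shows "limit_in E \<inter> cyl [orig] \<in> sets \<mu>"
    "emeasure \<nu> E = emeasure \<mu> (limit_in E \<inter> cyl [orig])"
proof -
  interpret conformal A \<phi> lam orig \<mu> by unfold_locales (rule conf)
  have sets_nu: "sets \<nu> = sets (borel_on (subtopology Tp Bd))" using rep by (simp add: represents_def)
  have sp: "space \<nu> = Bd" using sets_eq_imp_space_eq[OF sets_nu] Bd_subset by (auto simp: space_borel_on)
  have Z [measurable]: "limit_in E \<in> sets B" by (rule limit_in_measurable[OF E])
  show "limit_in E \<inter> cyl [orig] \<in> sets \<mu>" by (simp add: sets_mu)
  have min: "AE \<omega> in \<nu>. \<omega> \<in> Bd\<^sub>m" using rep by (simp add: represents_def)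
  have "emeasure \<mu> (limit_in E \<inter> cyl [orig]) = (\<integral>\<^sup>+\<omega>. emeasure (mm \<omega>) (limit_in E \<inter> cyl [orig]) \<partial>\<nu>)"
    using disintegration[OF conf rep Z] by blast
  also have "\<dots> = (\<integral>\<^sup>+\<omega>. indicator E \<omega> \<partial>\<nu>)"
  proof (rule nn_integral_cong_AE, rule AE_mp[OF min], intro AE_I2 impI)
    fix \<omega> assume "\<omega> \<in> space \<nu>" and \<omega>: "\<omega> \<in> Bd\<^sub>m"
    then have \<omega>X: "\<omega> \<in> mspace Xh" using sp Bd_subset by simp
    have s: "sets (mm \<omega>) = sets B" by (rule sets_martin_measure[OF \<omega>X])
    have spm: "space (mm \<omega>) = X" using sets_eq_imp_space_eq[OF s] by simp
    note conv = minimal_converges[OF \<omega>]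
    show "emeasure (mm \<omega>) (limit_in E \<inter> cyl [orig]) = indicator E \<omega>"
    proof (cases "\<omega> \<in> E")
      case True
      have "emeasure (mm \<omega>) (limit_in E \<inter> cyl [orig]) = emeasure (mm \<omega>) (cyl [orig])"
      proof (rule emeasure_eq_AE)
        show "AE x in mm \<omega>. x \<in> limit_in E \<inter> cyl [orig] \<longleftrightarrow> x \<in> cyl [orig]"
          using conv by (rule AE_mp) (use True in \<open>auto intro!: AE_I2 simp: limit_in_def spm\<close>)
      qed (auto simp: s)
      then show ?thesis using True martin_measure(2)[OF \<omega>X, of "[orig]"] Kx_orig[OF \<omega>X] by simp
    next
      case False
      have "emeasure (mm \<omega>) (limit_in E \<inter> cyl [orig]) = emeasure (mm \<omega>) {}"
      proof (rule emeasure_eq_AE)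
        show "AE x in mm \<omega>. x \<in> limit_in E \<inter> cyl [orig] \<longleftrightarrow> x \<in> {}"
        proof (rule AE_mp[OF conv], intro AE_I2 impI)
          fix x assume "orbit_tends_to Xh e x \<omega>"
          then have "x \<notin> limit_in E" using False orbit_limit_unique[of x \<omega>] unfolding limit_in_def by blast
          then show "x \<in> limit_in E \<inter> cyl [orig] \<longleftrightarrow> x \<in> {}" by simp
        qed
      qed (auto simp: s)
      then show ?thesis using False by simp
    qed
  qed
  also have "\<dots> = emeasure \<nu> E" using E sets_nu by (intro nn_integral_indicator) simp
  finally show "emeasure \<nu> E = emeasure \<mu> (limit_in E \<inter> cyl [orig])" by simp
qed

end

theorem theorem4p1:
  fixes A :: "'s \<Rightarrow> 's \<Rightarrow> bool"
    and \<phi> :: "(nat \<Rightarrow> 's) \<Rightarrow> real"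
    and lam :: real
    and orig :: 's
    and w :: "nat \<Rightarrow> 's list"
    and C :: "nat \<Rightarrow> real"
    and Xh :: "'c metric"
    and e :: "(nat \<Rightarrow> 's) \<Rightarrow> 'c"
    and \<mu> :: "(nat \<Rightarrow> 's) measure"
    and \<nu> :: "'c measure"
  assumes "countable (UNIV :: 's set)" and "infinite (UNIV :: 's set)"
    and "transitive_tms A" and "locally_compact_tms A"
    and "lam > 0"
    and "summable_variations A \<phi>"
    and "transient A \<phi> lam"
    and "w ` {1..} = admissible_words A"
    and "\<And>i. i \<ge> 1 \<Longrightarrow> C i > 0"
    and "\<And>i x. i \<ge> 1 \<Longrightarrow> x \<in> tms A \<Longrightarrow>
          martin_kernel A \<phi> lam orig (indicator (cylinder A (w i))) x \<le> C i"
    and "is_completion (tms A) (martin_dist A \<phi> lam orig w C) Xh e"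
    and "\<mu> \<in> Conf A \<phi> lam"
    and "represents A \<phi> lam orig Xh e \<nu> \<mu>"
  shows "(AE x in \<mu>. \<exists>\<omega> \<in> minimal_boundary A \<phi> lam orig Xh e. orbit_tends_to Xh e x \<omega>) \<and>
    (\<forall>\<omega> \<in> minimal_boundary A \<phi> lam orig Xh e.
        \<mu> = martin_measure A \<phi> lam orig Xh e \<omega> \<longrightarrow> (AE x in \<mu>. orbit_tends_to Xh e x \<omega>)) \<and>
    (\<forall>E \<in> sets (borel_on (subtopology (mtopology_of Xh) (martin_boundary A Xh e))).
        {x \<in> cylinder A [orig]. \<exists>\<omega> \<in> E. orbit_tends_to Xh e x \<omega>} \<in> sets \<mu> \<and>
        emeasure \<nu> E = emeasure \<mu> {x \<in> cylinder A [orig]. \<exists>\<omega> \<in> E. orbit_tends_to Xh e x \<omega>})"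
proof -
  interpret martin_compactification A \<phi> lam orig w C Xh e
    by unfold_locales (use assms in auto)
  have eq: "{x \<in> cylinder A [orig]. \<exists>\<omega>\<in>E. orbit_tends_to Xh e x \<omega>} = limit_in E \<inter> cylinder A [orig]" for E
    using cylinder_subset by (auto simp: limit_in_def)
  show ?thesis
    unfolding eq
  proof (intro conjI ballI impI)
    fix \<omega> assume \<omega>: "\<omega> \<in> minimal_boundary A \<phi> lam orig Xh e"
      and eq\<mu>: "\<mu> = martin_measure A \<phi> lam orig Xh e \<omega>"
    show "AE x in \<mu>. orbit_tends_to Xh e x \<omega>"
      unfolding eq\<mu> by (rule minimal_converges[OF \<omega>])
  qed (use convergence_to_boundary[OF assms(12,13)] boundary_measure_eq[OF assms(12,13)] in simp_all)
qed

end
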